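(* Let $0<t_*<T$, and let ${\bf D}$ be a compact subset of $\{\vec a=(a_0,\dots,a_N):a_0,a_N>0,\ a_1,\dots,a_{N-1}\ge0\}$. For $\vec a_1,\vec a_2\in{\bf D}$, let $(\rho_i,m_i)$, $i=1,2$, be the solutions of the weak problem $$(m_i,z)+(K(|\nabla\rho_i|,\vec a_i)\nabla\rho_i,z)=0\quad\forall z\in H(\mathrm{div},\Omega),$$ $$(\phi\rho_{i,t},r)-(m_i,\nabla r)=(f,r)-\langle\psi,r\rangle\quad\forall r\in H^1(\Omega),$$ with the same $f$, the same boundary data $\psi$ and the same initial data $\rho_i(\cdot,0)=\rho^0$. Then there exists a positive constant $C$ independent of $|\vec a_1-\vec a_2|$ such that $$\|\rho_1-\rho_2\|_{L^\infty(I;L^2(\Omega))}+\|m_1-m_2\|_{L^\infty(t_*,T;L^2(\Omega))}^2\le C|\vec a_1-\vec a_2|.$$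
   Context: Nonlinearity: $N\ge1$ and real exponents $0=\alpha_0<\alpha_1<\dots<\alpha_N$ are fixed; for an admissible coefficient vector $\vec a$, $g(s,\vec a)=\sum_{i=0}^N a_is^{\alpha_i}$ for $s\ge0$, and $K(\xi,\vec a)=1/g(s(\xi,\vec a),\vec a)$ for $\xi\ge0$, where $s(\xi,\vec a)$ is the unique non-negative solution $s$ of $s\,g(s,\vec a)=\xi$. Domain and data: $\Omega\subset\mathbb R^d$, $d\ge2$, is a bounded domain with boundary $\Gamma$ (regular enough for the trace theorem); $0<T<\infty$, $I=(0,T)$; $\phi\in C^1(\Omega)$ with $0<\phi_*<\phi(x)<\phi^*$ for constants $\phi_*,\phi^*$; $\rho^0$ on $\Omega$ and $\psi$ on $\Gamma\times(0,T)$ are smooth, and $f$ on $\Omega\times(0,T)$ satisfies $f,f_t\in L^2(I;L^2(\Omega))$. $(\cdot,\cdot)$ is the inner product of $L^2(\Omega)$ or $(L^2(\Omega))^d$, $\langle\cdot,\cdot\rangle$ that of $L^2(\Gamma)$. Solutions are maps $(m,\rho):I\to H(\mathrm{div},\Omega)\times H^1(\Omega)$, assumed sufficiently regular in $x$ and $t$. The constant $C$ may depend on ${\bf D}$, the exponents, $d$, $\Omega$, $\phi$, $T$, $t_*$ and the data $f,\psi,\rho^0$. *)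

theory Defs
  imports "HOL-Analysis.Analysis" "HOL-Probability.Essential_Supremum"
begin

section \<open>The Forchheimer nonlinearity\<close>

(* A coefficient vector (a_0,...,a_N) is a function nat => real vanishing beyond N, so that the
   (product) topology on nat => real induces the usual topology of R^(N+1) on these vectors. *)
definition admissible_coeffs :: "nat \<Rightarrow> (nat \<Rightarrow> real) set" where
  "admissible_coeffs N =
     {a. a 0 > 0 \<and> a N > 0 \<and> (\<forall>i\<in>{1..<N}. a i \<ge> 0) \<and> (\<forall>i>N. a i = 0)}"

definition coeff_dist :: "nat \<Rightarrow> (nat \<Rightarrow> real) \<Rightarrow> (nat \<Rightarrow> real) \<Rightarrow> real" where
  "coeff_dist N a b = L2_set (\<lambda>i. a i - b i) {..N}"

(* The summand i = 0, where the exponent alpha 0 is 0, is split off because s^0 = 1 for all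
   s >= 0, whereas 0 powr 0 = 0 in HOL. *)
definition forch_g :: "nat \<Rightarrow> (nat \<Rightarrow> real) \<Rightarrow> real \<Rightarrow> (nat \<Rightarrow> real) \<Rightarrow> real" where
  "forch_g N \<alpha> s a = a 0 + (\<Sum>i=1..N. a i * s powr \<alpha> i)"

definition forch_s :: "nat \<Rightarrow> (nat \<Rightarrow> real) \<Rightarrow> real \<Rightarrow> (nat \<Rightarrow> real) \<Rightarrow> real" where
  "forch_s N \<alpha> \<xi> a = (THE s. s \<ge> 0 \<and> s * forch_g N \<alpha> s a = \<xi>)"

definition forch_K :: "nat \<Rightarrow> (nat \<Rightarrow> real) \<Rightarrow> real \<Rightarrow> (nat \<Rightarrow> real) \<Rightarrow> real" where
  "forch_K N \<alpha> \<xi> a = 1 / forch_g N \<alpha> (forch_s N \<alpha> \<xi> a) a"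

section \<open>Smooth functions and test functions\<close>

primrec Ck_on :: "nat \<Rightarrow> 'a::euclidean_space set \<Rightarrow> ('a \<Rightarrow> real) \<Rightarrow> bool" where
  "Ck_on 0 U f \<longleftrightarrow> continuous_on U f"
| "Ck_on (Suc n) U f \<longleftrightarrow>
     (\<forall>x\<in>U. f differentiable (at x)) \<and>
     (\<forall>v. Ck_on n U (\<lambda>x. frechet_derivative f (at x) v))"

definition smooth_on :: "'a::euclidean_space set \<Rightarrow> ('a \<Rightarrow> real) \<Rightarrow> bool" where
  "smooth_on U f \<longleftrightarrow> (\<forall>n. Ck_on n U f)"

definition test_function :: "'a::euclidean_space set \<Rightarrow> ('a \<Rightarrow> real) \<Rightarrow> bool" where
  "test_function U \<eta> \<longleftrightarrow>
     smooth_on UNIV \<eta> \<and> compact (closure {x. \<eta> x \<noteq> 0}) \<and> closure {x. \<eta> x \<noteq> 0} \<subseteq> U"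

section \<open>Lebesgue and Sobolev spaces\<close>

definition in_Lp :: "'a measure \<Rightarrow> real \<Rightarrow> ('a \<Rightarrow> 'b::euclidean_space) \<Rightarrow> bool" where
  "in_Lp M p u \<longleftrightarrow> u \<in> borel_measurable M \<and> integrable M (\<lambda>x. norm (u x) powr p)"

definition Lp_norm :: "'a measure \<Rightarrow> real \<Rightarrow> ('a \<Rightarrow> 'b::euclidean_space) \<Rightarrow> real" where
  "Lp_norm M p u = (\<integral>x. norm (u x) powr p \<partial>M) powr (1 / p)"

definition L2_inner :: "'a measure \<Rightarrow> ('a \<Rightarrow> 'b::euclidean_space) \<Rightarrow> ('a \<Rightarrow> 'b) \<Rightarrow> real" where
  "L2_inner M u v = (\<integral>x. u x \<bullet> v x \<partial>M)"

definition L2_tendsto ::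
    "'a measure \<Rightarrow> (real \<Rightarrow> 'a \<Rightarrow> 'b::euclidean_space) \<Rightarrow> ('a \<Rightarrow> 'b) \<Rightarrow> real filter \<Rightarrow> bool" where
  "L2_tendsto M u v F \<longleftrightarrow> ((\<lambda>s. Lp_norm M 2 (\<lambda>x. u s x - v x)) \<longlongrightarrow> 0) F"

(* w is the distributional derivative of u on U in the direction v. *)
definition weak_deriv ::
    "'a::euclidean_space set \<Rightarrow> 'a \<Rightarrow> ('a \<Rightarrow> real) \<Rightarrow> ('a \<Rightarrow> real) \<Rightarrow> bool" where
  "weak_deriv U v u w \<longleftrightarrow>
     (\<forall>\<eta>. test_function U \<eta> \<longrightarrow>
        (\<integral>x. u x * frechet_derivative \<eta> (at x) v \<partial>lebesgue_on U)
          = - (\<integral>x. w x * \<eta> x \<partial>lebesgue_on U))"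

definition weak_gradient ::
    "(real^'d) set \<Rightarrow> (real^'d \<Rightarrow> real) \<Rightarrow> (real^'d \<Rightarrow> real^'d) \<Rightarrow> bool" where
  "weak_gradient U u G \<longleftrightarrow> (\<forall>i. weak_deriv U (axis i 1) u (\<lambda>x. G x $ i))"

(* u belongs to W^{1,p}(U) and G represents its gradient, which is unique up to null sets. *)
definition sobolev ::
    "(real^'d) set \<Rightarrow> real \<Rightarrow> (real^'d \<Rightarrow> real) \<Rightarrow> (real^'d \<Rightarrow> real^'d) \<Rightarrow> bool" where
  "sobolev U p u G \<longleftrightarrow>
     in_Lp (lebesgue_on U) p u \<and> in_Lp (lebesgue_on U) p G \<and> weak_gradient U u G"

definition classical_gradient :: "(real^'d \<Rightarrow> real) \<Rightarrow> real^'d \<Rightarrow> real^'d" where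
  "classical_gradient \<eta> x = (\<chi> i. frechet_derivative \<eta> (at x) (axis i 1))"

definition in_Hdiv :: "(real^'d) set \<Rightarrow> (real^'d \<Rightarrow> real^'d) \<Rightarrow> bool" where
  "in_Hdiv U z \<longleftrightarrow> in_Lp (lebesgue_on U) 2 z \<and>
     (\<exists>q. in_Lp (lebesgue_on U) 2 q \<and>
        (\<forall>\<eta>. test_function U \<eta> \<longrightarrow>
           (\<integral>x. z x \<bullet> classical_gradient \<eta> x \<partial>lebesgue_on U)
             = - (\<integral>x. q x * \<eta> x \<partial>lebesgue_on U)))"

section \<open>Surface measure and trace operator\<close>

definition hausdorff_pre :: "real \<Rightarrow> real \<Rightarrow> 'a::metric_space set \<Rightarrow> ennreal" where
  "hausdorff_pre s \<delta> A =
     (INF E \<in> {E :: nat \<Rightarrow> 'a set.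
               A \<subseteq> (\<Union>i. E i) \<and> (\<forall>i. bounded (E i) \<and> diameter (E i) \<le> \<delta>)}.
        \<Sum>i. ennreal (unit_ball_vol s * (diameter (E i) / 2) powr s))"

definition hausdorff_outer :: "real \<Rightarrow> 'a::metric_space set \<Rightarrow> ennreal" where
  "hausdorff_outer s A = (SUP \<delta> \<in> {0<..}. hausdorff_pre s \<delta> A)"

(* The (d-1)-dimensional Hausdorff measure on the Borel subsets of S, with the normalisation
   that gives surface area. The Hausdorff outer measure is a metric outer measure, hence
   countably additive on the Borel sets, as measure_of requires. *)
definition surface_measure :: "(real^'d) set \<Rightarrow> (real^'d) measure" where
  "surface_measure S =
     restrict_space
       (measure_of UNIV (sets borel) (hausdorff_outer (real (CARD('d) - 1)))) S"

(* The trace theorem on U: tr is linear and bounded from W^{1,p}(U) to L^p of the boundary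
   for all 1 <= p < infinity, and is the restriction to the boundary for functions that are
   continuous up to the boundary. Since U is bounded, W^{1,1}(U) contains all W^{1,p}(U). *)
definition trace_operator ::
    "(real^'d) set \<Rightarrow> ((real^'d \<Rightarrow> real) \<Rightarrow> (real^'d \<Rightarrow> real)) \<Rightarrow> bool" where
  "trace_operator U tr \<longleftrightarrow>
     (\<forall>u v G H c. sobolev U 1 u G \<longrightarrow> sobolev U 1 v H \<longrightarrow>
        (AE x in surface_measure (frontier U).
           tr (\<lambda>y. u y + c * v y) x = tr u x + c * tr v x)) \<and>
     (\<forall>p\<ge>1. \<exists>C. \<forall>u G. sobolev U p u G \<longrightarrow>
        in_Lp (surface_measure (frontier U)) p (tr u) \<and>
        Lp_norm (surface_measure (frontier U)) p (tr u)
          \<le> C * (Lp_norm (lebesgue_on U) p u + Lp_norm (lebesgue_on U) p G)) \<and>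
     (\<forall>u G. sobolev U 1 u G \<longrightarrow> continuous_on (closure U) u \<longrightarrow>
        (AE x in surface_measure (frontier U). tr u x = u x))"

section \<open>Data and weak solutions\<close>

(* f and its weak time derivative are in L^2(0,T; L^2(U)), identified with L^2(U x (0,T)). *)
definition source_data :: "(real^'d) set \<Rightarrow> real \<Rightarrow> (real \<Rightarrow> real^'d \<Rightarrow> real) \<Rightarrow> bool" where
  "source_data U T f \<longleftrightarrow>
     in_Lp (lebesgue_on (U \<times> {0<..<T})) 2 (\<lambda>(x, t). f t x) \<and>
     (\<exists>ft. in_Lp (lebesgue_on (U \<times> {0<..<T})) 2 (\<lambda>(x, t). ft t x) \<and>
        weak_deriv (U \<times> {0<..<T}) (0, 1) (\<lambda>(x, t). f t x) (\<lambda>(x, t). ft t x))"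

(* Smoothness of psi on S x (0,T) is understood up to t = 0 and t = T, and S need not be a
   smooth surface: psi is smooth in a neighbourhood of S x [0,T]. *)
definition boundary_data :: "(real^'d) set \<Rightarrow> real \<Rightarrow> (real \<Rightarrow> real^'d \<Rightarrow> real) \<Rightarrow> bool" where
  "boundary_data S T \<psi> \<longleftrightarrow>
     (\<exists>V. open V \<and> S \<times> {0..T} \<subseteq> V \<and> smooth_on V (\<lambda>(x, t). \<psi> t x))"

(* rho is in C^1((0,T); H^1(U)) with time derivative rhot; G and Gt are their gradients. *)
definition C1_time_H1 ::
    "(real^'d) set \<Rightarrow> real \<Rightarrow> (real \<Rightarrow> real^'d \<Rightarrow> real) \<Rightarrow> (real \<Rightarrow> real^'d \<Rightarrow> real^'d) \<Rightarrow>
     (real \<Rightarrow> real^'d \<Rightarrow> real) \<Rightarrow> (real \<Rightarrow> real^'d \<Rightarrow> real^'d) \<Rightarrow> bool" where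
  "C1_time_H1 U T \<rho> G \<rho>t Gt \<longleftrightarrow>
     (\<forall>t\<in>{0<..<T}.
        sobolev U 2 (\<rho> t) (G t) \<and> sobolev U 2 (\<rho>t t) (Gt t) \<and>
        L2_tendsto (lebesgue_on U) (\<lambda>s x. (\<rho> s x - \<rho> t x) / (s - t)) (\<rho>t t) (at t) \<and>
        L2_tendsto (lebesgue_on U) (\<lambda>s x. (G s x - G t x) /\<^sub>R (s - t)) (Gt t) (at t) \<and>
        L2_tendsto (lebesgue_on U) \<rho>t (\<rho>t t) (at t) \<and>
        L2_tendsto (lebesgue_on U) Gt (Gt t) (at t))"

(* Solutions of the weak problem, with the regularity in time rho in
   C([0,T); L^2(U)) and C^1((0,T); H^1(U)). The source f t is determined only for almost
   every t, so the two equations are required for almost every t. *)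
definition weak_solution ::
    "nat \<Rightarrow> (nat \<Rightarrow> real) \<Rightarrow> (real^'d) set \<Rightarrow> ((real^'d \<Rightarrow> real) \<Rightarrow> (real^'d \<Rightarrow> real)) \<Rightarrow> real \<Rightarrow>
     (real^'d \<Rightarrow> real) \<Rightarrow> (real \<Rightarrow> real^'d \<Rightarrow> real) \<Rightarrow> (real \<Rightarrow> real^'d \<Rightarrow> real) \<Rightarrow> (real^'d \<Rightarrow> real) \<Rightarrow>
     (nat \<Rightarrow> real) \<Rightarrow> (real \<Rightarrow> real^'d \<Rightarrow> real^'d) \<Rightarrow> (real \<Rightarrow> real^'d \<Rightarrow> real) \<Rightarrow> bool" where
  "weak_solution N \<alpha> U tr T \<phi> f \<psi> \<rho>0 a m \<rho> \<longleftrightarrow>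
     (\<forall>t\<in>{0<..<T}. in_Hdiv U (m t)) \<and>
     in_Lp (lebesgue_on U) 2 \<rho>0 \<and> L2_tendsto (lebesgue_on U) \<rho> \<rho>0 (at_right 0) \<and>
     (\<exists>G \<rho>t Gt. C1_time_H1 U T \<rho> G \<rho>t Gt \<and>
        (AE t in lebesgue_on {0<..<T}.
           (\<forall>z. in_Hdiv U z \<longrightarrow>
              L2_inner (lebesgue_on U) (m t) z
              + L2_inner (lebesgue_on U) (\<lambda>x. forch_K N \<alpha> (norm (G t x)) a *\<^sub>R G t x) z = 0) \<and>
           (\<forall>r Gr. sobolev U 2 r Gr \<longrightarrow>
              L2_inner (lebesgue_on U) (\<lambda>x. \<phi> x * \<rho>t t x) r
              - L2_inner (lebesgue_on U) (m t) Gr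
              = L2_inner (lebesgue_on U) (f t) r
                - L2_inner (surface_measure (frontier U)) (\<psi> t) (tr r))))"

definition Linf_L2_norm ::
    "real \<Rightarrow> real \<Rightarrow> (real^'d) set \<Rightarrow> (real \<Rightarrow> real^'d \<Rightarrow> 'b::euclidean_space) \<Rightarrow> ereal" where
  "Linf_L2_norm t0 t1 U u =
     esssup (lebesgue_on {t0<..<t1}) (\<lambda>t. ereal (Lp_norm (lebesgue_on U) 2 (u t)))"

end

theory Submission
  imports Defs "HOL-Computational_Algebra.Polynomial"
begin

text \<open>
  Continuous dependence of generalised Forchheimer flow on the coefficients of its polynomial.

  The constitutive law \<open>m = - K(|\<nabla>\<rho>|) \<nabla>\<rho>\<close> is awkward because \<open>K\<close> is defined by inverting
  \<open>s g(s) = \<xi>\<close>. It becomes explicit when it is read backwards: the flux \<open>F = K(|y|) y\<close> has modulus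
  \<open>s\<close>, so \<open>y = g(|F|) F\<close>. Written in terms of the fluxes \<open>F\<^sub>1\<close>, \<open>F\<^sub>2\<close> of gradients \<open>y\<^sub>1\<close>, \<open>y\<^sub>2\<close>
  under coefficients \<open>a\<close> and \<open>b\<close>, monotonicity of \<open>g\<close> gives (lemma \<open>flux_monotone_coeffs\<close>)
  \<open>(F\<^sub>1 - F\<^sub>2) \<bullet> (y\<^sub>1 - y\<^sub>2) \<ge> c |F\<^sub>1 - F\<^sub>2|\<^sup>2 - C |a - b|\<^sup>2 (F\<^sub>2 \<bullet> y\<^sub>2)\<close>, where \<open>F\<^sub>2 \<bullet> y\<^sub>2\<close> is the energy
  density of the second solution. Testing the difference of the two problems with \<open>\<rho>\<^sub>1 - \<rho>\<^sub>2\<close>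
  therefore yields
  \<open>1/2 d/dt \<parallel>sqrt \<phi> (\<rho>\<^sub>1 - \<rho>\<^sub>2)\<parallel>\<^sup>2 + c \<parallel>m\<^sub>1 - m\<^sub>2\<parallel>\<^sup>2 \<le> C |a - b|\<^sup>2 \<integral> F\<^sub>2 \<bullet> \<nabla>\<rho>\<^sub>2\<close>.
  Integrated in time, and with the energy of a solution bounded by the data, this is a bound of order
  \<open>|a - b|\<close> for \<open>\<rho>\<^sub>1 - \<rho>\<^sub>2\<close> (lemma \<open>density_comparison\<close>). Read at a fixed time \<open>t > t\<^sub>*\<close>, with the time derivative moved
  to the right hand side, it bounds \<open>\<parallel>m\<^sub>1 - m\<^sub>2\<parallel>\<^sup>2\<close> by \<open>\<parallel>\<rho>\<^sub>1\<^sub>t - \<rho>\<^sub>2\<^sub>t\<parallel> \<parallel>\<rho>\<^sub>1 - \<rho>\<^sub>2\<parallel>\<close> plus terms of order \<open>|a - b|\<^sup>2\<close>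
  (lemma \<open>flux_comparison\<close>).

  What remains are bounds for a single solution that depend on the data only. The energy
  identity, with the boundary term controlled by the trace theorem in \<open>W(1,1)\<close>, bounds
  \<open>\<parallel>\<rho>\<parallel>\<close> and the time integral of the energy (\<open>energy_estimate\<close>). Testing with \<open>\<rho>\<^sub>t\<close>, started at a
  time at which the energy does not exceed its average, bounds the energy itself and
  \<open>\<integral> \<parallel>\<rho>\<^sub>t\<parallel>\<^sup>2\<close> away from \<open>t = 0\<close> (\<open>smoothing_estimate\<close>). Finally the equations at times \<open>t\<close> and
  \<open>t + h\<close> are subtracted and tested with \<open>\<rho>(t + h) - \<rho>(t)\<close>; after division by \<open>h\<^sup>2\<close> and \<open>h \<rightarrow> 0\<close>, again
  from a well chosen starting time, \<open>\<parallel>\<rho>\<^sub>t\<parallel>\<close> is bounded away from \<open>t = 0\<close>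
  (\<open>time_derivative_estimate\<close>).

  Two facts connect the distributional formulation with these computations. The first equation
  holds against all fields in \<open>H(div)\<close>, hence against test fields, and so determines the flux almost
  everywhere (\<open>Hdiv_orthogonal_zero\<close>). The weak time derivative of the source bounds
  its time increments in the mean square (\<open>weak_deriv_difference_quotient_L2\<close>). Both rest on the
  fundamental lemma of the calculus of variations (\<open>fundamental_lemma\<close>).
\<close>

section \<open>Algebra of the Forchheimer flux\<close>

text \<open>
  The modulus of the flux is the solution \<open>s\<close> of \<open>s g(s) = |y|\<close>. Hence
  \<open>y = g(|F|) F\<close>, where \<open>F\<close> is the flux of \<open>y\<close>: the inverse of
  this map is explicit although the map itself is not, and the estimates below are carried out in terms
  of the flux.
\<close>

definition forch_flux :: "nat \<Rightarrow> (nat \<Rightarrow> real) \<Rightarrow> (nat \<Rightarrow> real) \<Rightarrow> 'v::euclidean_space \<Rightarrow> 'v" where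
  "forch_flux N \<alpha> a y = forch_K N \<alpha> (norm y) a *\<^sub>R y"

text \<open>
  An antiderivative of \<open>s g(s)\<close>. As a function of \<open>|F|\<close> it is a convex
  potential for the inverse map \<open>F \<mapsto> g(|F|) F\<close>.
\<close>

definition forch_dual_potential :: "nat \<Rightarrow> (nat \<Rightarrow> real) \<Rightarrow> (nat \<Rightarrow> real) \<Rightarrow> real \<Rightarrow> real" where
  "forch_dual_potential N \<alpha> a s =
     a 0 * s\<^sup>2 / 2 + (\<Sum>i=1..N. a i * s powr (\<alpha> i + 2) / (\<alpha> i + 2))"

text \<open>
  The Legendre transform of the dual potential, evaluated at the maximiser. Its gradient is the flux;
  the definition through the flux makes this usable without differentiating \<open>K\<close>.
\<close>

definition forch_potential :: "nat \<Rightarrow> (nat \<Rightarrow> real) \<Rightarrow> (nat \<Rightarrow> real) \<Rightarrow> 'v::euclidean_space \<Rightarrow> real" where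
  "forch_potential N \<alpha> a y =
     forch_flux N \<alpha> a y \<bullet> y - forch_dual_potential N \<alpha> a (norm (forch_flux N \<alpha> a y))"

text \<open>
  A compact set of admissible coefficient vectors has a common positive lower bound
  \<open>\<delta>\<close> for the first and the last coefficient, and a common upper bound
  \<open>\<mu>\<close>. The constants below depend on the coefficients only through these two numbers.
\<close>

locale forchheimer =
  fixes N :: nat and \<alpha> :: "nat \<Rightarrow> real" and \<delta> \<mu> :: real
  assumes N_pos: "N \<ge> 1" and exp_pos: "\<And>i. i \<in> {1..N} \<Longrightarrow> 0 < \<alpha> i"
    and exp_le: "\<And>i. i \<in> {1..N} \<Longrightarrow> \<alpha> i \<le> \<alpha> N"
    and lo_pos: "0 < \<delta>" and up_pos: "0 < \<mu>"
begin

definition coeffs :: "(nat \<Rightarrow> real) set" where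
  "coeffs = {a. \<delta> \<le> a 0 \<and> \<delta> \<le> a N \<and> (\<forall>i\<le>N. 0 \<le> a i \<and> a i \<le> \<mu>)}"

text \<open>
  Up to constants, \<open>g\<close> equals this weight for all coefficient vectors under consideration,
  which makes \<open>g\<close> for different coefficient vectors comparable.
\<close>

definition wt :: "real \<Rightarrow> real" where "wt s = 1 + s powr \<alpha> N"

abbreviation "g \<equiv> forch_g N \<alpha>"
abbreviation "F \<equiv> forch_flux N \<alpha>"

lemma coeffsD:
  assumes "a \<in> coeffs"
  shows "\<delta> \<le> a 0" "\<delta> \<le> a N" "\<And>i. i \<le> N \<Longrightarrow> 0 \<le> a i" "\<And>i. i \<le> N \<Longrightarrow> a i \<le> \<mu>"
  using assms unfolding coeffs_def by auto

lemma exp_N_pos: "0 < \<alpha> N"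
  using exp_pos[of N] N_pos by auto

lemma wt_ge1: "1 \<le> wt s"
  by (simp add: wt_def)

lemma powr_le_wt:
  assumes "0 \<le> s" "i \<in> {1..N}"
  shows "s powr \<alpha> i \<le> wt s"
proof (cases "s \<le> 1")
  case True
  have "s powr \<alpha> i \<le> 1 powr \<alpha> i"
    using assms True exp_pos[OF assms(2)] by (intro powr_mono2) auto
  then show ?thesis by (simp add: wt_def add_increasing2)
next
  case False
  have "s powr \<alpha> i \<le> s powr \<alpha> N"
    using False exp_le[OF assms(2)] by (intro powr_mono) auto
  then show ?thesis by (simp add: wt_def)
qed

lemma g_ge: 
  assumes a: "a \<in> coeffs" and s: "0 \<le> s"
  shows "\<delta> * wt s \<le> g s a"
proof -
  have "\<delta> * s powr \<alpha> N \<le> a N * s powr \<alpha> N"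
    using coeffsD(2)[OF a] by (intro mult_right_mono) auto
  also have "\<dots> \<le> (\<Sum>i=1..N. a i * s powr \<alpha> i)"
    using N_pos coeffsD(3)[OF a] by (intro member_le_sum) auto
  finally show ?thesis
    using coeffsD(1)[OF a] by (simp add: forch_g_def wt_def algebra_simps)
qed

lemma g_ge_lo: "a \<in> coeffs \<Longrightarrow> 0 \<le> s \<Longrightarrow> \<delta> \<le> g s a"
  using g_ge[of a s] wt_ge1[of s] lo_pos by (smt (verit) mult_le_cancel_left1)

lemma g_pos: "a \<in> coeffs \<Longrightarrow> 0 \<le> s \<Longrightarrow> 0 < g s a"
  using g_ge_lo[of a s] lo_pos by linarith

lemma g_le:
  assumes a: "a \<in> coeffs" and s: "0 \<le> s"
  shows "g s a \<le> (real N + 1) * \<mu> * wt s"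
proof -
  have "(\<Sum>i=1..N. a i * s powr \<alpha> i) \<le> (\<Sum>i=1..N. \<mu> * wt s)"
    using coeffsD(3,4)[OF a] powr_le_wt[OF s] up_pos
    by (intro sum_mono mult_mono) auto
  moreover have "a 0 \<le> \<mu> * wt s"
    using coeffsD(4)[OF a, of 0] wt_ge1[of s] up_pos by (smt (verit) mult_le_cancel_left1 le0)
  ultimately show ?thesis
    by (simp add: forch_g_def algebra_simps)
qed

lemma coeff_diff_le: "i \<le> N \<Longrightarrow> \<bar>a i - b i\<bar> \<le> coeff_dist N a b"
  using member_le_L2_set[of "{..N}" i "\<lambda>i. \<bar>a i - b i\<bar>"]
  by (simp add: coeff_dist_def L2_set_def)

lemma coeff_dist_nonneg: "0 \<le> coeff_dist N a b"
  by (simp add: coeff_dist_def L2_set_nonneg)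

lemma coeff_dist_le:
  assumes "a \<in> coeffs" "b \<in> coeffs"
  shows "coeff_dist N a b \<le> (real N + 1) * \<mu>"
proof -
  have "coeff_dist N a b \<le> (\<Sum>i\<in>{..N}. \<bar>a i - b i\<bar>)"
    unfolding coeff_dist_def by (rule L2_set_le_sum_abs)
  also have "\<dots> \<le> (\<Sum>i\<in>{..N}. \<mu>)"
    using coeffsD(3,4)[OF assms(1)] coeffsD(3,4)[OF assms(2)]
    by (intro sum_mono) (smt (verit) atMost_iff)
  finally show ?thesis by (simp add: add.commute)
qed

lemma g_coeff_diff:
  assumes s: "0 \<le> s"
  shows "\<bar>g s a - g s b\<bar> \<le> (real N + 1) * coeff_dist N a b * wt s"
proof -
  have "g s a - g s b = (a 0 - b 0) + (\<Sum>i=1..N. (a i - b i) * s powr \<alpha> i)"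
    by (simp add: forch_g_def sum_subtractf algebra_simps)
  also have "\<bar>\<dots>\<bar> \<le> \<bar>a 0 - b 0\<bar> + (\<Sum>i=1..N. \<bar>(a i - b i) * s powr \<alpha> i\<bar>)"
    using sum_abs[of "\<lambda>i. (a i - b i) * s powr \<alpha> i" "{1..N}"] by linarith
  also have "\<dots> \<le> coeff_dist N a b * wt s + (\<Sum>i=1..N. coeff_dist N a b * wt s)"
  proof (intro add_mono sum_mono)
    show "\<bar>a 0 - b 0\<bar> \<le> coeff_dist N a b * wt s"
      using coeff_diff_le[of 0 a b] wt_ge1[of s] coeff_dist_nonneg[of a b]
      by (smt (verit) mult_le_cancel_left1 le0)
  next
    fix i assume "i \<in> {1..N}"
    then show "\<bar>(a i - b i) * s powr \<alpha> i\<bar> \<le> coeff_dist N a b * wt s"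
      unfolding abs_mult using coeff_diff_le[of i a b] powr_le_wt[OF s, of i] coeff_dist_nonneg[of a b]
      by (intro mult_mono) auto
  qed
  finally show ?thesis by (simp add: algebra_simps)
qed

lemma g_mono:
  assumes a: "a \<in> coeffs" and "0 \<le> s" "s \<le> t"
  shows "g s a \<le> g t a"
  unfolding forch_g_def using assms coeffsD(3)[OF a]
  by (auto intro!: sum_mono mult_left_mono powr_mono2 less_imp_le[OF exp_pos])

lemma continuous_sg:
  assumes a: "a \<in> coeffs"
  shows "continuous_on {0..b} (\<lambda>s. s * g s a)"
  unfolding forch_g_def using exp_pos
  by (intro continuous_on_mult continuous_on_add continuous_on_sum continuous_on_const
      continuous_on_id continuous_on_powr') (auto simp: exp_pos)

lemma forch_s_solves:
  assumes a: "a \<in> coeffs" and xi: "0 \<le> \<xi>"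
  shows "0 \<le> forch_s N \<alpha> \<xi> a" "forch_s N \<alpha> \<xi> a * g (forch_s N \<alpha> \<xi> a) a = \<xi>"
proof -
  have "\<exists>s\<ge>0. s \<le> \<xi> / \<delta> \<and> s * g s a = \<xi>"
  proof (rule IVT')
    show "0 * g 0 a \<le> \<xi>" using xi by simp
    show "0 \<le> \<xi> / \<delta>" using xi lo_pos by simp
    then show "\<xi> \<le> \<xi> / \<delta> * g (\<xi> / \<delta>) a"
      using g_ge_lo[OF a, of "\<xi> / \<delta>"] lo_pos
      by (smt (verit) mult_left_mono nonzero_eq_divide_eq)
  qed (rule continuous_sg[OF a])
  moreover have "s = t" if "0 \<le> s" "0 \<le> t" "s * g s a = \<xi>" "t * g t a = \<xi>" for s t
  proof -
    have *: False if "0 \<le> s" "s < t" "s * g s a = t * g t a" for s t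
    proof -
      have "s * g s a \<le> s * g t a" using that g_mono[OF a, of s t] by (intro mult_left_mono) auto
      also have "\<dots> < t * g t a" using that g_pos[OF a, of t] by (intro mult_strict_right_mono) auto
      finally show False using that by simp
    qed
    show ?thesis using *[of s t] *[of t s] that by (metis linorder_neqE)
  qed
  ultimately have "\<exists>!s. s \<ge> 0 \<and> s * g s a = \<xi>" by metis
  from theI'[OF this] show "0 \<le> forch_s N \<alpha> \<xi> a" "forch_s N \<alpha> \<xi> a * g (forch_s N \<alpha> \<xi> a) a = \<xi>"
    unfolding forch_s_def by auto
qed

lemma norm_flux:
  assumes a: "a \<in> coeffs"
  shows "norm (F a y) = forch_s N \<alpha> (norm y) a"
proof -
  let ?s = "forch_s N \<alpha> (norm y) a"
  have "0 \<le> ?s" "?s * g ?s a = norm y" using forch_s_solves[OF a] by auto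
  moreover have "0 < g ?s a" using g_pos[OF a] calculation by auto
  ultimately show ?thesis by (simp add: forch_flux_def forch_K_def field_simps)
qed

lemma flux_inverse:
  assumes a: "a \<in> coeffs"
  shows "y = g (norm (F a y)) a *\<^sub>R F a y"
proof -
  have "0 < g (norm (F a y)) a" using g_pos[OF a] by auto
  then show ?thesis
    unfolding norm_flux[OF a] by (simp add: forch_flux_def forch_K_def)
qed

lemma energy_eq:
  assumes a: "a \<in> coeffs"
  shows "F a y \<bullet> y = g (norm (F a y)) a * (norm (F a y))\<^sup>2"
  by (subst (2) flux_inverse[OF a, of y]) (simp add: power2_norm_eq_inner)

lemma energy_nonneg: "a \<in> coeffs \<Longrightarrow> 0 \<le> F a y \<bullet> y"
  using energy_eq[of a y] g_pos[of a "norm (F a y)"] by simp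

text \<open>
  Polarisation: the difference of the two sides is \<open>(k - l) (|p|\<^sup>2 - |q|\<^sup>2) /
  2\<close>. It is used with \<open>k = g(|p|)\<close> and \<open>l = g(|q|)\<close>, when the
  assumption is monotonicity of \<open>g\<close>.
\<close>

lemma inner_gradient_flux_ge:
  fixes p q :: "'v::euclidean_space"
  assumes "(k - l) * ((norm p)\<^sup>2 - (norm q)\<^sup>2) \<ge> 0"
  shows "(k + l) / 2 * (norm (p - q))\<^sup>2 \<le> (k *\<^sub>R p - l *\<^sub>R q) \<bullet> (p - q)"
proof -
  have "(k *\<^sub>R p - l *\<^sub>R q) \<bullet> (p - q) - (k + l) / 2 * (norm (p - q))\<^sup>2
      = (k - l) * ((norm p)\<^sup>2 - (norm q)\<^sup>2) / 2"
    by (simp add: power2_norm_eq_inner inner_diff_left inner_diff_right inner_commute field_simps)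
  then show ?thesis using assms by simp
qed

lemma g_diff_mono:
  assumes a: "a \<in> coeffs" and "0 \<le> s" "0 \<le> t"
  shows "0 \<le> (g s a - g t a) * (s\<^sup>2 - t\<^sup>2)"
proof (cases "s \<le> t")
  case True
  then show ?thesis using g_mono[OF a, of s t] assms
    by (intro mult_nonpos_nonpos) (auto intro: power_mono)
next
  case False
  then show ?thesis using g_mono[OF a, of t s] assms
    by (intro mult_nonneg_nonneg) (auto intro: power_mono)
qed

lemma flux_monotone_g:
  fixes y1 y2 :: "'v::euclidean_space"
  assumes a: "a \<in> coeffs"
  shows "(g (norm (F a y1)) a + g (norm (F a y2)) a) / 2 * (norm (F a y1 - F a y2))\<^sup>2
           \<le> (F a y1 - F a y2) \<bullet> (y1 - y2)"
proof -
  have "(g (norm (F a y1)) a + g (norm (F a y2)) a) / 2 * (norm (F a y1 - F a y2))\<^sup>2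
     \<le> (g (norm (F a y1)) a *\<^sub>R F a y1 - g (norm (F a y2)) a *\<^sub>R F a y2) \<bullet> (F a y1 - F a y2)"
    by (rule inner_gradient_flux_ge) (simp add: g_diff_mono[OF a])
  then show ?thesis
    unfolding flux_inverse[OF a, symmetric] by (simp add: inner_commute)
qed

text \<open>
  The inequality behind the theorem. In terms of the fluxes \<open>p\<close> and \<open>q\<close>, with
  moduli \<open>s\<close> and \<open>t\<close>, the inner product splits into a monotone part, in which
  \<open>g\<close> has the same coefficients \<open>a\<close> twice, and the error \<open>(g(t, a) -
  g(t, b)) q \<bullet> (p - q)\<close>. The error is at most \<open>|a - b|\<close> times the weight, so
  Young's inequality absorbs it in the part \<open>g(t, a) |p - q|\<^sup>2 / 2\<close> of the monotone
  term; the remainder is quadratic in \<open>|a - b|\<close> and proportional to the energy density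
  \<open>q \<bullet> y2\<close>.
\<close>

lemma flux_monotone_coeffs:
  fixes y1 y2 :: "'v::euclidean_space"
  assumes a: "a \<in> coeffs" and b: "b \<in> coeffs"
  shows "\<delta> / 2 * (norm (F a y1 - F b y2))\<^sup>2
           - (real N + 1)\<^sup>2 / (2 * \<delta>\<^sup>2) * (coeff_dist N a b)\<^sup>2 * (F b y2 \<bullet> y2)
         \<le> (F a y1 - F b y2) \<bullet> (y1 - y2)"
proof -
  define p q where "p = F a y1" and "q = F b y2"
  define s t where "s = norm p" and "t = norm q"
  define X where "X = norm (p - q)"
  define d where "d = (real N + 1) * coeff_dist N a b"
  have st: "0 \<le> s" "0 \<le> t" "0 \<le> X" by (auto simp: s_def t_def X_def)
  have y: "y1 = g s a *\<^sub>R p" "y2 = g t b *\<^sub>R q"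
    using flux_inverse[OF a, of y1] flux_inverse[OF b, of y2] by (auto simp: p_def q_def s_def t_def)
  have 1: "(g s a + g t a) / 2 * X\<^sup>2 \<le> (g s a *\<^sub>R p - g t a *\<^sub>R q) \<bullet> (p - q)"
    unfolding X_def by (rule inner_gradient_flux_ge) (use g_diff_mono[OF a st(1,2)] in \<open>simp add: s_def t_def\<close>)
  have eq: "(p - q) \<bullet> (y1 - y2) = (g s a *\<^sub>R p - g t a *\<^sub>R q) \<bullet> (p - q) + (g t a - g t b) * (q \<bullet> (p - q))"
    unfolding y by (simp add: algebra_simps inner_commute)
  have "\<bar>(g t a - g t b) * (q \<bullet> (p - q))\<bar> \<le> (d * wt t) * (t * X)"
    unfolding abs_mult d_def t_def X_def
    by (intro mult_mono g_coeff_diff Cauchy_Schwarz_ineq2) (auto simp: coeff_dist_nonneg wt_def)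
  also have "\<dots> \<le> \<delta> * wt t / 2 * X\<^sup>2 + d\<^sup>2 / (2 * \<delta>) * (wt t * t\<^sup>2)"
  proof -
    \<comment> \<open>Young's inequality, written as a square.\<close>
    have "0 \<le> wt t / (2 * \<delta>) * (\<delta> * X - d * t)\<^sup>2" using lo_pos wt_ge1[of t] by simp
    also have "\<dots> = \<delta> * wt t / 2 * X\<^sup>2 + d\<^sup>2 / (2 * \<delta>) * (wt t * t\<^sup>2) - (d * wt t) * (t * X)"
      using lo_pos by (simp add: power2_eq_square field_simps)
    finally show ?thesis by simp
  qed
  also have "\<dots> \<le> g t a / 2 * X\<^sup>2 + d\<^sup>2 / (2 * \<delta>) * (q \<bullet> y2 / \<delta>)"
  proof (intro add_mono mult_left_mono mult_right_mono)
    show "\<delta> * wt t / 2 \<le> g t a / 2" using g_ge[OF a st(2)] by simp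
    have "\<delta> * wt t * t\<^sup>2 \<le> g t b * t\<^sup>2" using g_ge[OF b st(2)] by (intro mult_right_mono) auto
    also have "g t b * t\<^sup>2 = q \<bullet> y2" using energy_eq[OF b, of y2] by (simp add: q_def t_def)
    finally show "wt t * t\<^sup>2 \<le> q \<bullet> y2 / \<delta>" using lo_pos by (simp add: field_simps)
  qed (use lo_pos in auto)
  finally have 2: "- (g t a / 2 * X\<^sup>2 + d\<^sup>2 / (2 * \<delta>) * (q \<bullet> y2 / \<delta>)) \<le> (g t a - g t b) * (q \<bullet> (p - q))"
    by linarith
  have "\<delta> / 2 * X\<^sup>2 \<le> g s a / 2 * X\<^sup>2"
    using g_ge_lo[OF a st(1)] by (intro mult_right_mono) auto
  moreover have "d\<^sup>2 / (2 * \<delta>) * (q \<bullet> y2 / \<delta>) = (real N + 1)\<^sup>2 / (2 * \<delta>\<^sup>2) * (coeff_dist N a b)\<^sup>2 * (q \<bullet> y2)"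
    using lo_pos by (simp add: d_def power_mult_distrib) (simp add: power2_eq_square field_simps)
  ultimately show ?thesis
    using 1 2 eq by (simp add: p_def[symmetric] q_def[symmetric] X_def[symmetric] algebra_simps add_divide_distrib)
qed

lemma flux_cocoercive:
  fixes y1 y2 :: "'v::euclidean_space"
  assumes a: "a \<in> coeffs"
  shows "\<delta> / 2 * (norm (F a y1 - F a y2))\<^sup>2 \<le> (F a y1 - F a y2) \<bullet> (y1 - y2)"
  using flux_monotone_coeffs[OF a a, of y1 y2] by (simp add: coeff_dist_def L2_set_def)

lemma flux_monotone:
  fixes y1 y2 :: "'v::euclidean_space"
  assumes a: "a \<in> coeffs"
  shows "0 \<le> (F a y1 - F a y2) \<bullet> (y1 - y2)"
  using flux_cocoercive[OF a, of y1 y2] lo_pos by (smt (verit) divide_nonneg_nonneg mult_nonneg_nonneg zero_le_power2)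

lemma flux_lipschitz:
  fixes y1 y2 :: "'v::euclidean_space"
  assumes a: "a \<in> coeffs"
  shows "norm (F a y1 - F a y2) \<le> 2 / \<delta> * norm (y1 - y2)"
proof -
  have "\<delta> / 2 * (norm (F a y1 - F a y2))\<^sup>2 \<le> norm (F a y1 - F a y2) * norm (y1 - y2)"
    using flux_cocoercive[OF a, of y1 y2] norm_cauchy_schwarz order_trans by blast
  then have *: "\<delta> / 2 * norm (F a y1 - F a y2) * norm (F a y1 - F a y2) \<le> norm (y1 - y2) * norm (F a y1 - F a y2)"
    by (simp add: power2_eq_square mult_ac)
  show ?thesis
  proof (cases "F a y1 = F a y2")
    case True
    then show ?thesis using lo_pos by simp
  next
    case False
    then have "\<delta> / 2 * norm (F a y1 - F a y2) \<le> norm (y1 - y2)"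
      using mult_right_le_imp_le[OF *] by simp
    then show ?thesis using lo_pos by (simp add: field_simps)
  qed
qed

lemma flux_zero: "F a 0 = 0"
  by (simp add: forch_flux_def)

lemma norm_flux_le:
  fixes y :: "'v::euclidean_space"
  shows "a \<in> coeffs \<Longrightarrow> norm (F a y) \<le> 2 / \<delta> * norm y"
  using flux_lipschitz[of a y 0] by (simp add: flux_zero)

lemma continuous_flux: "a \<in> coeffs \<Longrightarrow> continuous_on UNIV (F a :: 'v::euclidean_space \<Rightarrow> 'v)"
  using flux_lipschitz lo_pos
  by (intro lipschitz_on_continuous_on[where L="2/\<delta>"] lipschitz_onI) (auto simp: dist_norm)

text \<open>
  The derivative of \<open>x powr \<beta>\<close> is unbounded at \<open>0\<close> when \<open>\<beta> <
  1\<close>; the factor \<open>t\<close>, which lies below every intermediate point of the mean value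
  theorem, compensates for this.
\<close>

lemma powr_diff_bound:
  fixes s t \<beta> :: real
  assumes "0 \<le> t" "t \<le> s" "0 < \<beta>"
  shows "(s powr \<beta> - t powr \<beta>) * t \<le> \<beta> * s powr \<beta> * (s - t)"
proof (cases "t = 0 \<or> t = s")
  case True
  then show ?thesis using assms by auto
next
  case False
  then have "0 < t" "t < s" using assms by auto
  obtain z where z: "t < z" "z < s" "s powr \<beta> - t powr \<beta> = (s - t) * (\<beta> * z powr (\<beta> - 1))"
  proof -
    have "\<exists>z. z > t \<and> z < s \<and> s powr \<beta> - t powr \<beta> = (s - t) * (\<beta> * z powr (\<beta> - 1))"
    proof (rule MVT2[OF \<open>t < s\<close>])
      fix x assume "t \<le> x" "x \<le> s"
      then show "((\<lambda>x. x powr \<beta>) has_real_derivative \<beta> * x powr (\<beta> - 1)) (at x)"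
        using \<open>0 < t\<close> by (auto intro!: derivative_eq_intros)
    qed
    then show ?thesis using that by blast
  qed
  have "t * z powr (\<beta> - 1) \<le> z * z powr (\<beta> - 1)" using z by (intro mult_right_mono) auto
  also have "\<dots> = z powr \<beta>" using z \<open>0 < t\<close> by (simp add: powr_diff)
  also have "\<dots> \<le> s powr \<beta>" using z \<open>0 < t\<close> assms by (intro powr_mono2) auto
  finally have "(s - t) * \<beta> * (t * z powr (\<beta> - 1)) \<le> (s - t) * \<beta> * s powr \<beta>"
    using z assms by (intro mult_left_mono) auto
  then show ?thesis by (simp add: z algebra_simps)
qed

lemma g_diff_bound:
  assumes a: "a \<in> coeffs" and st: "0 \<le> t" "t \<le> s"
  shows "(g s a - g t a) * t \<le> \<alpha> N * g s a * (s - t)"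
proof -
  have "(g s a - g t a) * t = (\<Sum>i=1..N. a i * ((s powr \<alpha> i - t powr \<alpha> i) * t))"
    unfolding forch_g_def add_diff_cancel_left sum_subtractf[symmetric] sum_distrib_right
    by (simp add: algebra_simps)
  also have "\<dots> \<le> (\<Sum>i=1..N. a i * (\<alpha> N * s powr \<alpha> i * (s - t)))"
  proof (intro sum_mono mult_left_mono)
    fix i assume i: "i \<in> {1..N}"
    have "(s powr \<alpha> i - t powr \<alpha> i) * t \<le> \<alpha> i * s powr \<alpha> i * (s - t)"
      by (rule powr_diff_bound[OF st exp_pos[OF i]])
    also have "\<dots> \<le> \<alpha> N * s powr \<alpha> i * (s - t)"
      using st exp_le[OF i] by (intro mult_right_mono) auto
    finally show "(s powr \<alpha> i - t powr \<alpha> i) * t \<le> \<alpha> N * s powr \<alpha> i * (s - t)" .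
    show "0 \<le> a i" using i coeffsD(3)[OF a] by auto
  qed
  also have "\<dots> = \<alpha> N * (g s a - a 0) * (s - t)"
    by (simp add: forch_g_def sum_distrib_right sum_distrib_left algebra_simps)
  also have "\<dots> \<le> \<alpha> N * g s a * (s - t)"
    using st exp_N_pos coeffsD(1)[OF a] lo_pos by (intro mult_right_mono mult_left_mono) auto
  finally show ?thesis .
qed

text \<open>
  Coercivity in terms of the gradients. The flux is degenerate, so the constant grows like
  \<open>g\<close>. With \<open>s \<ge> t\<close> for the moduli, \<open>y1 - y2 = g(s) (p - q) + (g(s)
  - g(t)) q\<close>, and by \<open>g_diff_bound\<close> the second term is no larger than a multiple of
  the first.
\<close>

lemma gradient_diff_le:
  fixes y1 y2 :: "'v::euclidean_space"
  assumes a: "a \<in> coeffs"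
  shows "(norm (y1 - y2))\<^sup>2 \<le> 2 * (1 + \<alpha> N)\<^sup>2 * (g (norm (F a y1)) a + g (norm (F a y2)) a)
           * ((F a y1 - F a y2) \<bullet> (y1 - y2))"
proof -
  have *: "(norm (y1 - y2))\<^sup>2 \<le> 2 * (1 + \<alpha> N)\<^sup>2 * (g (norm (F a y1)) a + g (norm (F a y2)) a)
           * ((F a y1 - F a y2) \<bullet> (y1 - y2))"
    if le: "norm (F a y2) \<le> norm (F a y1)" for y1 y2 :: 'v
  proof -
    define p q where "p = F a y1" and "q = F a y2"
    define s t where "s = norm p" and "t = norm q"
    have st: "0 \<le> s" "0 \<le> t" "t \<le> s" using le by (auto simp: s_def t_def p_def q_def)
    have y: "y1 = g s a *\<^sub>R p" "y2 = g t a *\<^sub>R q"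
      using flux_inverse[OF a, of y1] flux_inverse[OF a, of y2] by (auto simp: p_def q_def s_def t_def)
    have gs: "0 < g s a" "0 < g t a" "0 \<le> g s a - g t a" using g_pos[OF a] g_mono[OF a] st by auto
    have "s - t \<le> norm (p - q)" unfolding s_def t_def by (rule norm_triangle_ineq2)
    then have "\<alpha> N * g s a * (s - t) \<le> \<alpha> N * g s a * norm (p - q)"
      using exp_N_pos gs by (intro mult_left_mono) auto
    then have 1: "(g s a - g t a) * t \<le> \<alpha> N * g s a * norm (p - q)"
      using g_diff_bound[OF a st(2,3)] by linarith
    have "y1 - y2 = g s a *\<^sub>R (p - q) + (g s a - g t a) *\<^sub>R q" unfolding y by (simp add: algebra_simps)
    then have "norm (y1 - y2) \<le> g s a * norm (p - q) + (g s a - g t a) * t"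
      using norm_triangle_ineq[of "g s a *\<^sub>R (p - q)" "(g s a - g t a) *\<^sub>R q"] gs by (simp add: t_def)
    also have "\<dots> \<le> (1 + \<alpha> N) * g s a * norm (p - q)" using 1 by (simp add: algebra_simps)
    finally have "(norm (y1 - y2))\<^sup>2 \<le> ((1 + \<alpha> N) * g s a * norm (p - q))\<^sup>2"
      by (intro power_mono) auto
    also have "\<dots> = (2 * (1 + \<alpha> N)\<^sup>2 * g s a) * (g s a / 2 * (norm (p - q))\<^sup>2)"
      by (simp add: power2_eq_square)
    also have "\<dots> \<le> (2 * (1 + \<alpha> N)\<^sup>2 * (g s a + g t a)) * ((p - q) \<bullet> (y1 - y2))"
    proof (intro mult_mono)
      have "g s a / 2 * (norm (p - q))\<^sup>2 \<le> (g s a + g t a) / 2 * (norm (p - q))\<^sup>2"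
        using gs by (intro mult_right_mono) auto
      then show "g s a / 2 * (norm (p - q))\<^sup>2 \<le> (p - q) \<bullet> (y1 - y2)"
        using flux_monotone_g[OF a, of y1 y2] unfolding p_def q_def s_def t_def by linarith
    qed (use gs exp_N_pos in auto)
    finally show ?thesis unfolding p_def q_def s_def t_def .
  qed
  show ?thesis
  proof (cases "norm (F a y2) \<le> norm (F a y1)")
    case True
    then show ?thesis by (rule *)
  next
    case False
    have "(F a y2 - F a y1) \<bullet> (y2 - y1) = (F a y1 - F a y2) \<bullet> (y1 - y2)"
      by (simp add: algebra_simps)
    then show ?thesis using *[of y1 y2] False by (simp add: norm_minus_commute add.commute)
  qed
qed

lemma g_le_energy:
  assumes a: "a \<in> coeffs"
  shows "g (norm (F a y)) a \<le> 2 * (real N + 1) * \<mu> + F a y \<bullet> y"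
proof -
  define s where "s = norm (F a y)"
  have s: "0 \<le> s" by (simp add: s_def)
  have E: "F a y \<bullet> y = g s a * s\<^sup>2" using energy_eq[OF a] by (simp add: s_def)
  have gs: "0 < g s a" using g_pos[OF a s] .
  show ?thesis
  proof (cases "s \<le> 1")
    case True
    have "g s a \<le> g 1 a" using g_mono[OF a s True] .
    also have "\<dots> \<le> 2 * (real N + 1) * \<mu>" using g_le[OF a, of 1] by (simp add: wt_def mult.commute mult.left_commute)
    finally show ?thesis using energy_nonneg[OF a, of y] by (simp add: s_def)
  next
    case False
    then have "g s a * 1 \<le> g s a * s\<^sup>2" using gs by (intro mult_left_mono) (auto intro: one_le_power)
    then show ?thesis using up_pos unfolding E s_def[symmetric] by (simp add: add_increasing)
  qed
qed

text \<open>
  The energy density is \<open>s |y|\<close> with \<open>s = |F|\<close>, so it dominates \<open>|y| /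
  \<epsilon>\<close> as soon as \<open>s \<ge> 1 / \<epsilon>\<close>, while \<open>|y| = s g(s)\<close>
  is bounded for smaller \<open>s\<close>. This superlinear growth is what absorbs the boundary terms.
\<close>

lemma norm_le_energy:
  assumes a: "a \<in> coeffs" and e: "0 < \<epsilon>"
  shows "norm y \<le> \<epsilon> * (F a y \<bullet> y) + (real N + 1) * \<mu> * wt (1 / \<epsilon>) / \<epsilon>"
proof -
  define s where "s = norm (F a y)"
  have s: "0 \<le> s" by (simp add: s_def)
  have E: "F a y \<bullet> y = g s a * s\<^sup>2" using energy_eq[OF a] by (simp add: s_def)
  have gs: "0 < g s a" using g_pos[OF a s] .
  have "norm y = norm (g s a *\<^sub>R F a y)" using flux_inverse[OF a, of y] by (simp add: s_def)
  then have y: "norm y = g s a * s" using gs by (simp add: s_def)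
  show ?thesis
  proof (cases "s \<le> 1 / \<epsilon>")
    case True
    have "g s a \<le> (real N + 1) * \<mu> * wt (1 / \<epsilon>)"
      using g_mono[OF a s True] g_le[OF a, of "1/\<epsilon>"] e by simp
    then have "g s a * s \<le> (real N + 1) * \<mu> * wt (1 / \<epsilon>) * (1 / \<epsilon>)"
      using s gs True by (intro mult_mono) auto
    then show ?thesis using energy_nonneg[OF a, of y] e by (simp add: y add_increasing)
  next
    case False
    then have "1 \<le> \<epsilon> * s" using e by (simp add: field_simps)
    then have "g s a * s * 1 \<le> g s a * s * (\<epsilon> * s)" using gs s by (intro mult_left_mono) auto
    then show ?thesis using up_pos wt_ge1[of "1/\<epsilon>"] e unfolding y E
      by (simp add: power2_eq_square algebra_simps add_increasing2)
  qed
qed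

lemma dual_potential_mult:
  assumes "0 \<le> s"
  shows "g s a * s\<^sup>2 = a 0 * s\<^sup>2 + (\<Sum>i=1..N. a i * s powr (\<alpha> i + 2))"
proof -
  have "s powr (\<alpha> i + 2) = s powr \<alpha> i * s\<^sup>2" for i
    using assms by (cases "s = 0") (auto simp: powr_add)
  then show ?thesis by (simp add: forch_g_def distrib_right sum_distrib_right mult.assoc)
qed

lemma dual_potential_bounds:
  assumes a: "a \<in> coeffs" and s: "0 \<le> s"
  shows "0 \<le> forch_dual_potential N \<alpha> a s" "forch_dual_potential N \<alpha> a s \<le> g s a * s\<^sup>2 / 2"
proof -
  have a0: "0 \<le> a 0" using coeffsD(3)[OF a, of 0] by simp
  show "0 \<le> forch_dual_potential N \<alpha> a s"
    unfolding forch_dual_potential_def using coeffsD(3)[OF a] a0 exp_pos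
    by (intro add_nonneg_nonneg sum_nonneg divide_nonneg_nonneg mult_nonneg_nonneg)
       (auto intro: less_imp_le add_nonneg_nonneg)
  have "(\<Sum>i=1..N. a i * s powr (\<alpha> i + 2) / (\<alpha> i + 2)) \<le> (\<Sum>i=1..N. a i * s powr (\<alpha> i + 2) / 2)"
    using coeffsD(3)[OF a] exp_pos by (intro sum_mono divide_left_mono) (auto simp: less_imp_le add_pos_pos)
  then show "forch_dual_potential N \<alpha> a s \<le> g s a * s\<^sup>2 / 2"
    unfolding dual_potential_mult[OF s] forch_dual_potential_def
    by (simp add: sum_divide_distrib add_divide_distrib)
qed

text \<open>
  The supporting line inequality, summand by summand, for the powers \<open>s powr (\<alpha> i +
  2)\<close>.
\<close>

lemma dual_potential_convex:
  assumes a: "a \<in> coeffs" and s: "0 \<le> s" "0 \<le> t"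
  shows "g t a * t * (s - t) \<le> forch_dual_potential N \<alpha> a s - forch_dual_potential N \<alpha> a t"
proof -
  have *: "t * t powr \<alpha> i * (s - t) \<le> s powr (\<alpha> i + 2) / (\<alpha> i + 2) - t powr (\<alpha> i + 2) / (\<alpha> i + 2)"
    if i: "i \<in> {1..N}" for i
  proof -
    define b where "b = \<alpha> i + 2"
    have b: "b > 2" using exp_pos[OF i] by (simp add: b_def)
    show ?thesis
    proof (cases "t = 0")
      case True
      then show ?thesis using b by (simp add: b_def[symmetric])
    next
      case False
      then have t: "0 < t" using s by simp
      have "convex_on {0<..} (\<lambda>x::real. x powr b)"
        proof (rule f''_ge0_imp_convex[where f'="\<lambda>x. b * x powr (b - 1)" and f''="\<lambda>x. b * ((b - 1) * x powr (b - 2))"])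
          fix x :: real assume x: "x \<in> {0<..}"
          show "((\<lambda>x. x powr b) has_real_derivative b * x powr (b - 1)) (at x)"
            using x by (auto intro!: derivative_eq_intros)
          have "((\<lambda>x. b * x powr (b - 1)) has_real_derivative b * ((b - 1) * x powr (b - 1 - 1))) (at x)"
            using x by (intro DERIV_cmult DERIV_fun_powr[where g="\<lambda>x. x", OF DERIV_ident, simplified]) auto
          then show "((\<lambda>x. b * x powr (b - 1)) has_real_derivative b * ((b - 1) * x powr (b - 2))) (at x)" by simp
          show "0 \<le> b * ((b - 1) * x powr (b - 2))" using b by auto
        qed auto
      then have c: "s powr b \<ge> t powr b + b * t powr (b - 1) * (s - t)"
      proof (cases "s = 0")
        case True
        have "b * t powr (b - 1) * t = b * t powr b" using t by (simp add: powr_diff)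
        moreover have "t powr b \<le> b * t powr b" using b by (simp add: mult_le_cancel_right1)
        ultimately show ?thesis using True b by (simp add: mult.assoc)
      next
        case False
        then have "s > 0" using s by simp
        have "((\<lambda>x. x powr b) has_real_derivative b * t powr (b - 1)) (at t within {0<..})"
          using t by (auto intro!: derivative_eq_intros)
        from convex_on_imp_above_tangent[OF \<open>convex_on {0<..} (\<lambda>x::real. x powr b)\<close> _ _ _ this, of s] 
        show ?thesis using t \<open>s > 0\<close> by (auto simp: interior_open algebra_simps)
      qed
      have "t powr (b - 1) = t * t powr \<alpha> i" using t by (simp add: b_def powr_add powr_diff power2_eq_square)
      with c have "b * (t * t powr \<alpha> i * (s - t)) \<le> s powr b - t powr b" by (simp add: mult.assoc)
      then show ?thesis using b unfolding b_def[symmetric]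
        by (simp add: diff_divide_distrib[symmetric] pos_le_divide_eq mult.commute)
    qed
  qed
  have "t * (s - t) \<le> s\<^sup>2 / 2 - t\<^sup>2 / 2"
    using zero_le_power2[of "s - t"] by (simp add: power2_eq_square algebra_simps)
  then have 0: "a 0 * (t * (s - t)) \<le> a 0 * (s\<^sup>2 / 2 - t\<^sup>2 / 2)"
    using coeffsD(3)[OF a, of 0] by (intro mult_left_mono) auto
  have 1: "(\<Sum>i=1..N. a i * (t * t powr \<alpha> i * (s - t)))
      \<le> (\<Sum>i=1..N. a i * (s powr (\<alpha> i + 2) / (\<alpha> i + 2) - t powr (\<alpha> i + 2) / (\<alpha> i + 2)))"
    using * coeffsD(3)[OF a] by (intro sum_mono mult_left_mono) auto
  have "g t a * t * (s - t) = a 0 * (t * (s - t)) + (\<Sum>i=1..N. a i * (t * t powr \<alpha> i * (s - t)))"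
    unfolding forch_g_def distrib_right sum_distrib_right by (simp add: mult_ac)
  also have "\<dots> \<le> forch_dual_potential N \<alpha> a s - forch_dual_potential N \<alpha> a t"
    using 0 1 by (simp add: forch_dual_potential_def right_diff_distrib sum_subtractf)
  finally show ?thesis .
qed

lemma potential_bounds:
  assumes a: "a \<in> coeffs"
  shows "F a y \<bullet> y / 2 \<le> forch_potential N \<alpha> a y" "forch_potential N \<alpha> a y \<le> F a y \<bullet> y"
  using dual_potential_bounds[OF a, of "norm (F a y)"] energy_eq[OF a, of y]
  by (auto simp: forch_potential_def)

text \<open>
  By Legendre duality the difference of the two sides is the gap in the supporting line inequality of
  the dual potential with the roles of the two points exchanged.
\<close>

lemma potential_convex:
  fixes y1 y2 :: "'v::euclidean_space"
  assumes a: "a \<in> coeffs"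
  shows "F a y1 \<bullet> (y2 - y1) \<le> forch_potential N \<alpha> a y2 - forch_potential N \<alpha> a y1"
proof -
  let ?s = "norm (F a y1)" and ?t = "norm (F a y2)"
  have "y2 \<bullet> (F a y1 - F a y2) = g ?t a * (F a y2 \<bullet> (F a y1 - F a y2))"
    by (subst (1) flux_inverse[OF a, of y2]) simp
  also have "F a y2 \<bullet> (F a y1 - F a y2) \<le> ?t * (?s - ?t)"
    using norm_cauchy_schwarz[of "F a y2" "F a y1"]
    by (simp add: inner_diff_right right_diff_distrib power2_norm_eq_inner[symmetric] power2_eq_square)
  then have "g ?t a * (F a y2 \<bullet> (F a y1 - F a y2)) \<le> g ?t a * (?t * (?s - ?t))"
    using g_pos[OF a, of ?t] by (intro mult_left_mono) auto
  also have "\<dots> \<le> forch_dual_potential N \<alpha> a ?s - forch_dual_potential N \<alpha> a ?t"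
    using dual_potential_convex[OF a, of ?s ?t] by (simp add: mult.assoc)
  finally show ?thesis by (simp add: forch_potential_def algebra_simps inner_commute)
qed

end

section \<open>Smooth functions and the fundamental lemma\<close>

lemma Ck_on_derivative:
  assumes "\<And>x. (f has_derivative f' x) (at x)" "\<And>v. Ck_on n UNIV (\<lambda>x. f' x v)"
  shows "Ck_on (Suc n) UNIV f"
proof -
  have "frechet_derivative f (at x) = f' x" for x
    using frechet_derivative_at[OF assms(1)] by simp
  then show ?thesis using assms by (auto simp: differentiable_def)
qed

lemma Ck_on_has_derivative:
  assumes "Ck_on (Suc n) UNIV f"
  shows "(f has_derivative frechet_derivative f (at x)) (at x)"
  using assms frechet_derivative_works by auto

lemma Ck_on_Suc_imp: "Ck_on (Suc n) U f \<Longrightarrow> Ck_on n U f"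
proof (induction n arbitrary: f)
  case 0
  then show ?case
    by (auto intro!: continuous_at_imp_continuous_on differentiable_imp_continuous_within)
next
  case (Suc n)
  then show ?case by (metis Ck_on.simps(2))
qed

lemma Ck_on_const: "Ck_on n UNIV (\<lambda>x::'a::euclidean_space. c)"
proof (induction n arbitrary: c)
  case (Suc n)
  show ?case by (rule Ck_on_derivative[where f'="\<lambda>_ _. 0"]) (use Suc in auto)
qed simp

lemma Ck_on_add:
  "Ck_on n UNIV f \<Longrightarrow> Ck_on n UNIV h \<Longrightarrow> Ck_on n UNIV (\<lambda>x. f x + h x)"
proof (induction n arbitrary: f h)
  case (Suc n)
  show ?case
  proof (rule Ck_on_derivative)
    show "((\<lambda>x. f x + h x) has_derivative
        (\<lambda>v. frechet_derivative f (at x) v + frechet_derivative h (at x) v)) (at x)" for x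
      using Suc.prems by (intro has_derivative_add Ck_on_has_derivative)
  qed (use Suc in auto)
qed (auto intro: continuous_on_add)

lemma Ck_on_mult:
  "Ck_on n UNIV f \<Longrightarrow> Ck_on n UNIV h \<Longrightarrow> Ck_on n UNIV (\<lambda>x. f x * h x)"
proof (induction n arbitrary: f h)
  case (Suc n)
  show ?case
  proof (rule Ck_on_derivative)
    show "((\<lambda>x. f x * h x) has_derivative
        (\<lambda>v. f x * frechet_derivative h (at x) v + frechet_derivative f (at x) v * h x)) (at x)" for x
      using Suc.prems by (intro has_derivative_mult Ck_on_has_derivative)
    show "Ck_on n UNIV (\<lambda>x. f x * frechet_derivative h (at x) v + frechet_derivative f (at x) v * h x)" for v
      using Suc.prems Ck_on_Suc_imp[OF Suc.prems(1)] Ck_on_Suc_imp[OF Suc.prems(2)]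
      by (intro Ck_on_add Suc.IH) auto
  qed
qed (auto intro: continuous_on_mult)

lemma smooth_on_mult:
  "smooth_on UNIV f \<Longrightarrow> smooth_on UNIV h \<Longrightarrow> smooth_on UNIV (\<lambda>x. f x * h x)"
  by (simp add: smooth_on_def Ck_on_mult)

lemma smooth_on_prod:
  "(\<And>i. i \<in> I \<Longrightarrow> smooth_on UNIV (f i)) \<Longrightarrow> smooth_on UNIV (\<lambda>x. \<Prod>i\<in>I. f i x)"
  by (induction I rule: infinite_finite_induct) (auto simp: smooth_on_def Ck_on_const Ck_on_mult)

lemma Ck_on_translate: "Ck_on n UNIV f \<Longrightarrow> Ck_on n UNIV (\<lambda>x. f (x + c))"
proof (induction n arbitrary: f)
  case (Suc n)
  show ?case
  proof (rule Ck_on_derivative)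
    have "((\<lambda>x. x + c) has_derivative (\<lambda>v. v)) (at x)" for x
      by (auto intro!: derivative_eq_intros)
    from has_derivative_compose[OF this Ck_on_has_derivative[OF Suc.prems]]
    show "((\<lambda>x. f (x + c)) has_derivative frechet_derivative f (at (x + c))) (at x)" for x .
    show "Ck_on n UNIV (\<lambda>x. frechet_derivative f (at (x + c)) v)" for v
      using Suc.prems by (intro Suc.IH) auto
  qed
next
  case 0
  have "continuous_on UNIV (\<lambda>x. x + c)" by (intro continuous_intros)
  with 0 show ?case by (simp add: continuous_on_compose2[where t=UNIV and g=f])
qed

text \<open>
  With \<open>p = 1\<close> this is the usual smooth function that vanishes to infinite order at
  \<open>0\<close>. The polynomial factor makes the family closed under differentiation, so that
  smoothness follows by induction.
\<close>

definition flat :: "real poly \<Rightarrow> real \<Rightarrow> real" where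
  "flat p t = (if 0 < t then poly p (1 / t) * exp (- (1 / t)) else 0)"

lemma flat_tendsto_0: "(flat p \<longlongrightarrow> 0) (at 0)"
proof -
  have "((\<lambda>x. poly p x * exp (- x)) \<longlongrightarrow> 0) at_top"
  proof -
    have "((\<lambda>x. \<Sum>i\<le>degree p. coeff p i * (x ^ i / exp x)) \<longlongrightarrow> (\<Sum>i\<le>degree p. coeff p i * 0)) at_top"
      by (intro tendsto_intros tendsto_power_div_exp_0)
    then show ?thesis by (simp add: poly_altdef sum_divide_distrib exp_minus divide_inverse sum_distrib_right mult.assoc)
  qed
  from filterlim_compose[OF this filterlim_inverse_at_top_right]
  have "((\<lambda>t. poly p (inverse t) * exp (- inverse t)) \<longlongrightarrow> 0) (at_right 0)" .
  then have "(flat p \<longlongrightarrow> 0) (at_right 0)"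
    by (rule Lim_transform_eventually)
      (auto simp: eventually_at_right_field flat_def inverse_eq_divide intro!: exI[of _ 1])
  moreover have "(flat p \<longlongrightarrow> 0) (at_left 0)"
    by (rule tendsto_eventually) (auto simp: eventually_at_left_field flat_def intro!: exI[of _ "-1"])
  ultimately show ?thesis by (simp add: filterlim_split_at)
qed

lemma flat_has_derivative:
  "(flat p has_real_derivative flat (monom 1 2 * (p - pderiv p)) t) (at t)"
proof -
  consider "t < 0" | "t = 0" | "t > 0" by linarith
  then show ?thesis
  proof cases
    case 1
    have "((\<lambda>_. 0) has_real_derivative 0) (at t)" by simp
    moreover have "eventually (\<lambda>x. 0 = flat p x) (nhds t)"
      using eventually_nhds_in_open[of "{..<0}" t] 1
      by (auto elim!: eventually_mono simp: flat_def)
    ultimately have "(flat p has_real_derivative 0) (at t)"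
      by (subst (asm) DERIV_cong_ev[OF refl _ refl]) auto
    then show ?thesis using 1 by (simp add: flat_def)
  next
    case 2
    have "(flat (pCons 0 p) \<longlongrightarrow> 0) (at 0)" by (rule flat_tendsto_0)
    moreover have "flat (pCons 0 p) = (\<lambda>h. (flat p (0 + h) - flat p 0) / h)"
      by (auto simp: flat_def)
    ultimately show ?thesis using 2 by (simp add: DERIV_def flat_def[of _ 0])
  next
    case 3
    have "((\<lambda>t. poly p (1 / t) * exp (- (1 / t))) has_real_derivative
        poly (pderiv p) (1 / t) * (- 1 / t\<^sup>2) * exp (- (1 / t))
        + poly p (1 / t) * (exp (- (1 / t)) * (1 / t\<^sup>2))) (at t)"
      using 3 by (auto intro!: derivative_eq_intros DERIV_chain2[OF poly_DERIV]
          simp: power2_eq_square field_simps)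
    moreover have "eventually (\<lambda>x. poly p (1 / x) * exp (- (1 / x)) = flat p x) (nhds t)"
      using eventually_nhds_in_open[of "{0<..}" t] 3
      by (auto elim!: eventually_mono simp: flat_def)
    moreover have "poly (pderiv p) (1 / t) * (- 1 / t\<^sup>2) * exp (- (1 / t))
        + poly p (1 / t) * (exp (- (1 / t)) * (1 / t\<^sup>2)) = flat (monom 1 2 * (p - pderiv p)) t"
      using 3 by (simp add: flat_def poly_monom power_one_over field_simps)
    ultimately show ?thesis
      by (subst (asm) DERIV_cong_ev[OF refl _ refl]) auto
  qed
qed

lemma smooth_on_flat: "smooth_on UNIV (\<lambda>z::'a::euclidean_space. flat p (c * (z \<bullet> u) + d))"
proof -
  have "Ck_on n UNIV (\<lambda>z::'a. flat p (c * (z \<bullet> u) + d))" for n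
  proof (induction n arbitrary: p)
    case 0
    have "continuous_on UNIV (flat p)"
      by (meson DERIV_isCont flat_has_derivative continuous_at_imp_continuous_on)
    then show ?case by (auto intro!: continuous_on_compose2[where t=UNIV and g="flat p"] continuous_intros)
  next
    case (Suc n)
    show ?case
    proof (rule Ck_on_derivative)
      have "((\<lambda>z. c * (z \<bullet> u) + d) has_derivative (\<lambda>v. c * (v \<bullet> u))) (at z)" for z :: 'a
        by (auto intro!: derivative_eq_intros)
      from has_derivative_compose[OF this flat_has_derivative[unfolded has_field_derivative_def]]
      show "((\<lambda>z. flat p (c * (z \<bullet> u) + d)) has_derivative
         (\<lambda>v. flat (monom 1 2 * (p - pderiv p)) (c * (z \<bullet> u) + d) * (c * (v \<bullet> u)))) (at z)" for z :: 'a .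
      show "Ck_on n UNIV (\<lambda>z. flat (monom 1 2 * (p - pderiv p)) (c * (z \<bullet> u) + d) * (c * (v \<bullet> u)))" for v :: 'a
        by (intro Ck_on_mult Ck_on_const Suc.IH)
    qed
  qed
  then show ?thesis by (simp add: smooth_on_def)
qed

text \<open>
  Since \<open>exp (- 1 / (n t))\<close> tends to \<open>1\<close> for \<open>t > 0\<close>, these
  functions increase to the indicator of the open box, and they vanish outside it.
\<close>

definition box_bump :: "'a::euclidean_space \<Rightarrow> 'a \<Rightarrow> nat \<Rightarrow> 'a \<Rightarrow> real" where
  "box_bump a b n z = (\<Prod>i\<in>Basis. flat 1 (real (Suc n) * (z \<bullet> i) + - (real (Suc n) * (a \<bullet> i)))
                               * flat 1 (- real (Suc n) * (z \<bullet> i) + real (Suc n) * (b \<bullet> i)))"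

lemma flat1_bounds: "0 \<le> flat 1 t" "flat 1 t \<le> 1" "flat 1 t \<noteq> 0 \<longleftrightarrow> 0 < t"
  by (auto simp: flat_def)

lemma box_bump_bounds: "0 \<le> box_bump a b n z" "box_bump a b n z \<le> 1"
  unfolding box_bump_def
  by (auto intro!: prod_nonneg prod_le_1 mult_nonneg_nonneg mult_le_one flat1_bounds)

lemma box_bump_nonzero: "box_bump a b n z \<noteq> 0 \<longleftrightarrow> z \<in> box a b"
proof -
  have *: "0 < real (Suc n) * x + - (real (Suc n) * y) \<longleftrightarrow> y < x"
       "0 < - real (Suc n) * x + real (Suc n) * y \<longleftrightarrow> x < y" for x y :: real
    by (auto simp del: of_nat_Suc)
  show ?thesis unfolding box_bump_def mem_box prod_zero_iff[OF finite_Basis] mult_eq_0_iff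
    using flat1_bounds(3) * by auto
qed

lemma test_function_box_bump:
  assumes "cbox a b \<subseteq> V"
  shows "test_function V (box_bump a b n)"
proof -
  have eq: "{x. box_bump a b n x \<noteq> 0} = box a b" using box_bump_nonzero by auto
  have "closure (box a b) \<subseteq> cbox a b" by (simp add: box_subset_cbox closure_minimal closed_cbox)
  moreover have "smooth_on UNIV (box_bump a b n)"
    unfolding box_bump_def
    by (intro smooth_on_prod smooth_on_mult smooth_on_flat)
  ultimately show ?thesis
    using assms bounded_subset[OF bounded_cbox box_subset_cbox]
    unfolding test_function_def eq by (auto simp: compact_closure)
qed

lemma box_bump_tendsto: "(\<lambda>n. box_bump a b n z) \<longlonglongrightarrow> indicator (box a b) z"
proof (cases "z \<in> box a b")
  case False
  then show ?thesis using box_bump_nonzero[of a b _ z] by (simp add: tendsto_eventually)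
next
  case True
  have *: "(\<lambda>n. flat 1 (real (Suc n) * x)) \<longlonglongrightarrow> 1" if "0 < x" for x
  proof -
    have "(\<lambda>n. exp (- (inverse (real (Suc n)) * inverse x))) \<longlonglongrightarrow> exp (- (0 * inverse x))"
      by (intro tendsto_intros LIMSEQ_inverse_real_of_nat)
    then show ?thesis using that by (simp add: flat_def inverse_eq_divide del: of_nat_Suc)
  qed
  have "(\<lambda>n. box_bump a b n z) \<longlonglongrightarrow> (\<Prod>i\<in>(Basis::'a set). 1 * 1)"
    unfolding box_bump_def
  proof (intro tendsto_prod tendsto_mult)
    fix i :: 'a assume "i \<in> Basis"
    then have "0 < z \<bullet> i - a \<bullet> i" "0 < b \<bullet> i - z \<bullet> i" using True by (auto simp: mem_box)
    from this[THEN *]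
    show "(\<lambda>n. flat 1 (real (Suc n) * (z \<bullet> i) + - (real (Suc n) * (a \<bullet> i)))) \<longlonglongrightarrow> 1"
         "(\<lambda>n. flat 1 (- real (Suc n) * (z \<bullet> i) + real (Suc n) * (b \<bullet> i))) \<longlonglongrightarrow> 1"
      by (simp_all add: algebra_simps)
  qed
  then show ?thesis using True by simp
qed

lemma test_function_derivative:
  assumes "test_function U \<eta>"
  shows "(\<eta> has_derivative frechet_derivative \<eta> (at x)) (at x)"
  using assms Ck_on_has_derivative[of 0 \<eta> x] unfolding test_function_def smooth_on_def by blast

lemma test_function_continuous:
  assumes "test_function U \<eta>"
  shows "continuous_on UNIV \<eta>" "continuous_on UNIV (\<lambda>x. frechet_derivative \<eta> (at x) v)"
proof -
  have "Ck_on 0 UNIV \<eta>" "Ck_on 1 UNIV \<eta>"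
    using assms unfolding test_function_def smooth_on_def by blast+
  then show "continuous_on UNIV \<eta>" "continuous_on UNIV (\<lambda>x. frechet_derivative \<eta> (at x) v)" by auto
qed

lemma test_function_measurable:
  assumes "test_function U \<eta>"
  shows "\<eta> \<in> borel_measurable borel" "(\<lambda>x. frechet_derivative \<eta> (at x) v) \<in> borel_measurable borel"
  using test_function_continuous[OF assms] by (auto intro: borel_measurable_continuous_onI)

lemma test_function_deriv_support:
  assumes "test_function U \<eta>" "x \<notin> closure {x. \<eta> x \<noteq> 0}"
  shows "frechet_derivative \<eta> (at x) v = 0"
proof -
  have "((\<lambda>_. 0::real) has_derivative (\<lambda>_. 0)) (at x)" by simp
  then have "(\<eta> has_derivative (\<lambda>_. 0)) (at x)"
  proof (rule has_derivative_transform_within_open)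
    show "open (- closure {x. \<eta> x \<noteq> 0})" "x \<in> - closure {x. \<eta> x \<noteq> 0}" using assms by auto
    fix y assume "y \<in> - closure {x. \<eta> x \<noteq> 0}"
    then show "0 = \<eta> y" using closure_subset[of "{x. \<eta> x \<noteq> 0}"] by auto
  qed
  from frechet_derivative_at[OF this] show ?thesis by metis
qed

lemma test_function_bounded:
  assumes t: "test_function U \<eta>"
  obtains B where "0 \<le> B" "\<And>x. \<bar>\<eta> x\<bar> \<le> B" "\<And>x. \<bar>frechet_derivative \<eta> (at x) v\<bar> \<le> B"
proof -
  let ?K = "closure {x. \<eta> x \<noteq> 0}"
  have K: "compact ?K" using t by (simp add: test_function_def)
  have "bounded (\<eta> ` ?K)" "bounded ((\<lambda>x. frechet_derivative \<eta> (at x) v) ` ?K)"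
    using test_function_continuous[OF t]
    by (auto intro!: compact_imp_bounded compact_continuous_image K intro: continuous_on_subset)
  then obtain B1 B2 where B: "\<And>x. x \<in> ?K \<Longrightarrow> \<bar>\<eta> x\<bar> \<le> B1"
      "\<And>x. x \<in> ?K \<Longrightarrow> \<bar>frechet_derivative \<eta> (at x) v\<bar> \<le> B2"
    unfolding bounded_iff by (auto simp: image_iff)
  have out: "\<eta> x = 0 \<and> frechet_derivative \<eta> (at x) v = 0" if "x \<notin> ?K" for x
    using that test_function_deriv_support[OF t that] closure_subset[of "{x. \<eta> x \<noteq> 0}"] by auto
  show ?thesis
  proof (rule that[of "\<bar>B1\<bar> + \<bar>B2\<bar>"])
    show "\<bar>\<eta> x\<bar> \<le> \<bar>B1\<bar> + \<bar>B2\<bar>" for x using B(1)[of x] out[of x] by (cases "x \<in> ?K") auto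
    show "\<bar>frechet_derivative \<eta> (at x) v\<bar> \<le> \<bar>B1\<bar> + \<bar>B2\<bar>" for x
      using B(2)[of x] out[of x] by (cases "x \<in> ?K") auto
  qed auto
qed

lemma integrable_mult_bounded:
  fixes f h :: "'a \<Rightarrow> real"
  assumes "integrable M f" "h \<in> borel_measurable M" "\<And>x. \<bar>h x\<bar> \<le> B"
  shows "integrable M (\<lambda>x. f x * h x)"
proof (rule Bochner_Integration.integrable_bound[where f="\<lambda>x. B * f x"])
  have "\<bar>f x\<bar> * \<bar>h x\<bar> \<le> \<bar>f x\<bar> * \<bar>B\<bar>" for x
    using assms(3)[of x] by (intro mult_left_mono) auto
  then show "AE x in M. norm (f x * h x) \<le> norm (B * f x)"
    by (simp add: abs_mult mult.commute)
qed (use assms in auto)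

text \<open>
  Bumps approximate indicators of boxes, so \<open>w\<close> has integral zero over every box whose
  closure lies in \<open>V\<close>. Inside one such box, boxes form an intersection-stable generator of
  the Borel sets, so \<open>w\<close> vanishes there; countably many boxes exhaust \<open>V\<close>.
\<close>

lemma fundamental_lemma:
  fixes w :: "'a::euclidean_space \<Rightarrow> real"
  assumes V: "open V" and w: "integrable lborel w"
    and zero: "\<And>\<eta>. test_function V \<eta> \<Longrightarrow> (\<integral>x. w x * \<eta> x \<partial>lborel) = 0"
  shows "AE x in lborel. x \<in> V \<longrightarrow> w x = 0"
proof -
  have box0: "(\<integral>x. w x * indicator (box a b) x \<partial>lborel) = 0" if ab: "cbox a b \<subseteq> V" for a b
  proof -
    have "(\<lambda>n. \<integral>x. w x * box_bump a b n x \<partial>lborel) \<longlonglongrightarrow> (\<integral>x. w x * indicator (box a b) x \<partial>lborel)"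
    proof (rule integral_dominated_convergence[where w="\<lambda>x. norm (w x)"])
      show "AE x in lborel. (\<lambda>n. w x * box_bump a b n x) \<longlonglongrightarrow> w x * indicator (box a b) x"
        by (intro AE_I2 tendsto_intros box_bump_tendsto)
      show "AE x in lborel. norm (w x * box_bump a b n x) \<le> norm (w x)" for n
        using box_bump_bounds[of a b n] by (auto simp: abs_mult mult_left_le)
      have [measurable]: "box_bump a b n \<in> borel_measurable borel" for n
        using test_function_measurable(1)[OF test_function_box_bump[of a b UNIV n]] by simp
      show "(\<lambda>x. w x * box_bump a b n x) \<in> borel_measurable lborel" for n using w by measurable
    qed (use w in auto)
    then show ?thesis using zero[OF test_function_box_bump[OF ab]] by (simp add: LIMSEQ_const_iff)
  qed
  have on_box: "AE x in lborel. x \<in> box a b \<longrightarrow> w x = 0" if ab: "cbox a b \<subseteq> V" for a b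
  proof -
    define v where "v x = w x * indicator (box a b) x" for x
    have v: "integrable lborel v" unfolding v_def
      by (intro integrable_mult_bounded[OF w, of _ 1]) (auto simp: indicator_def)
    have all0: "(\<integral>x. v x * indicator A x \<partial>lborel) = 0" if A: "A \<in> sets borel" for A
    proof -
      have st: "Int_stable (range (\<lambda>(c, d). box c d) :: 'a set set)"
        by (auto simp: Int_stable_def box_Int_box)
      have sub: "range (\<lambda>(c, d). box c d) \<subseteq> Pow (UNIV :: 'a set)" by simp
      have "A \<in> sigma_sets UNIV (range (\<lambda>(c, d). box c d))" using A by (simp add: borel_eq_box)
      from st sub this show ?thesis
      proof (induction rule: sigma_sets_induct_disjoint)
      case (basic A)
      then obtain c d where A: "A = box c d" by auto
      obtain p q where pq: "box a b \<inter> box c d = box p q" "cbox p q \<subseteq> cbox a b"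
      proof
        let ?p = "\<Sum>i\<in>Basis. max (a \<bullet> i) (c \<bullet> i) *\<^sub>R i" and ?q = "\<Sum>i\<in>Basis. min (b \<bullet> i) (d \<bullet> i) *\<^sub>R i"
        show "box a b \<inter> box c d = box ?p ?q" by (auto simp: mem_box box_Int_box)
        show "cbox ?p ?q \<subseteq> cbox a b" by (auto simp: mem_box)
      qed
      have "v x * indicator A x = w x * indicator (box p q) x" for x
        using pq(1) unfolding A v_def by (auto simp: indicator_def)
      then show ?case
        using box0[of p q] pq(2) ab by simp
    next
      case (compl A)
      have [measurable]: "A \<in> sets borel" using compl(1) by (simp add: borel_eq_box)
      have "(\<integral>x. v x * indicator (UNIV - A) x \<partial>lborel) = (\<integral>x. v x - v x * indicator A x \<partial>lborel)"
        by (intro Bochner_Integration.integral_cong) (auto simp: indicator_def)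
      also have "\<dots> = (\<integral>x. v x \<partial>lborel) - (\<integral>x. v x * indicator A x \<partial>lborel)"
        by (intro Bochner_Integration.integral_diff v integrable_mult_bounded[OF v, of _ 1])
           (auto simp: indicator_def)
      finally show ?case
        using compl(2) box0[OF ab] by (simp add: v_def)
    next
      case (union A)
      have m: "A i \<in> sets lborel" for i using union(2) by (auto simp: borel_eq_box)
      have s: "set_integrable lborel S v" if "S \<in> sets lborel" for S
        unfolding set_integrable_def using integrable_mult_bounded[OF v, of "indicator S" 1] that
        by (auto simp: indicator_def mult.commute)
      have "(\<integral>x\<in>(\<Union>i. A i). v x \<partial>lborel) = (\<Sum>i. \<integral>x\<in>A i. v x \<partial>lborel)"
        using union(1) by (intro lebesgue_integral_countable_add[OF m _ s])
          (use m in \<open>auto simp: disjoint_family_on_def intro!: sets.countable_UN\<close>)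
      then show ?case
        using union(3) by (simp add: set_lebesgue_integral_def mult.commute)
      qed simp
    qed
    have "AE x in lborel. v x = 0"
      by (rule density_unique_real[OF v integrable_zero])
         (use all0 in \<open>simp add: set_lebesgue_integral_def mult.commute\<close>)
    then show ?thesis by eventually_elim (auto simp: v_def)
  qed
  obtain \<D> where D: "countable \<D>" "\<D> \<subseteq> Pow V" "\<And>X. X \<in> \<D> \<Longrightarrow> \<exists>a b. X = cbox a b" "\<Union>\<D> = V"
    using open_countable_Union_open_cbox[OF V] by metis
  have "AE x in lborel. x \<in> X \<longrightarrow> w x = 0" if X: "X \<in> \<D>" for X
  proof -
    obtain a b where ab: "X = cbox a b" "cbox a b \<subseteq> V" using D(2,3) X by blast
    have "AE x in lborel. x \<notin> cbox a b - box a b"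
      using negligible_frontier_interval[of a b] 
      by (intro AE_not_in) (simp add: negligible_iff_null_sets null_sets_completion_iff)
    then show ?thesis using on_box[OF ab(2)] unfolding ab(1) by eventually_elim auto
  qed
  then have "AE x in lborel. \<forall>X\<in>\<D>. x \<in> X \<longrightarrow> w x = 0" unfolding AE_ball_countable[OF D(1)] by blast
  then show ?thesis by eventually_elim (use D(4) in auto)
qed

text \<open>
  Translations of a test function are differentiated under the integral sign. Together with the
  translation invariance of Lebesgue measure this yields integration by parts and, later, the passage
  from a weak derivative to differences.
\<close>

lemma integral_translate_test_function_derivative:
  fixes f \<eta> :: "'a::euclidean_space \<Rightarrow> real"
  assumes t: "test_function U \<eta>" and f: "integrable lborel f"
  shows "((\<lambda>\<sigma>. \<integral>z. f z * \<eta> (z + \<sigma> *\<^sub>R e) \<partial>lborel) has_real_derivative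
           (\<integral>z. f z * frechet_derivative \<eta> (at (z + \<sigma> *\<^sub>R e)) e \<partial>lborel)) (at \<sigma>)"
proof -
  obtain B where B: "0 \<le> B" "\<And>x. \<bar>\<eta> x\<bar> \<le> B" "\<And>x. \<bar>frechet_derivative \<eta> (at x) e\<bar> \<le> B"
    using test_function_bounded[OF t, where v=e] by metis
  note [measurable] = test_function_measurable[OF t]
  have d: "((\<lambda>s. \<eta> (z + s *\<^sub>R e)) has_real_derivative frechet_derivative \<eta> (at (z + s *\<^sub>R e)) e) (at s)" for z s
  proof -
    have "((\<lambda>s. z + s *\<^sub>R e) has_derivative (\<lambda>h. h *\<^sub>R e)) (at s)"
      by (auto intro!: derivative_eq_intros)
    from has_derivative_compose[OF this test_function_derivative[OF t]]
    have "((\<lambda>s. \<eta> (z + s *\<^sub>R e)) has_derivative (\<lambda>h. frechet_derivative \<eta> (at (z + s *\<^sub>R e)) (h *\<^sub>R e))) (at s)" .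
    moreover have "frechet_derivative \<eta> (at x) (h *\<^sub>R e) = h * frechet_derivative \<eta> (at x) e" for x h
      using linear_scale[OF has_derivative_linear[OF test_function_derivative[OF t]]] by simp
    ultimately have "((\<lambda>s. \<eta> (z + s *\<^sub>R e)) has_derivative (\<lambda>h. h * frechet_derivative \<eta> (at (z + s *\<^sub>R e)) e)) (at s)"
      by (simp only:)
    then show ?thesis unfolding has_field_derivative_def by (rule has_derivative_eq_rhs) (simp add: fun_eq_iff mult.commute)
  qed
  have lip: "\<bar>\<eta> (z + s *\<^sub>R e) - \<eta> (z + r *\<^sub>R e)\<bar> \<le> B * \<bar>s - r\<bar>" for z s r
    using field_differentiable_bound[of UNIV "\<lambda>s. \<eta> (z + s *\<^sub>R e)" "\<lambda>s. frechet_derivative \<eta> (at (z + s *\<^sub>R e)) e" B s r]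
      d B(3) by (auto simp: has_field_derivative_at_within)
  have int: "integrable lborel (\<lambda>z. f z * \<eta> (z + s *\<^sub>R e))" for s
    by (rule integrable_mult_bounded[OF f _ B(2)]) measurable
  show ?thesis
    unfolding has_field_derivative_iff tendsto_at_iff_sequentially comp_def
  proof (intro allI impI)
    fix X :: "nat \<Rightarrow> real" assume X: "\<forall>i. X i \<in> UNIV - {\<sigma>}" "X \<longlonglongrightarrow> \<sigma>"
    have "(\<lambda>n. \<integral>z. f z * ((\<eta> (z + X n *\<^sub>R e) - \<eta> (z + \<sigma> *\<^sub>R e)) / (X n - \<sigma>)) \<partial>lborel)
      \<longlonglongrightarrow> (\<integral>z. f z * frechet_derivative \<eta> (at (z + \<sigma> *\<^sub>R e)) e \<partial>lborel)"
    proof (rule integral_dominated_convergence[where w="\<lambda>z. B * norm (f z)"])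
      show "AE z in lborel. (\<lambda>n. f z * ((\<eta> (z + X n *\<^sub>R e) - \<eta> (z + \<sigma> *\<^sub>R e)) / (X n - \<sigma>)))
          \<longlonglongrightarrow> f z * frechet_derivative \<eta> (at (z + \<sigma> *\<^sub>R e)) e"
        using d[unfolded has_field_derivative_iff tendsto_at_iff_sequentially comp_def] X
        by (intro AE_I2 tendsto_intros) blast
      show "AE z in lborel. norm (f z * ((\<eta> (z + X n *\<^sub>R e) - \<eta> (z + \<sigma> *\<^sub>R e)) / (X n - \<sigma>))) \<le> B * norm (f z)" for n
      proof (intro AE_I2)
        fix z
        have "\<bar>(\<eta> (z + X n *\<^sub>R e) - \<eta> (z + \<sigma> *\<^sub>R e)) / (X n - \<sigma>)\<bar> \<le> B"
          using lip[of z "X n" \<sigma>] X(1) by (auto simp: abs_divide divide_le_eq)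
        then show "norm (f z * ((\<eta> (z + X n *\<^sub>R e) - \<eta> (z + \<sigma> *\<^sub>R e)) / (X n - \<sigma>))) \<le> B * norm (f z)"
          by (simp only: real_norm_def abs_mult mult.commute[of B] mult_left_mono abs_ge_zero)
      qed
      show "integrable lborel (\<lambda>z. B * norm (f z))" using f by simp
    qed (use f in measurable)
    moreover have "(\<integral>z. f z * ((\<eta> (z + X n *\<^sub>R e) - \<eta> (z + \<sigma> *\<^sub>R e)) / (X n - \<sigma>)) \<partial>lborel)
       = ((\<integral>z. f z * \<eta> (z + X n *\<^sub>R e) \<partial>lborel) - (\<integral>z. f z * \<eta> (z + \<sigma> *\<^sub>R e) \<partial>lborel)) / (X n - \<sigma>)" for n
      by (subst Bochner_Integration.integral_diff[symmetric, OF int int])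
         (simp add: Bochner_Integration.integral_divide_zero[symmetric] algebra_simps diff_divide_distrib
           del: Bochner_Integration.integral_divide_zero)
    ultimately show "(\<lambda>n. ((\<integral>z. f z * \<eta> (z + X n *\<^sub>R e) \<partial>lborel) - (\<integral>z. f z * \<eta> (z + \<sigma> *\<^sub>R e) \<partial>lborel)) / (X n - \<sigma>))
      \<longlonglongrightarrow> (\<integral>z. f z * frechet_derivative \<eta> (at (z + \<sigma> *\<^sub>R e)) e \<partial>lborel)"
      by (simp only:)
  qed
qed

lemma lborel_integral_translate:
  fixes f :: "'a::euclidean_space \<Rightarrow> real"
  assumes [measurable]: "f \<in> borel_measurable borel"
  shows "(\<integral>z. f (z + c) \<partial>lborel) = (\<integral>z. f z \<partial>lborel)"
proof -
  have "(\<integral>z. f z \<partial>lborel) = (\<integral>z. f z \<partial>distr lborel borel ((+) c))" by (simp add: lborel_distr_plus)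
  also have "\<dots> = (\<integral>z. f (c + z) \<partial>lborel)" by (subst integral_distr) auto
  finally show ?thesis by (simp add: add.commute)
qed

lemma test_function_integrable:
  fixes \<eta> :: "'a::euclidean_space \<Rightarrow> real"
  assumes t: "test_function U \<eta>"
  shows "integrable lborel \<eta>"
proof -
  let ?K = "closure {x. \<eta> x \<noteq> 0}"
  have K: "compact ?K" using t by (simp add: test_function_def)
  have "set_integrable lborel ?K \<eta>"
    unfolding set_integrable_def
    by (rule borel_integrable_compact[OF K]) (rule continuous_on_subset[OF test_function_continuous(1)[OF t]], simp)
  then have "integrable lborel (\<lambda>x. indicator ?K x *\<^sub>R \<eta> x)" unfolding set_integrable_def .
  moreover have "(\<lambda>x. indicator ?K x *\<^sub>R \<eta> x) = \<eta>"
    using closure_subset[of "{x. \<eta> x \<noteq> 0}"] by (auto simp: indicator_def fun_eq_iff)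
  ultimately show ?thesis by simp
qed

text \<open>
  The integral of \<open>\<beta>(z) \<eta>(z + \<sigma> e)\<close> equals that of \<open>\<beta>(z -
  \<sigma> e) \<eta>(z)\<close>; the two sides of the claim are their derivatives at \<open>\<sigma> =
  0\<close>.
\<close>

lemma test_function_integration_by_parts:
  fixes \<beta> \<eta> :: "'a::euclidean_space \<Rightarrow> real"
  assumes b: "test_function U \<beta>" and t: "test_function V \<eta>"
  shows "(\<integral>x. \<beta> x * frechet_derivative \<eta> (at x) e \<partial>lborel) = - (\<integral>x. frechet_derivative \<beta> (at x) e * \<eta> x \<partial>lborel)"
proof -
  note [measurable] = test_function_measurable[OF t] test_function_measurable[OF b]
  have 1: "((\<lambda>\<sigma>. \<integral>z. \<beta> z * \<eta> (z + \<sigma> *\<^sub>R e) \<partial>lborel) has_real_derivative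
        (\<integral>z. \<beta> z * frechet_derivative \<eta> (at z) e \<partial>lborel)) (at 0)"
    using integral_translate_test_function_derivative[OF t test_function_integrable[OF b], of e 0] by simp
  have 2: "((\<lambda>\<sigma>. \<integral>z. \<eta> z * \<beta> (z + \<sigma> *\<^sub>R (-e)) \<partial>lborel) has_real_derivative
        (\<integral>z. \<eta> z * frechet_derivative \<beta> (at z) (-e) \<partial>lborel)) (at 0)"
    using integral_translate_test_function_derivative[OF b test_function_integrable[OF t], of "-e" 0] by simp
  have "(\<integral>z. \<eta> z * \<beta> (z + \<sigma> *\<^sub>R (-e)) \<partial>lborel) = (\<integral>z. \<beta> z * \<eta> (z + \<sigma> *\<^sub>R e) \<partial>lborel)" for \<sigma>
    using lborel_integral_translate[of "\<lambda>z. \<eta> z * \<beta> (z + \<sigma> *\<^sub>R (-e))" "\<sigma> *\<^sub>R e"]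
    by (simp add: mult.commute)
  with 1 2 have "(\<integral>z. \<beta> z * frechet_derivative \<eta> (at z) e \<partial>lborel)
      = (\<integral>z. \<eta> z * frechet_derivative \<beta> (at z) (-e) \<partial>lborel)"
    by (metis (no_types, lifting) DERIV_unique ext)
  moreover have "frechet_derivative \<beta> (at z) (-e) = - frechet_derivative \<beta> (at z) e" for z
    using linear_neg[OF has_derivative_linear[OF test_function_derivative[OF b]]] .
  ultimately show ?thesis by (simp add: mult.commute)
qed

lemma test_function_translate:
  assumes t: "test_function U \<eta>" and sub: "(\<lambda>x. x - c) ` U \<subseteq> V"
  shows "test_function V (\<lambda>x. \<eta> (x + c))"
proof -
  have eq: "{x. \<eta> (x + c) \<noteq> 0} = (\<lambda>x. x - c) ` {x. \<eta> x \<noteq> 0}"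
    by (auto simp: image_iff intro!: exI[of _ "_ + c"])
  have cl: "closure {x. \<eta> (x + c) \<noteq> 0} = (\<lambda>x. x - c) ` closure {x. \<eta> x \<noteq> 0}"
    unfolding eq using closure_translation_subtract by blast
  show ?thesis
    using t sub unfolding test_function_def cl smooth_on_def
    by (auto intro: Ck_on_translate compact_translation_subtract)
qed

section \<open>Calculus in L2\<close>

lemma in_L2_iff:
  "in_Lp M 2 u \<longleftrightarrow> u \<in> borel_measurable M \<and> integrable M (\<lambda>x. (norm (u x))\<^sup>2)"
  by (simp add: in_Lp_def powr_numeral)

lemma Lp_norm_2: "Lp_norm M 2 u = sqrt (\<integral>x. (norm (u x))\<^sup>2 \<partial>M)"
  by (simp add: Lp_norm_def powr_numeral powr_half_sqrt integral_nonneg_AE)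

lemma Lp_norm_2_nonneg: "0 \<le> Lp_norm M 2 u"
  by (simp add: Lp_norm_2 integral_nonneg_AE)

lemma Lp_norm_2_power2: "(Lp_norm M 2 u)\<^sup>2 = L2_inner M u u"
  by (simp add: Lp_norm_2 L2_inner_def power2_norm_eq_inner integral_nonneg_AE)

lemma L2_inner_self_nonneg: "0 \<le> L2_inner M u u"
  by (metis Lp_norm_2_power2 zero_le_power2)

lemma in_L2_measurable: "in_Lp M 2 u \<Longrightarrow> u \<in> borel_measurable M"
  by (simp add: in_L2_iff)

lemma L2_integrable_inner:
  assumes u: "in_Lp M 2 u" and v: "in_Lp M 2 v"
  shows "integrable M (\<lambda>x. u x \<bullet> v x)"
proof (rule Bochner_Integration.integrable_bound)
  show "integrable M (\<lambda>x. (norm (u x))\<^sup>2 + (norm (v x))\<^sup>2)"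
    using u v by (simp add: in_L2_iff)
  show "(\<lambda>x. u x \<bullet> v x) \<in> borel_measurable M"
    using u v by (simp add: in_L2_iff borel_measurable_inner)
  show "AE x in M. norm (u x \<bullet> v x) \<le> norm ((norm (u x))\<^sup>2 + (norm (v x))\<^sup>2)"
  proof (intro AE_I2)
    fix x
    have "0 \<le> norm (u x) * norm (v x)" by simp
    then have "norm (u x) * norm (v x) \<le> (norm (u x))\<^sup>2 + (norm (v x))\<^sup>2"
      using sum_squares_bound[of "norm (u x)" "norm (v x)"]
      by linarith
    then show "norm (u x \<bullet> v x) \<le> norm ((norm (u x))\<^sup>2 + (norm (v x))\<^sup>2)"
      using Cauchy_Schwarz_ineq2[of "u x" "v x"] by (simp add: abs_of_nonneg)
  qed
qed

lemma in_L2_add: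
  assumes u: "in_Lp M 2 u" and v: "in_Lp M 2 v"
  shows "in_Lp M 2 (\<lambda>x. u x + v x)"
proof -
  have "(norm (u x + v x))\<^sup>2 = (norm (u x))\<^sup>2 + 2 * (u x \<bullet> v x) + (norm (v x))\<^sup>2" for x
    by (simp add: power2_norm_eq_inner inner_add_left inner_add_right inner_commute)
  then show ?thesis using u v L2_integrable_inner[OF u v] by (simp add: in_L2_iff borel_measurable_add)
qed

lemma in_L2_scale: "in_Lp M 2 u \<Longrightarrow> in_Lp M 2 (\<lambda>x. c *\<^sub>R u x)"
  by (simp add: in_L2_iff power_mult_distrib borel_measurable_scaleR)

lemma in_L2_diff:
  assumes "in_Lp M 2 u" "in_Lp M 2 v"
  shows "in_Lp M 2 (\<lambda>x. u x - v x)"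
  using in_L2_add[OF assms(1) in_L2_scale[OF assms(2), of "-1"]] by simp

lemma in_L2_bounded:
  assumes u: "in_Lp M 2 u" and v: "v \<in> borel_measurable M"
    and le: "\<And>x. x \<in> space M \<Longrightarrow> norm (v x) \<le> B * norm (u x)"
  shows "in_Lp M 2 v"
  unfolding in_L2_iff
proof (intro conjI v, rule Bochner_Integration.integrable_bound)
  show "integrable M (\<lambda>x. B\<^sup>2 * (norm (u x))\<^sup>2)" using u by (simp add: in_L2_iff)
  show "AE x in M. norm ((norm (v x))\<^sup>2) \<le> norm (B\<^sup>2 * (norm (u x))\<^sup>2)"
    using le by (intro AE_I2) (simp add: power_mult_distrib[symmetric] power_mono)
qed (use v in auto)

lemma L2_inner_commute: "L2_inner M u v = L2_inner M v u"
  by (simp add: L2_inner_def inner_commute)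

lemma L2_inner_add_left:
  assumes "in_Lp M 2 u" "in_Lp M 2 v" "in_Lp M 2 w"
  shows "L2_inner M (\<lambda>x. u x + v x) w = L2_inner M u w + L2_inner M v w"
  using assms by (simp add: L2_inner_def inner_add_left L2_integrable_inner)

lemma L2_inner_diff_left:
  assumes "in_Lp M 2 u" "in_Lp M 2 v" "in_Lp M 2 w"
  shows "L2_inner M (\<lambda>x. u x - v x) w = L2_inner M u w - L2_inner M v w"
  using assms by (simp add: L2_inner_def inner_diff_left L2_integrable_inner)

lemma L2_inner_add_right:
  assumes "in_Lp M 2 u" "in_Lp M 2 v" "in_Lp M 2 w"
  shows "L2_inner M w (\<lambda>x. u x + v x) = L2_inner M w u + L2_inner M w v"
  using assms by (simp add: L2_inner_def inner_add_right L2_integrable_inner)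

lemma L2_inner_diff_right:
  assumes "in_Lp M 2 u" "in_Lp M 2 v" "in_Lp M 2 w"
  shows "L2_inner M w (\<lambda>x. u x - v x) = L2_inner M w u - L2_inner M w v"
  using L2_inner_diff_left[OF assms] by (simp add: L2_inner_commute)

lemma L2_inner_scale_left: "L2_inner M (\<lambda>x. c *\<^sub>R u x) w = c * L2_inner M u w"
  by (simp add: L2_inner_def)

lemma L2_inner_scale_right: "L2_inner M w (\<lambda>x. c *\<^sub>R u x) = c * L2_inner M w u"
  by (simp add: L2_inner_def)

lemma L2_inner_cong_AE:
  assumes "AE x in M. u x = u' x" "u \<in> borel_measurable M" "u' \<in> borel_measurable M" "v \<in> borel_measurable M"
  shows "L2_inner M u v = L2_inner M u' v"
  unfolding L2_inner_def using assms
  by (intro integral_cong_AE) (auto intro: borel_measurable_inner)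

text \<open>
  The functions are not identified almost everywhere, so the inner product is only semidefinite. If
  \<open>v\<close> has norm zero it vanishes almost everywhere; otherwise the squared norm of \<open>u -
  r v\<close> is nonnegative for the minimising \<open>r\<close>.
\<close>

lemma L2_Cauchy_Schwarz:
  assumes u: "in_Lp M 2 u" and v: "in_Lp M 2 v"
  shows "\<bar>L2_inner M u v\<bar> \<le> Lp_norm M 2 u * Lp_norm M 2 v"
proof (cases "L2_inner M v v = 0")
  case True
  have "AE x in M. (norm (v x))\<^sup>2 = 0"
    using True v by (subst integral_nonneg_eq_0_iff_AE[symmetric])
      (auto simp: in_L2_iff L2_inner_def power2_norm_eq_inner)
  then have "AE x in M. u x \<bullet> v x = 0" by eventually_elim simp
  then have "L2_inner M u v = 0" unfolding L2_inner_def by (rule integral_eq_zero_AE)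
  then show ?thesis by (simp add: Lp_norm_2_nonneg)
next
  case False
  define A B C where "A = L2_inner M u u" and "B = L2_inner M u v" and "C = L2_inner M v v"
  have C: "C > 0" using False L2_inner_self_nonneg[of M v] by (simp add: C_def)
  define r where "r = B / C"
  let ?w = "\<lambda>x. u x - r *\<^sub>R v x"
  have "0 \<le> L2_inner M ?w ?w" by (rule L2_inner_self_nonneg)
  also have "\<dots> = A - r * B - r * (B - r * C)"
    using u v by (simp add: L2_inner_diff_left L2_inner_diff_right in_L2_scale in_L2_diff
        L2_inner_scale_left L2_inner_scale_right A_def B_def C_def L2_inner_commute[of M v u])
  also have "\<dots> = A - B\<^sup>2 / C" using C by (simp add: r_def power2_eq_square)
  finally have "B\<^sup>2 \<le> A * C" using C by (simp add: field_simps)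
  also have "\<dots> = (Lp_norm M 2 u * Lp_norm M 2 v)\<^sup>2"
    by (simp add: power_mult_distrib Lp_norm_2_power2 A_def C_def)
  finally have "\<bar>B\<bar> \<le> \<bar>Lp_norm M 2 u * Lp_norm M 2 v\<bar>" by (simp add: abs_le_square_iff)
  then show ?thesis by (simp add: B_def abs_mult Lp_norm_2_nonneg)
qed

lemma L2_young:
  assumes u: "in_Lp M 2 u" and v: "in_Lp M 2 v" and k: "0 < k"
  shows "\<bar>L2_inner M u v\<bar> \<le> L2_inner M u u / (2 * k) + k * L2_inner M v v / 2"
proof -
  let ?a = "Lp_norm M 2 u" and ?b = "Lp_norm M 2 v"
  have "0 \<le> (?a - k * ?b)\<^sup>2 / (2 * k)" using k by simp
  also have "\<dots> = ?a\<^sup>2 / (2 * k) + k * ?b\<^sup>2 / 2 - ?a * ?b"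
    using k by (simp add: power2_eq_square field_simps)
  finally show ?thesis using L2_Cauchy_Schwarz[OF u v] by (simp add: Lp_norm_2_power2)
qed

lemma Lp_norm_2_scale: "Lp_norm M 2 (\<lambda>x. c *\<^sub>R u x) = \<bar>c\<bar> * Lp_norm M 2 u"
  by (simp add: Lp_norm_2 power_mult_distrib real_sqrt_mult)

lemma Lp_norm_2_minus_commute: "Lp_norm M 2 (\<lambda>x. u x - v x) = Lp_norm M 2 (\<lambda>x. v x - u x)"
  by (simp add: Lp_norm_2 norm_minus_commute)

lemma Lp_norm_2_triangle:
  assumes u: "in_Lp M 2 u" and v: "in_Lp M 2 v"
  shows "Lp_norm M 2 (\<lambda>x. u x + v x) \<le> Lp_norm M 2 u + Lp_norm M 2 v"
proof (rule power2_le_imp_le)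
  have "(Lp_norm M 2 (\<lambda>x. u x + v x))\<^sup>2 = (Lp_norm M 2 u)\<^sup>2 + 2 * L2_inner M u v + (Lp_norm M 2 v)\<^sup>2"
    unfolding Lp_norm_2_power2 using u v L2_inner_commute[of M v u]
    by (simp add: L2_inner_add_left L2_inner_add_right in_L2_add)
  also have "\<dots> \<le> (Lp_norm M 2 u + Lp_norm M 2 v)\<^sup>2"
    using L2_Cauchy_Schwarz[OF u v] by (simp add: power2_sum)
  finally show "(Lp_norm M 2 (\<lambda>x. u x + v x))\<^sup>2 \<le> (Lp_norm M 2 u + Lp_norm M 2 v)\<^sup>2" .
qed (simp add: Lp_norm_2_nonneg)

lemma Lp_norm_2_mono:
  assumes u: "in_Lp M 2 u" and v: "v \<in> borel_measurable M" and B: "0 \<le> B"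
    and le: "\<And>x. x \<in> space M \<Longrightarrow> norm (v x) \<le> B * norm (u x)"
  shows "Lp_norm M 2 v \<le> B * Lp_norm M 2 u"
proof -
  have "(\<integral>x. (norm (v x))\<^sup>2 \<partial>M) \<le> (\<integral>x. B\<^sup>2 * (norm (u x))\<^sup>2 \<partial>M)"
    using u in_L2_bounded[OF u v le] le
  proof (intro integral_mono)
    fix x assume "x \<in> space M"
    then show "(norm (v x))\<^sup>2 \<le> B\<^sup>2 * (norm (u x))\<^sup>2"
      using le[of x] by (simp add: power_mult_distrib[symmetric] power_mono)
  qed (auto simp: in_L2_iff)
  then have "(\<integral>x. (norm (v x))\<^sup>2 \<partial>M) \<le> B\<^sup>2 * (\<integral>x. (norm (u x))\<^sup>2 \<partial>M)" by simp
  from real_sqrt_le_mono[OF this] show ?thesis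
    using B by (simp add: Lp_norm_2 real_sqrt_mult)
qed

lemma L2_tendsto_inner:
  assumes u: "L2_tendsto M u u0 F" and v: "L2_tendsto M v v0 F"
    and u2: "eventually (\<lambda>s. in_Lp M 2 (u s)) F" and v2: "eventually (\<lambda>s. in_Lp M 2 (v s)) F"
    and u0: "in_Lp M 2 u0" and v0: "in_Lp M 2 v0"
  shows "((\<lambda>s. L2_inner M (u s) (v s)) \<longlongrightarrow> L2_inner M u0 v0) F"
proof -
  let ?du = "\<lambda>s. Lp_norm M 2 (\<lambda>x. u s x - u0 x)" and ?dv = "\<lambda>s. Lp_norm M 2 (\<lambda>x. v s x - v0 x)"
  have "((\<lambda>s. ?du s * ?dv s + ?du s * Lp_norm M 2 v0 + Lp_norm M 2 u0 * ?dv s) \<longlongrightarrow>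
      0 * 0 + 0 * Lp_norm M 2 v0 + Lp_norm M 2 u0 * 0) F"
    by (intro tendsto_intros u[unfolded L2_tendsto_def] v[unfolded L2_tendsto_def])
  then have lim: "((\<lambda>s. ?du s * ?dv s + ?du s * Lp_norm M 2 v0 + Lp_norm M 2 u0 * ?dv s) \<longlongrightarrow> 0) F"
    by simp
  have ev: "eventually (\<lambda>s. norm (L2_inner M (u s) (v s) - L2_inner M u0 v0)
      \<le> ?du s * ?dv s + ?du s * Lp_norm M 2 v0 + Lp_norm M 2 u0 * ?dv s) F"
    using u2 v2
  proof eventually_elim
    case (elim s)
    have "L2_inner M (u s) (v s) - L2_inner M u0 v0 = L2_inner M (\<lambda>x. u s x - u0 x) (\<lambda>x. v s x - v0 x)
       + L2_inner M (\<lambda>x. u s x - u0 x) v0 + L2_inner M u0 (\<lambda>x. v s x - v0 x)"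
      using elim u0 v0 by (simp add: L2_inner_diff_left L2_inner_diff_right in_L2_diff)
    moreover have "\<bar>L2_inner M (\<lambda>x. u s x - u0 x) (\<lambda>x. v s x - v0 x)\<bar> \<le> ?du s * ?dv s"
      "\<bar>L2_inner M (\<lambda>x. u s x - u0 x) v0\<bar> \<le> ?du s * Lp_norm M 2 v0"
      "\<bar>L2_inner M u0 (\<lambda>x. v s x - v0 x)\<bar> \<le> Lp_norm M 2 u0 * ?dv s"
      using elim u0 v0 by (auto intro!: L2_Cauchy_Schwarz in_L2_diff)
    ultimately show ?case unfolding real_norm_def by linarith
  qed
  have "((\<lambda>s. L2_inner M (u s) (v s) - L2_inner M u0 v0) \<longlongrightarrow> 0) F"
    by (rule Lim_null_comparison[OF ev lim])
  then show ?thesis by (simp add: LIM_zero_iff)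
qed

lemma L2_tendsto_const: "L2_tendsto M (\<lambda>_. u) u F"
  by (simp add: L2_tendsto_def Lp_norm_2)

lemma L2_tendsto_diff:
  assumes u: "L2_tendsto M u u0 F" and v: "L2_tendsto M v v0 F"
    and u2: "eventually (\<lambda>s. in_Lp M 2 (u s)) F" and v2: "eventually (\<lambda>s. in_Lp M 2 (v s)) F"
    and u0: "in_Lp M 2 u0" and v0: "in_Lp M 2 v0"
  shows "L2_tendsto M (\<lambda>s x. u s x - v s x) (\<lambda>x. u0 x - v0 x) F"
  unfolding L2_tendsto_def
proof (rule Lim_null_comparison)
  show "((\<lambda>s. Lp_norm M 2 (\<lambda>x. u s x - u0 x) + Lp_norm M 2 (\<lambda>x. v s x - v0 x)) \<longlongrightarrow> 0) F"
    using tendsto_add[OF u[unfolded L2_tendsto_def] v[unfolded L2_tendsto_def]] by simp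
  show "eventually (\<lambda>s. norm (Lp_norm M 2 (\<lambda>x. u s x - v s x - (u0 x - v0 x)))
      \<le> Lp_norm M 2 (\<lambda>x. u s x - u0 x) + Lp_norm M 2 (\<lambda>x. v s x - v0 x)) F"
    using u2 v2
  proof eventually_elim
    case (elim s)
    have "Lp_norm M 2 (\<lambda>x. (u s x - u0 x) + (v0 x - v s x))
        \<le> Lp_norm M 2 (\<lambda>x. u s x - u0 x) + Lp_norm M 2 (\<lambda>x. v0 x - v s x)"
      using elim u0 v0 by (intro Lp_norm_2_triangle in_L2_diff)
    then show ?case
      by (simp add: Lp_norm_2_nonneg Lp_norm_2_minus_commute[of M v0] algebra_simps)
  qed
qed

lemma L2_tendsto_bounded:
  assumes u: "L2_tendsto M u u0 F" and B: "0 \<le> B"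
    and u2: "eventually (\<lambda>s. in_Lp M 2 (u s)) F" and u0: "in_Lp M 2 u0"
    and m: "eventually (\<lambda>s. v s \<in> borel_measurable M) F" "v0 \<in> borel_measurable M"
    and le: "\<And>s x. x \<in> space M \<Longrightarrow> norm (v s x - v0 x) \<le> B * norm (u s x - u0 x)"
  shows "L2_tendsto M v v0 F"
  unfolding L2_tendsto_def
proof (rule Lim_null_comparison)
  show "((\<lambda>s. B * Lp_norm M 2 (\<lambda>x. u s x - u0 x)) \<longlongrightarrow> 0) F"
    using tendsto_mult[OF tendsto_const u[unfolded L2_tendsto_def]] by simp
  show "eventually (\<lambda>s. norm (Lp_norm M 2 (\<lambda>x. v s x - v0 x)) \<le> B * Lp_norm M 2 (\<lambda>x. u s x - u0 x)) F"
    using u2 m(1)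
  proof eventually_elim
    case (elim s)
    show ?case
      using Lp_norm_2_mono[OF in_L2_diff[OF elim(1) u0] _ B le] elim m(2) by (simp add: Lp_norm_2_nonneg)
  qed
qed

text \<open>
  Differentiability at \<open>t\<close> of a curve in \<open>L\<^sup>2\<close>.
\<close>

definition has_L2_derivative ::
    "'a measure \<Rightarrow> (real \<Rightarrow> 'a \<Rightarrow> 'b::euclidean_space) \<Rightarrow> ('a \<Rightarrow> 'b) \<Rightarrow> real \<Rightarrow> bool" where
  "has_L2_derivative M u u' t \<longleftrightarrow>
     L2_tendsto M (\<lambda>s x. (u s x - u t x) /\<^sub>R (s - t)) u' (at t)"

lemma has_L2_derivative_tendsto:
  assumes d: "has_L2_derivative M u u' t" and u2: "eventually (\<lambda>s. in_Lp M 2 (u s)) (at t)"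
    and ut: "in_Lp M 2 (u t)" and u': "in_Lp M 2 u'"
  shows "L2_tendsto M u (u t) (at t)"
  unfolding L2_tendsto_def
proof (rule Lim_null_comparison)
  let ?q = "\<lambda>s x. (u s x - u t x) /\<^sub>R (s - t)"
  have "((\<lambda>s. \<bar>s - t\<bar> * (Lp_norm M 2 (\<lambda>x. ?q s x - u' x) + Lp_norm M 2 u')) \<longlongrightarrow>
      \<bar>t - t\<bar> * (0 + Lp_norm M 2 u')) (at t)"
    using d unfolding has_L2_derivative_def L2_tendsto_def by (intro tendsto_intros)
  then show "((\<lambda>s. \<bar>s - t\<bar> * (Lp_norm M 2 (\<lambda>x. ?q s x - u' x) + Lp_norm M 2 u')) \<longlongrightarrow> 0) (at t)" by simp
  have ne: "eventually (\<lambda>s. s \<noteq> t) (at t)" by (simp add: eventually_at_filter)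
  show "eventually (\<lambda>s. norm (Lp_norm M 2 (\<lambda>x. u s x - u t x))
      \<le> \<bar>s - t\<bar> * (Lp_norm M 2 (\<lambda>x. ?q s x - u' x) + Lp_norm M 2 u')) (at t)"
    using u2 ne
  proof eventually_elim
    case (elim s)
    have q: "in_Lp M 2 (?q s)" using elim ut by (intro in_L2_scale in_L2_diff)
    have "Lp_norm M 2 (\<lambda>x. u s x - u t x) = Lp_norm M 2 (\<lambda>x. (s - t) *\<^sub>R ?q s x)"
      using elim by simp
    also have "\<dots> = \<bar>s - t\<bar> * Lp_norm M 2 (\<lambda>x. (?q s x - u' x) + u' x)"
      unfolding Lp_norm_2_scale[of M "s - t" "?q s"] by simp
    also have "\<dots> \<le> \<bar>s - t\<bar> * (Lp_norm M 2 (\<lambda>x. ?q s x - u' x) + Lp_norm M 2 u')"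
      using q u' by (intro mult_left_mono Lp_norm_2_triangle in_L2_diff) auto
    finally show ?case by (simp add: Lp_norm_2_nonneg)
  qed
qed

lemma eventually_in_L2_quotient:
  assumes "eventually (\<lambda>s. in_Lp M 2 (u s)) F" "in_Lp M 2 (u t)"
  shows "eventually (\<lambda>s. in_Lp M 2 (\<lambda>x. (u s x - u t x) /\<^sub>R (s - t))) F"
  using assms(1) by eventually_elim (intro in_L2_scale in_L2_diff assms(2))

lemma L2_inner_has_derivative:
  assumes du: "has_L2_derivative M u u' t" and dv: "has_L2_derivative M v v' t"
    and u2: "eventually (\<lambda>s. in_Lp M 2 (u s)) (at t)" and v2: "eventually (\<lambda>s. in_Lp M 2 (v s)) (at t)"
    and t: "in_Lp M 2 (u t)" "in_Lp M 2 (v t)" and d: "in_Lp M 2 u'" "in_Lp M 2 v'"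
  shows "((\<lambda>s. L2_inner M (u s) (v s)) has_real_derivative (L2_inner M u' (v t) + L2_inner M (u t) v')) (at t)"
proof -
  let ?qu = "\<lambda>s x. (u s x - u t x) /\<^sub>R (s - t)" and ?qv = "\<lambda>s x. (v s x - v t x) /\<^sub>R (s - t)"
  have q2: "eventually (\<lambda>s. in_Lp M 2 (?qu s)) (at t)" "eventually (\<lambda>s. in_Lp M 2 (?qv s)) (at t)"
    by (rule eventually_in_L2_quotient[OF u2 t(1)], rule eventually_in_L2_quotient[OF v2 t(2)])
  have "((\<lambda>s. L2_inner M (?qu s) (v s) + L2_inner M (u t) (?qv s)) \<longlongrightarrow>
      L2_inner M u' (v t) + L2_inner M (u t) v') (at t)"
    using du dv t d q2 v2
    by (intro tendsto_add L2_tendsto_inner L2_tendsto_const has_L2_derivative_tendsto[OF dv])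
       (auto simp: has_L2_derivative_def)
  moreover have "eventually (\<lambda>s. L2_inner M (?qu s) (v s) + L2_inner M (u t) (?qv s)
      = (L2_inner M (u s) (v s) - L2_inner M (u t) (v t)) / (s - t)) (at t)"
    using u2 v2
  proof eventually_elim
    case (elim s)
    then have "L2_inner M (?qu s) (v s) = inverse (s - t) * (L2_inner M (u s) (v s) - L2_inner M (u t) (v s))"
      "L2_inner M (u t) (?qv s) = inverse (s - t) * (L2_inner M (u t) (v s) - L2_inner M (u t) (v t))"
      unfolding L2_inner_scale_left L2_inner_scale_right
      using t by (simp_all add: L2_inner_diff_left L2_inner_diff_right)
    then show ?case by (simp add: divide_inverse algebra_simps)
  qed
  ultimately show ?thesis
    unfolding has_field_derivative_iff by (rule Lim_transform_eventually)
qed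

lemma has_L2_derivative_diff:
  assumes du: "has_L2_derivative M u u' t" and dv: "has_L2_derivative M v v' t"
    and u2: "eventually (\<lambda>s. in_Lp M 2 (u s)) (at t)" and v2: "eventually (\<lambda>s. in_Lp M 2 (v s)) (at t)"
    and t: "in_Lp M 2 (u t)" "in_Lp M 2 (v t)" and d: "in_Lp M 2 u'" "in_Lp M 2 v'"
  shows "has_L2_derivative M (\<lambda>s x. u s x - v s x) (\<lambda>x. u' x - v' x) t"
proof -
  have "(\<lambda>s x. (u s x - v s x - (u t x - v t x)) /\<^sub>R (s - t))
      = (\<lambda>s x. (u s x - u t x) /\<^sub>R (s - t) - (v s x - v t x) /\<^sub>R (s - t))"
    by (simp add: fun_eq_iff scaleR_diff_right)
  then show ?thesis
    using assms unfolding has_L2_derivative_def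
    by (simp add: L2_tendsto_diff eventually_in_L2_quotient)
qed

lemma has_L2_derivative_shift:
  assumes "has_L2_derivative M u u' (t + h)"
  shows "has_L2_derivative M (\<lambda>s. u (s + h)) u' t"
proof -
  have "filterlim (\<lambda>s. s + h) (at (t + h)) (at t)"
    by (intro filterlim_atI tendsto_intros) (auto simp: eventually_at_filter)
  from filterlim_compose[OF assms[unfolded has_L2_derivative_def L2_tendsto_def] this]
  show ?thesis by (simp add: has_L2_derivative_def L2_tendsto_def)
qed

lemma L1_le_L2:
  assumes M: "finite_measure M" and u: "in_Lp M 2 u"
  shows "integrable M (\<lambda>x. norm (u x))"
    "(\<integral>x. norm (u x) \<partial>M) \<le> (measure M (space M) + L2_inner M u u) / 2"
proof -
  interpret finite_measure M by fact
  have m: "u \<in> borel_measurable M" and i: "integrable M (\<lambda>x. (norm (u x))\<^sup>2)" using u by (auto simp: in_L2_iff)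
  have b: "norm (u x) \<le> (1 + (norm (u x))\<^sup>2) / 2" for x
    using sum_squares_bound[of 1 "norm (u x)"] by simp
  have I: "integrable M (\<lambda>x. (1 + (norm (u x))\<^sup>2) / 2)" using i by simp
  show 1: "integrable M (\<lambda>x. norm (u x))"
    by (rule Bochner_Integration.integrable_bound[OF I]) (use m b in \<open>auto intro: order_trans[OF _ abs_ge_self]\<close>)
  have "(\<integral>x. norm (u x) \<partial>M) \<le> (\<integral>x. (1 + (norm (u x))\<^sup>2) / 2 \<partial>M)"
    by (intro integral_mono 1 I b)
  also have "\<dots> = (measure M (space M) + L2_inner M u u) / 2"
    using i by (simp add: L2_inner_def power2_norm_eq_inner)
  finally show "(\<integral>x. norm (u x) \<partial>M) \<le> (measure M (space M) + L2_inner M u u) / 2" .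
qed

lemma in_L1_iff: "in_Lp M 1 u \<longleftrightarrow> u \<in> borel_measurable M \<and> integrable M (\<lambda>x. norm (u x))"
  by (simp add: in_Lp_def)

lemma Lp_norm_1: "Lp_norm M 1 u = (\<integral>x. norm (u x) \<partial>M)"
  by (simp add: Lp_norm_def integral_nonneg_AE)

section \<open>A Gronwall inequality\<close>

text \<open>
  The differential inequality holds only almost everywhere because the weak formulation does. The
  derivative itself exists everywhere, and for the gauge integral the fundamental theorem of calculus
  then needs no regularity of \<open>y'\<close>. The nonnegative term \<open>e\<close> collects the
  dissipation.
\<close>

lemma gronwall:
  fixes y y' e b :: "real \<Rightarrow> real"
  assumes st: "s \<le> t" and A: "0 \<le> A"
    and y: "\<And>\<tau>. \<tau> \<in> {s..t} \<Longrightarrow> (y has_real_derivative y' \<tau>) (at \<tau>)"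
    and e: "continuous_on {s..t} e" "\<And>\<tau>. \<tau> \<in> {s..t} \<Longrightarrow> 0 \<le> e \<tau>"
    and b: "integrable lborel b" "\<And>\<tau>. 0 \<le> b \<tau>"
    and ae: "AE \<tau> in lborel. \<tau> \<in> {s..t} \<longrightarrow> y' \<tau> + e \<tau> \<le> A * y \<tau> + b \<tau>"
  shows "y t + integral {s..t} e \<le> exp (A * (t - s)) * (y s + integral\<^sup>L lborel b)"
proof -
  define z where "z \<tau> = exp (- A * (\<tau> - s)) * y \<tau>" for \<tau>
  define z' where "z' \<tau> = exp (- A * (\<tau> - s)) * (y' \<tau> - A * y \<tau>)" for \<tau>
  define c where "c = exp (- A * (t - s))"
  have "(z has_real_derivative z' \<tau>) (at \<tau> within {s..t})" if "\<tau> \<in> {s..t}" for \<tau>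
    unfolding z_def z'_def
    by (rule derivative_eq_intros has_field_derivative_at_within[OF y[OF that]] refl)+
       (simp add: algebra_simps)
  then have I1: "(z' has_integral z t - z s) {s..t}"
    by (intro fundamental_theorem_of_calculus st) (simp add: has_real_derivative_iff_has_vector_derivative)
  have I2: "((\<lambda>\<tau>. c * e \<tau>) has_integral c * integral {s..t} e) {s..t}"
    by (intro has_integral_mult_right integrable_integral integrable_continuous_real e)
  have bU: "b integrable_on UNIV" using b(1) by (rule integrable_on_lborel)
  have bs: "b integrable_on {s..t}" by (rule integrable_on_subinterval[OF bU]) simp
  have bB: "integral {s..t} b \<le> integral\<^sup>L lborel b"
    using integral_subset_le[OF _ bs bU] b integral_unique[OF has_integral_integral_lborel[OF b(1)]] by simp
  obtain Z where Z: "Z \<in> null_sets lborel"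
    "{\<tau>. \<not> (\<tau> \<in> {s..t} \<longrightarrow> y' \<tau> + e \<tau> \<le> A * y \<tau> + b \<tau>)} \<subseteq> Z"
    using ae unfolding eventually_ae_filter by auto
  have neg: "negligible Z" using Z(1) by (simp add: negligible_iff_null_sets null_sets_completionI)
  define l where "l \<tau> = (if \<tau> \<in> Z then b \<tau> else z' \<tau> + c * e \<tau>)" for \<tau>
  have I3: "(l has_integral (z t - z s) + c * integral {s..t} e) {s..t}"
    by (rule has_integral_spike[OF neg _ has_integral_add[OF I1 I2]]) (simp add: l_def)
  have "l \<tau> \<le> b \<tau>" if \<tau>: "\<tau> \<in> {s..t}" for \<tau>
  proof (cases "\<tau> \<in> Z")
    case False
    define k where "k = exp (- A * (\<tau> - s))"
    have k: "0 < k" "k \<le> 1" "c \<le> k" using \<tau> A by (auto simp: k_def c_def intro: mult_left_mono)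
    have "y' \<tau> - A * y \<tau> \<le> b \<tau> - e \<tau>" using Z(2) False \<tau> by auto
    then have "z' \<tau> \<le> k * (b \<tau> - e \<tau>)" using k unfolding z'_def k_def[symmetric] by (intro mult_left_mono) auto
    moreover have "c * e \<tau> \<le> k * e \<tau>" using k e(2)[OF \<tau>] by (intro mult_right_mono) auto
    moreover have "k * b \<tau> \<le> 1 * b \<tau>" using k b(2)[of \<tau>] by (intro mult_right_mono) auto
    ultimately show ?thesis using False by (simp add: l_def algebra_simps)
  qed (simp add: l_def)
  from has_integral_le[OF I3 integrable_integral[OF bs] this]
  have "c * y t - y s + c * integral {s..t} e \<le> integral\<^sup>L lborel b"
    using bB by (simp add: z_def c_def)
  then have "c * (y t + integral {s..t} e) \<le> y s + integral\<^sup>L lborel b" by (simp add: algebra_simps)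
  then have "exp (A * (t - s)) * (c * (y t + integral {s..t} e)) \<le> exp (A * (t - s)) * (y s + integral\<^sup>L lborel b)"
    by (intro mult_left_mono) auto
  then show ?thesis by (simp add: c_def mult.assoc[symmetric] exp_minus)
qed

section \<open>Lebesgue measurable data and Borel representatives\<close>

lemma lebesgue_on_AE_iff:
  assumes "U \<in> sets lborel"
  shows "(AE x in lebesgue_on U. P x) \<longleftrightarrow> (AE x in lborel. x \<in> U \<longrightarrow> P x)"
  using assms by (subst AE_restrict_space_iff) (auto simp: AE_completion_iff)

lemma lebesgue_on_borel_measurable:
  assumes "h \<in> borel_measurable borel"
  shows "h \<in> borel_measurable (lebesgue_on U)"
  using assms by (intro measurable_restrict_space1 measurable_completion) simp

lemma lebesgue_on_integral:
  fixes h :: "'a::euclidean_space \<Rightarrow> 'b::euclidean_space"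
  assumes U: "U \<in> sets borel" and h: "h \<in> borel_measurable borel"
  shows "integral\<^sup>L (lebesgue_on U) h = (\<integral>x. indicator U x *\<^sub>R h x \<partial>lborel)"
    "integrable (lebesgue_on U) h \<longleftrightarrow> integrable lborel (\<lambda>x. indicator U x *\<^sub>R h x)"
proof -
  have m: "(\<lambda>x. indicator U x *\<^sub>R h x) \<in> borel_measurable lborel" using assms by simp
  have U': "U \<inter> space lebesgue \<in> sets lebesgue" using U by simp
  show "integral\<^sup>L (lebesgue_on U) h = (\<integral>x. indicator U x *\<^sub>R h x \<partial>lborel)"
    by (subst integral_restrict_space[OF U']) (rule integral_completion[OF m])
  show "integrable (lebesgue_on U) h \<longleftrightarrow> integrable lborel (\<lambda>x. indicator U x *\<^sub>R h x)"
    by (subst integrable_restrict_space[OF U']) (rule integrable_completion[OF m])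
qed

text \<open>
  Completeness of Lebesgue measure. It is needed for functions of time, and for time slices of the
  source, that are known only up to null sets.
\<close>

lemma AE_eq_borel_measurable_lebesgue_on:
  fixes u h :: "'a::euclidean_space \<Rightarrow> real"
  assumes U: "U \<in> sets borel" and h: "h \<in> borel_measurable (lebesgue_on U)"
    and ae: "AE x in lebesgue_on U. u x = h x"
  shows "u \<in> borel_measurable (lebesgue_on U)"
proof -
  have U': "U \<inter> space lebesgue \<in> sets lebesgue" using U by simp
  have 1: "(\<lambda>x. indicator U x *\<^sub>R h x) \<in> borel_measurable lebesgue"
    using h by (simp add: borel_measurable_restrict_space_iff[OF U'])
  have 2: "AE x in lebesgue. indicator U x *\<^sub>R h x = indicator U x *\<^sub>R u x"
    using ae unfolding AE_restrict_space_iff[OF U'] by eventually_elim (auto simp: indicator_def)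
  have "(\<lambda>x. indicator U x *\<^sub>R u x) \<in> borel_measurable lebesgue"
  proof (rule measurableI)
    fix A :: "real set" assume A: "A \<in> sets borel"
    show "(\<lambda>x. indicator U x *\<^sub>R u x) -` A \<inter> space lebesgue \<in> sets lebesgue"
    proof (rule completion.in_sets_AE)
      show "(\<lambda>x. indicator U x *\<^sub>R h x) -` A \<inter> space lebesgue \<in> sets lebesgue"
        by (rule measurable_sets[OF 1 A])
      show "AE x in lebesgue. (x \<in> (\<lambda>x. indicator U x *\<^sub>R h x) -` A \<inter> space lebesgue)
          = (x \<in> (\<lambda>x. indicator U x *\<^sub>R u x) -` A \<inter> space lebesgue)"
        using 2 by eventually_elim auto
    qed auto
  qed simp
  then show ?thesis by (simp add: borel_measurable_restrict_space_iff[OF U'])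
qed

lemma borel_representative:
  fixes u :: "'a::euclidean_space \<Rightarrow> real"
  assumes U: "U \<in> sets borel" and u: "u \<in> borel_measurable (lebesgue_on U)"
  obtains h where "h \<in> borel_measurable borel" "\<And>x. x \<notin> U \<Longrightarrow> h x = 0"
    "AE x in lebesgue_on U. u x = h x"
proof -
  have U': "U \<inter> space lebesgue \<in> sets lebesgue" using U by simp
  have "(\<lambda>x. indicator U x *\<^sub>R u x) \<in> borel_measurable lebesgue"
    using u by (simp add: borel_measurable_restrict_space_iff[OF U'])
  from completion_ex_borel_measurable_real[OF this]
  obtain g where g: "g \<in> borel_measurable lborel" "AE x in lborel. indicator U x *\<^sub>R u x = g x" by auto
  show ?thesis
  proof (rule that[of "\<lambda>x. indicator U x * g x"])
    show "(\<lambda>x. indicator U x * g x) \<in> borel_measurable borel" using g U by simp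
    show "AE x in lebesgue_on U. u x = indicator U x * g x"
      unfolding lebesgue_on_AE_iff[of U, simplified, OF U] using g(2) by eventually_elim auto
  qed simp
qed

lemma finite_measure_lebesgue_on:
  assumes "bounded U" "U \<in> sets borel"
  shows "finite_measure (lebesgue_on U)"
proof
  have "emeasure lborel U < \<infinity>" using assms(1) by (rule emeasure_bounded_finite)
  then show "emeasure (lebesgue_on U) (space (lebesgue_on U)) \<noteq> \<infinity>"
    using assms(2) by (simp add: emeasure_restrict_space)
qed

lemma in_L2_bounded_function:
  fixes h :: "'a \<Rightarrow> 'b::euclidean_space"
  assumes "finite_measure M" "h \<in> borel_measurable M" "\<And>x. x \<in> space M \<Longrightarrow> norm (h x) \<le> B"
  shows "in_Lp M 2 h"
proof -
  interpret finite_measure M by fact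
  have "(norm (h x))\<^sup>2 \<le> B\<^sup>2" if "x \<in> space M" for x using assms(3)[OF that] by (simp add: power_mono)
  then show ?thesis unfolding in_L2_iff using assms(2)
    by (intro conjI integrable_const_bound[where B="B\<^sup>2"] AE_I2) auto
qed

lemma in_L2_imp_integrable:
  fixes u :: "'a \<Rightarrow> 'b::euclidean_space"
  assumes "finite_measure M" "in_Lp M 2 u"
  shows "integrable M u"
  using L1_le_L2(1)[OF assms] assms(2) by (simp add: in_L2_iff integrable_norm_iff)

text \<open>
  Product measures and translations are handled for Borel functions on the whole space, whereas the data
  are Lebesgue measurable on a subset.
\<close>

lemma L2_borel_representative:
  fixes u :: "'a::euclidean_space \<Rightarrow> real"
  assumes V: "bounded V" "V \<in> sets borel" and u: "in_Lp (lebesgue_on V) 2 u"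
  obtains h where "h \<in> borel_measurable borel" "\<And>x. x \<notin> V \<Longrightarrow> h x = 0"
    "AE x in lborel. x \<in> V \<longrightarrow> u x = h x"
    "integrable lborel h" "integrable lborel (\<lambda>x. (h x)\<^sup>2)"
    "\<And>\<eta>. \<eta> \<in> borel_measurable borel \<Longrightarrow> (\<integral>x. u x * \<eta> x \<partial>lebesgue_on V) = (\<integral>x. h x * \<eta> x \<partial>lborel)"
proof -
  have um: "u \<in> borel_measurable (lebesgue_on V)" and u2: "integrable (lebesgue_on V) (\<lambda>x. (u x)\<^sup>2)"
    using u by (auto simp: in_L2_iff)
  have u1: "integrable (lebesgue_on V) u"
    by (rule in_L2_imp_integrable[OF finite_measure_lebesgue_on[OF V] u])
  from borel_representative[OF V(2) um]
  obtain h where h: "h \<in> borel_measurable borel" "\<And>x. x \<notin> V \<Longrightarrow> h x = 0"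
    "AE x in lebesgue_on V. u x = h x" by blast
  have [measurable]: "h \<in> borel_measurable borel" by (rule h(1))
  have hm: "h \<in> borel_measurable (lebesgue_on V)" by (rule lebesgue_on_borel_measurable[OF h(1)])
  have z: "indicator V x *\<^sub>R h x = h x" "indicator V x *\<^sub>R (h x)\<^sup>2 = (h x)\<^sup>2"
    "indicator V x *\<^sub>R (h x * k) = h x * k" for x and k :: real
    using h(2)[of x] by (auto simp: indicator_def)
  show ?thesis
  proof (rule that[OF h(1,2)])
    show "AE x in lborel. x \<in> V \<longrightarrow> u x = h x" using h(3) V by (simp add: lebesgue_on_AE_iff)
    have "integrable (lebesgue_on V) h" using integrable_cong_AE_imp[OF u1 hm] h(3) by simp
    then show "integrable lborel h" unfolding lebesgue_on_integral(2)[OF V(2) h(1)] z .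
    have m2: "(\<lambda>x. (h x)\<^sup>2) \<in> borel_measurable borel" by measurable
    have "integrable (lebesgue_on V) (\<lambda>x. (h x)\<^sup>2)"
      by (rule integrable_cong_AE_imp[OF u2 lebesgue_on_borel_measurable[OF m2]])
         (use h(3) in eventually_elim, simp)
    then show "integrable lborel (\<lambda>x. (h x)\<^sup>2)" unfolding lebesgue_on_integral(2)[OF V(2) m2] z .
    fix \<eta> :: "'a \<Rightarrow> real" assume [measurable]: "\<eta> \<in> borel_measurable borel"
    have m: "(\<lambda>x. h x * \<eta> x) \<in> borel_measurable borel" by measurable
    have em: "\<eta> \<in> borel_measurable (lebesgue_on V)" by (rule lebesgue_on_borel_measurable) measurable
    have "(\<integral>x. u x * \<eta> x \<partial>lebesgue_on V) = (\<integral>x. h x * \<eta> x \<partial>lebesgue_on V)"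
      using h(3) um hm em by (intro integral_cong_AE) auto
    also have "\<dots> = (\<integral>x. h x * \<eta> x \<partial>lborel)" unfolding lebesgue_on_integral(1)[OF V(2) m] z ..
    finally show "(\<integral>x. u x * \<eta> x \<partial>lebesgue_on V) = (\<integral>x. h x * \<eta> x \<partial>lborel)" .
  qed
qed

section \<open>Testing with fields in H(div)\<close>

lemma test_field_in_Hdiv:
  fixes U :: "(real^'d) set"
  assumes U: "open U" "bounded U" and t: "test_function U \<eta>"
  shows "in_Hdiv U (\<lambda>x. \<eta> x *\<^sub>R axis i 1)"
proof -
  note fin = finite_measure_lebesgue_on[OF U(2)] 
  have Ub: "U \<in> sets borel" using U by simp
  obtain B where B: "\<And>x. \<bar>\<eta> x\<bar> \<le> B" "\<And>x. \<bar>frechet_derivative \<eta> (at x) (axis i 1)\<bar> \<le> B"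
    using test_function_bounded[OF t, where v="axis i 1"] by metis
  note [measurable] = test_function_measurable[OF t]
  have out: "\<eta> x = 0" "frechet_derivative \<eta> (at x) v = 0" if "x \<notin> U" for x v
    using that t closure_subset[of "{x. \<eta> x \<noteq> 0}"] test_function_deriv_support[OF t, of x v]
    by (auto simp: test_function_def)
  show ?thesis unfolding in_Hdiv_def
  proof (intro conjI exI[of _ "\<lambda>x. frechet_derivative \<eta> (at x) (axis i 1)"] allI impI)
    show "in_Lp (lebesgue_on U) 2 (\<lambda>x. \<eta> x *\<^sub>R axis i (1::real))"
      by (rule in_L2_bounded_function[OF fin[OF Ub], of _ B])
        (auto intro!: lebesgue_on_borel_measurable simp: B(1))
    show "in_Lp (lebesgue_on U) 2 (\<lambda>x. frechet_derivative \<eta> (at x) (axis i 1))"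
      by (rule in_L2_bounded_function[OF fin[OF Ub], of _ B])
        (auto intro!: lebesgue_on_borel_measurable simp: B(2))
    fix \<zeta> assume z: "test_function U \<zeta>"
    note [measurable] = test_function_measurable[OF z]
    have "(\<integral>x. (\<eta> x *\<^sub>R axis i 1) \<bullet> classical_gradient \<zeta> x \<partial>lebesgue_on U)
        = (\<integral>x. \<eta> x * frechet_derivative \<zeta> (at x) (axis i 1) \<partial>lebesgue_on U)"
      by (simp add: inner_axis' classical_gradient_def)
    also have "\<dots> = (\<integral>x. \<eta> x * frechet_derivative \<zeta> (at x) (axis i 1) \<partial>lborel)"
      by (subst lebesgue_on_integral(1)[OF Ub]) (auto intro!: Bochner_Integration.integral_cong simp: out indicator_def)
    also have "\<dots> = - (\<integral>x. frechet_derivative \<eta> (at x) (axis i 1) * \<zeta> x \<partial>lborel)"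
      by (rule test_function_integration_by_parts[OF t z])
    also have "(\<integral>x. frechet_derivative \<eta> (at x) (axis i 1) * \<zeta> x \<partial>lborel)
       = (\<integral>x. frechet_derivative \<eta> (at x) (axis i 1) * \<zeta> x \<partial>lebesgue_on U)"
      by (subst lebesgue_on_integral(1)[OF Ub]) (auto intro!: Bochner_Integration.integral_cong simp: out indicator_def)
    finally show "(\<integral>x. (\<eta> x *\<^sub>R axis i 1) \<bullet> classical_gradient \<zeta> x \<partial>lebesgue_on U)
        = - (\<integral>x. frechet_derivative \<eta> (at x) (axis i 1) * \<zeta> x \<partial>lebesgue_on U)" .
  qed
qed

lemma in_L2_component:
  fixes w :: "'a \<Rightarrow> real^'d"
  assumes "in_Lp M 2 w"
  shows "in_Lp M 2 (\<lambda>x. w x $ i)"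
proof (rule in_L2_bounded[OF assms, of _ 1])
  show "(\<lambda>x. w x $ i) \<in> borel_measurable M"
    using in_L2_measurable[OF assms] unfolding cart_eq_inner_axis by (intro borel_measurable_inner) auto
qed (simp add: component_le_norm_cart)

text \<open>
  Test functions times coordinate vectors belong to \<open>H(div)\<close>, so every component satisfies
  the hypothesis of the fundamental lemma. Applied to \<open>w = m + K(|\<nabla>\<rho>|)
  \<nabla>\<rho>\<close> this gives the constitutive law pointwise.
\<close>

lemma Hdiv_orthogonal_zero:
  fixes U :: "(real^'d) set" and w :: "real^'d \<Rightarrow> real^'d"
  assumes U: "open U" "bounded U" and w: "in_Lp (lebesgue_on U) 2 w"
    and zero: "\<And>z. in_Hdiv U z \<Longrightarrow> L2_inner (lebesgue_on U) w z = 0"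
  shows "AE x in lebesgue_on U. w x = 0"
proof -
  have Ub: "U \<in> sets borel" using U by simp
  have "AE x in lebesgue_on U. w x $ i = 0" for i
  proof -
    obtain h where h: "h \<in> borel_measurable borel" "\<And>x. x \<notin> U \<Longrightarrow> h x = 0"
      "AE x in lborel. x \<in> U \<longrightarrow> w x $ i = h x"
      "integrable lborel h" "integrable lborel (\<lambda>x. (h x)\<^sup>2)"
      "\<And>\<eta>. \<eta> \<in> borel_measurable borel \<Longrightarrow> (\<integral>x. w x $ i * \<eta> x \<partial>lebesgue_on U) = (\<integral>x. h x * \<eta> x \<partial>lborel)"
      by (rule L2_borel_representative[OF U(2) Ub in_L2_component[OF w]]) (rule that)
    have "AE x in lborel. x \<in> U \<longrightarrow> h x = 0"
    proof (rule fundamental_lemma[OF U(1) h(4)])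
      fix \<eta> assume t: "test_function U \<eta>"
      have "(\<integral>x. h x * \<eta> x \<partial>lborel) = (\<integral>x. w x $ i * \<eta> x \<partial>lebesgue_on U)"
        using h(6)[OF test_function_measurable(1)[OF t]] by simp
      also have "\<dots> = L2_inner (lebesgue_on U) w (\<lambda>x. \<eta> x *\<^sub>R axis i 1)"
        by (simp add: L2_inner_def inner_axis mult.commute)
      also have "\<dots> = 0" by (rule zero[OF test_field_in_Hdiv[OF U t]])
      finally show "(\<integral>x. h x * \<eta> x \<partial>lborel) = 0" .
    qed
    with h(3) have "AE x in lborel. x \<in> U \<longrightarrow> w x $ i = 0" by eventually_elim simp
    then show ?thesis using Ub by (simp add: lebesgue_on_AE_iff)
  qed
  then have "AE x in lebesgue_on U. \<forall>i\<in>UNIV. w x $ i = 0" by (intro AE_finite_allI) auto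
  then show ?thesis by eventually_elim (simp add: vec_eq_iff)
qed

section \<open>Difference quotients of weakly differentiable functions\<close>

lemma frechet_derivative_translate:
  assumes "test_function U \<eta>"
  shows "frechet_derivative (\<lambda>x. \<eta> (x + c)) (at x) v = frechet_derivative \<eta> (at (x + c)) v"
proof -
  have "((\<lambda>x. x + c) has_derivative (\<lambda>v. v)) (at x)" by (auto intro!: derivative_eq_intros)
  from has_derivative_compose[OF this test_function_derivative[OF assms]]
  have "((\<lambda>x. \<eta> (x + c)) has_derivative frechet_derivative \<eta> (at (x + c))) (at x)" .
  from frechet_derivative_at[OF this] show ?thesis by simp
qed

lemma lborel_nn_integral_translate:
  fixes f :: "'a::euclidean_space \<Rightarrow> ennreal"
  assumes [measurable]: "f \<in> borel_measurable borel"
  shows "(\<integral>\<^sup>+z. f (z + c) \<partial>lborel) = (\<integral>\<^sup>+z. f z \<partial>lborel)"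
proof -
  have "(\<integral>\<^sup>+z. f z \<partial>lborel) = (\<integral>\<^sup>+z. f z \<partial>distr lborel borel ((+) c))" by (simp add: lborel_distr_plus)
  also have "\<dots> = (\<integral>\<^sup>+z. f (c + z) \<partial>lborel)" by (subst nn_integral_distr) auto
  finally show ?thesis by (simp add: add.commute)
qed

lemma lborel_integrable_translate:
  fixes f :: "'a::euclidean_space \<Rightarrow> real"
  assumes "integrable lborel f"
  shows "integrable lborel (\<lambda>z. f (z + c))"
proof -
  have [measurable]: "f \<in> borel_measurable borel" using assms by auto
  show ?thesis using assms unfolding integrable_iff_bounded
    by (simp add: lborel_nn_integral_translate[of "\<lambda>z. ennreal \<bar>f z\<bar>"])
qed

lemma AE_lborel_translate:
  fixes c :: "'a::euclidean_space"
  assumes "AE z in lborel. P z"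
  shows "AE z in lborel. P (z + c)"
proof -
  have "AE z in distr lborel borel ((+) c). P z" unfolding lborel_distr_plus by (rule assms)
  from AE_distrD[OF _ this] have "AE z in lborel. P (c + z)" by simp
  then show ?thesis by (simp add: add.commute)
qed

lemma integrable_time_average:
  fixes k :: "'a::euclidean_space \<Rightarrow> real"
  assumes k: "integrable lborel k"
  shows "integrable (lborel \<Otimes>\<^sub>M lborel) (\<lambda>(\<sigma>::real, z). indicator {0..h} \<sigma> * k (z + \<sigma> *\<^sub>R e))"
proof -
  have [measurable]: "k \<in> borel_measurable borel" using k by auto
  have m: "(\<lambda>(\<sigma>::real, z). indicator {0..h} \<sigma> * k (z + \<sigma> *\<^sub>R e)) \<in> borel_measurable (lborel \<Otimes>\<^sub>M lborel)"
    by measurable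
  have "(\<integral>\<^sup>+p. ennreal (norm (case p of (\<sigma>, z) \<Rightarrow> indicator {0..h} \<sigma> * k (z + \<sigma> *\<^sub>R e))) \<partial>(lborel \<Otimes>\<^sub>M lborel))
     = (\<integral>\<^sup>+\<sigma>. (\<integral>\<^sup>+z. ennreal (norm (indicator {0..h} \<sigma> * k (z + \<sigma> *\<^sub>R e))) \<partial>lborel) \<partial>lborel)"
    using m by (subst lborel.nn_integral_fst[symmetric]) auto
  also have "\<dots> = (\<integral>\<^sup>+\<sigma>. indicator {0..h} \<sigma> * (\<integral>\<^sup>+z. ennreal (norm (k z)) \<partial>lborel) \<partial>lborel)"
  proof (intro nn_integral_cong)
    fix \<sigma> :: real
    have "(\<integral>\<^sup>+z. ennreal (norm (indicator {0..h} \<sigma> * k (z + \<sigma> *\<^sub>R e))) \<partial>lborel)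
        = (\<integral>\<^sup>+z. indicator {0..h} \<sigma> * ennreal (norm (k (z + \<sigma> *\<^sub>R e))) \<partial>lborel)"
      by (intro nn_integral_cong) (auto simp: indicator_def)
    also have "\<dots> = indicator {0..h} \<sigma> * (\<integral>\<^sup>+z. ennreal (norm (k (z + \<sigma> *\<^sub>R e))) \<partial>lborel)"
      by (rule nn_integral_cmult) measurable
    also have "(\<integral>\<^sup>+z. ennreal (norm (k (z + \<sigma> *\<^sub>R e))) \<partial>lborel) = (\<integral>\<^sup>+z. ennreal (norm (k z)) \<partial>lborel)"
      by (rule lborel_nn_integral_translate) measurable
    finally show "(\<integral>\<^sup>+z. ennreal (norm (indicator {0..h} \<sigma> * k (z + \<sigma> *\<^sub>R e))) \<partial>lborel)
        = indicator {0..h} \<sigma> * (\<integral>\<^sup>+z. ennreal (norm (k z)) \<partial>lborel)" .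
  qed
  also have "\<dots> = (\<integral>\<^sup>+z. ennreal (norm (k z)) \<partial>lborel) * emeasure lborel {0..h}"
    by (simp add: nn_integral_multc mult.commute)
  also have "\<dots> < \<infinity>"
    using k emeasure_bounded_finite[of "{0..h}"] by (simp add: integrable_iff_bounded ennreal_mult_less_top)
  finally show ?thesis using m unfolding integrable_iff_bounded by simp
qed

text \<open>
  The fundamental theorem of calculus along the direction \<open>e\<close>. For a test function
  \<open>\<eta>\<close> let \<open>\<Phi>(\<sigma>)\<close> be the integral of \<open>f(z) \<eta>(z -
  \<sigma> e)\<close>. Its derivative is the integral of \<open>k(z) \<eta>(z - \<sigma> e)\<close>
  because the translates are still test functions in \<open>V\<close>. Integrating over \<open>[0,
  h]\<close> and exchanging the integrals shows that the two sides of the claim agree against every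
  \<open>\<eta>\<close>.
\<close>

lemma weak_deriv_difference_quotient:
  fixes f k :: "'a::euclidean_space \<Rightarrow> real"
  assumes f: "integrable lborel f" and k: "integrable lborel k"
    and weak: "\<And>\<eta>. test_function V \<eta> \<Longrightarrow>
        (\<integral>z. f z * frechet_derivative \<eta> (at z) e \<partial>lborel) = - (\<integral>z. k z * \<eta> z \<partial>lborel)"
    and h: "0 \<le> h" and W: "open W" "\<And>z \<sigma>. z \<in> W \<Longrightarrow> 0 \<le> \<sigma> \<Longrightarrow> \<sigma> \<le> h \<Longrightarrow> z + \<sigma> *\<^sub>R e \<in> V"
  shows "AE z in lborel. z \<in> W \<longrightarrow> f (z + h *\<^sub>R e) - f z = (\<integral>\<sigma>. indicator {0..h} \<sigma> * k (z + \<sigma> *\<^sub>R e) \<partial>lborel)"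
proof -
  define q where "q z = (\<integral>\<sigma>. indicator {0..h} \<sigma> * k (z + \<sigma> *\<^sub>R e) \<partial>lborel)" for z
  have [measurable]: "f \<in> borel_measurable borel" "k \<in> borel_measurable borel" using f k by auto
  note I = integrable_time_average[OF k, of h e]
  have q: "integrable lborel q"
    unfolding q_def using lborel_pair.integrable_snd[OF I] .
  have fh: "integrable lborel (\<lambda>z. f (z + h *\<^sub>R e))" by (rule lborel_integrable_translate[OF f])
  have "AE z in lborel. z \<in> W \<longrightarrow> f (z + h *\<^sub>R e) - f z - q z = 0"
  proof (rule fundamental_lemma[OF W(1)])
    show "integrable lborel (\<lambda>z. f (z + h *\<^sub>R e) - f z - q z)" using f fh q by simp
    fix \<eta> assume t: "test_function W \<eta>"
    note [measurable] = test_function_measurable[OF t]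
    obtain B where B: "\<And>x. \<bar>\<eta> x\<bar> \<le> B" using test_function_bounded[OF t, where v=0] by metis
    define \<Phi> where "\<Phi> \<sigma> = (\<integral>z. f z * \<eta> (z + \<sigma> *\<^sub>R (- e)) \<partial>lborel)" for \<sigma>
    define \<Psi> where "\<Psi> \<sigma> = (\<integral>z. k (z + \<sigma> *\<^sub>R e) * \<eta> z \<partial>lborel)" for \<sigma>
    have D: "(\<Phi> has_real_derivative \<Psi> \<sigma>) (at \<sigma>)" if \<sigma>: "\<sigma> \<in> {0..h}" for \<sigma>
    proof -
      let ?\<eta> = "\<lambda>z. \<eta> (z + \<sigma> *\<^sub>R (- e))"
      have t': "test_function V ?\<eta>"
        by (rule test_function_translate[OF t]) (use W(2) \<sigma> in auto)
      have "frechet_derivative \<eta> (at x) (- e) = - frechet_derivative \<eta> (at x) e" for x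
        using linear_neg[OF has_derivative_linear[OF test_function_derivative[OF t]]] .
      then have "(\<integral>z. f z * frechet_derivative \<eta> (at (z + \<sigma> *\<^sub>R (- e))) (- e) \<partial>lborel)
          = - (\<integral>z. f z * frechet_derivative ?\<eta> (at z) e \<partial>lborel)"
        unfolding frechet_derivative_translate[OF t] by simp
      also have "\<dots> = (\<integral>z. k z * \<eta> (z + \<sigma> *\<^sub>R (- e)) \<partial>lborel)" using weak[OF t'] by simp
      also have "\<dots> = \<Psi> \<sigma>"
        unfolding \<Psi>_def
        using lborel_integral_translate[of "\<lambda>z. k z * \<eta> (z + \<sigma> *\<^sub>R (- e))" "\<sigma> *\<^sub>R e"] by simp
      finally show ?thesis
        using integral_translate_test_function_derivative[OF t f, of "- e" \<sigma>] by (simp add: \<Phi>_def[abs_def])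
    qed
    have J: "integrable (lborel \<Otimes>\<^sub>M lborel) (\<lambda>(\<sigma>, z). indicator {0..h} \<sigma> * k (z + \<sigma> *\<^sub>R e) * \<eta> z)"
      using integrable_mult_bounded[OF I, of "\<lambda>p. \<eta> (snd p)" B] B
      by (simp add: case_prod_beta')
    have "(\<integral>z. q z * \<eta> z \<partial>lborel) = (\<integral>z. (\<integral>\<sigma>. indicator {0..h} \<sigma> * k (z + \<sigma> *\<^sub>R e) * \<eta> z \<partial>lborel) \<partial>lborel)"
      by (simp add: q_def)
    also have "\<dots> = (\<integral>\<sigma>. (\<integral>z. indicator {0..h} \<sigma> * k (z + \<sigma> *\<^sub>R e) * \<eta> z \<partial>lborel) \<partial>lborel)"
      using lborel_pair.Fubini_integral[OF J] by simp
    also have "\<dots> = (\<integral>\<sigma>. indicator {0..h} \<sigma> *\<^sub>R \<Psi> \<sigma> \<partial>lborel)"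
      by (simp add: \<Psi>_def mult.assoc)
    also have "\<dots> = \<Phi> h - \<Phi> 0"
    proof -
      have "integrable lborel (\<lambda>\<sigma>. indicator {0..h} \<sigma> *\<^sub>R \<Psi> \<sigma>)"
        using lborel_pair.integrable_fst[OF J] by (simp add: \<Psi>_def mult.assoc)
      from has_integral_integral_lborel[OF this]
      have "((\<lambda>\<sigma>. if \<sigma> \<in> {0..h} then \<Psi> \<sigma> else 0) has_integral (\<integral>\<sigma>. indicator {0..h} \<sigma> *\<^sub>R \<Psi> \<sigma> \<partial>lborel)) UNIV"
        by (rule has_integral_eq[rotated]) (auto simp: indicator_def)
      then have "(\<Psi> has_integral (\<integral>\<sigma>. indicator {0..h} \<sigma> *\<^sub>R \<Psi> \<sigma> \<partial>lborel)) {0..h}"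
        by (simp only: has_integral_restrict_UNIV)
      moreover have "(\<Psi> has_integral \<Phi> h - \<Phi> 0) {0..h}"
        using D h by (intro fundamental_theorem_of_calculus)
          (auto simp: has_real_derivative_iff_has_vector_derivative[symmetric] intro: has_field_derivative_at_within)
      ultimately show ?thesis by (rule has_integral_unique)
    qed
    also have "\<Phi> h = (\<integral>z. f (z + h *\<^sub>R e) * \<eta> z \<partial>lborel)"
      unfolding \<Phi>_def using lborel_integral_translate[of "\<lambda>z. f z * \<eta> (z + h *\<^sub>R (- e))" "h *\<^sub>R e"] by simp
    also have "\<Phi> 0 = (\<integral>z. f z * \<eta> z \<partial>lborel)" by (simp add: \<Phi>_def)
    finally have eq: "(\<integral>z. q z * \<eta> z \<partial>lborel) = (\<integral>z. f (z + h *\<^sub>R e) * \<eta> z \<partial>lborel) - (\<integral>z. f z * \<eta> z \<partial>lborel)" .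
    have i: "integrable lborel (\<lambda>z. f (z + h *\<^sub>R e) * \<eta> z)" "integrable lborel (\<lambda>z. f z * \<eta> z)"
      "integrable lborel (\<lambda>z. q z * \<eta> z)"
      using f fh q B by (auto intro!: integrable_mult_bounded)
    show "(\<integral>z. (f (z + h *\<^sub>R e) - f z - q z) * \<eta> z \<partial>lborel) = 0"
      using eq i by (simp add: left_diff_distrib)
  qed
  then show ?thesis by eventually_elim (simp add: q_def)
qed

text \<open>
  Cauchy-Schwarz in \<open>\<sigma>\<close>, followed by Fubini and translation invariance.
\<close>

lemma weak_deriv_difference_quotient_L2:
  fixes f k :: "'a::euclidean_space \<Rightarrow> real"
  assumes f: "integrable lborel f" and k: "integrable lborel k" "integrable lborel (\<lambda>z. (k z)\<^sup>2)"
    and weak: "\<And>\<eta>. test_function V \<eta> \<Longrightarrow>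
        (\<integral>z. f z * frechet_derivative \<eta> (at z) e \<partial>lborel) = - (\<integral>z. k z * \<eta> z \<partial>lborel)"
    and h: "0 \<le> h" and W: "open W" "\<And>z \<sigma>. z \<in> W \<Longrightarrow> 0 \<le> \<sigma> \<Longrightarrow> \<sigma> \<le> h \<Longrightarrow> z + \<sigma> *\<^sub>R e \<in> V"
  shows "integrable lborel (\<lambda>z. indicator W z * (f (z + h *\<^sub>R e) - f z)\<^sup>2)"
    "(\<integral>z. indicator W z * (f (z + h *\<^sub>R e) - f z)\<^sup>2 \<partial>lborel) \<le> h\<^sup>2 * (\<integral>z. (k z)\<^sup>2 \<partial>lborel)"
proof -
  have [measurable]: "f \<in> borel_measurable borel" "k \<in> borel_measurable borel" "W \<in> sets borel"
    using f k W by auto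
  note I = integrable_time_average[OF k(2), of h e]
  define R where "R z = (\<integral>\<sigma>. indicator {0..h} \<sigma> * (k (z + \<sigma> *\<^sub>R e))\<^sup>2 \<partial>lborel)" for z
  have R: "integrable lborel R" unfolding R_def using lborel_pair.integrable_snd[OF I] .
  have "integral\<^sup>L lborel R = (\<integral>\<sigma>. (\<integral>z. indicator {0..h} \<sigma> * (k (z + \<sigma> *\<^sub>R e))\<^sup>2 \<partial>lborel) \<partial>lborel)"
    unfolding R_def using lborel_pair.Fubini_integral[OF I] by simp
  also have "\<dots> = (\<integral>\<sigma>. indicator {0..h} \<sigma> * (\<integral>z. (k z)\<^sup>2 \<partial>lborel) \<partial>lborel)"
    using lborel_integral_translate[of "\<lambda>z. (k z)\<^sup>2"] by simp
  also have "\<dots> = h * (\<integral>z. (k z)\<^sup>2 \<partial>lborel)" using h by simp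
  finally have Ri: "integral\<^sup>L lborel R = h * (\<integral>z. (k z)\<^sup>2 \<partial>lborel)" .
  have ae: "AE z in lborel. z \<in> W \<longrightarrow> f (z + h *\<^sub>R e) - f z = (\<integral>\<sigma>. indicator {0..h} \<sigma> * k (z + \<sigma> *\<^sub>R e) \<partial>lborel)"
    by (rule weak_deriv_difference_quotient[OF f k(1) weak h W])
  have le: "AE z in lborel. indicator W z * (f (z + h *\<^sub>R e) - f z)\<^sup>2 \<le> h * R z"
    using ae lborel_pair.AE_integrable_snd[OF I]
  proof eventually_elim
    case (elim z)
    have R0: "0 \<le> R z" unfolding R_def by (intro integral_nonneg_AE) auto
    show ?case
    proof (cases "z \<in> W")
      case True
      let ?i = "\<lambda>\<sigma>. indicator {0..h} \<sigma> :: real" and ?k = "\<lambda>\<sigma>. indicator {0..h} \<sigma> * k (z + \<sigma> *\<^sub>R e)"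
      have sq: "(?i \<sigma>)\<^sup>2 = ?i \<sigma>" "(?k \<sigma>)\<^sup>2 = indicator {0..h} \<sigma> * (k (z + \<sigma> *\<^sub>R e))\<^sup>2" for \<sigma>
        by (auto simp: indicator_def)
      have 1: "in_Lp lborel 2 ?i" "in_Lp lborel 2 ?k"
        using elim(2) integrable_real_indicator[OF _ emeasure_bounded_finite[of "{0..h}"]]
        unfolding in_L2_iff by (simp_all add: sq)
      have "f (z + h *\<^sub>R e) - f z = L2_inner lborel ?i ?k"
        unfolding L2_inner_def elim(1)[rule_format, OF True]
        by (intro Bochner_Integration.integral_cong) (auto simp: indicator_def)
      then have "\<bar>f (z + h *\<^sub>R e) - f z\<bar> \<le> Lp_norm lborel 2 ?i * Lp_norm lborel 2 ?k"
        using L2_Cauchy_Schwarz[OF 1] by simp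
      then have "\<bar>f (z + h *\<^sub>R e) - f z\<bar>\<^sup>2 \<le> (Lp_norm lborel 2 ?i * Lp_norm lborel 2 ?k)\<^sup>2"
        by (intro power_mono) auto
      also have "\<dots> = h * R z"
        using h R0 by (simp add: Lp_norm_2 sq power_mult_distrib R_def)
      finally show ?thesis using True by simp
    qed (use h R0 in simp)
  qed
  show i: "integrable lborel (\<lambda>z. indicator W z * (f (z + h *\<^sub>R e) - f z)\<^sup>2)"
  proof (rule Bochner_Integration.integrable_bound)
    show "integrable lborel (\<lambda>z. h * R z)" using R by simp
    show "AE z in lborel. norm (indicator W z * (f (z + h *\<^sub>R e) - f z)\<^sup>2) \<le> norm (h * R z)"
      using le by eventually_elim (simp add: abs_of_nonneg)
  qed measurable
  have "(\<integral>z. indicator W z * (f (z + h *\<^sub>R e) - f z)\<^sup>2 \<partial>lborel) \<le> (\<integral>z. h * R z \<partial>lborel)"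
    using i R le by (intro integral_mono_AE) auto
  also have "\<dots> = h\<^sup>2 * (\<integral>z. (k z)\<^sup>2 \<partial>lborel)" by (simp add: Ri power2_eq_square)
  finally show "(\<integral>z. indicator W z * (f (z + h *\<^sub>R e) - f z)\<^sup>2 \<partial>lborel) \<le> h\<^sup>2 * (\<integral>z. (k z)\<^sup>2 \<partial>lborel)" .
qed

section \<open>Time slices of the source\<close>

lemma AE_lborel_pair_swap:
  fixes P :: "'a::euclidean_space \<times> 'b::euclidean_space \<Rightarrow> bool"
  assumes "AE z in lborel. P z"
  shows "AE y in lborel. AE x in lborel. P (x, y)"
proof -
  obtain Z where Z: "Z \<in> null_sets (lborel :: ('a \<times> 'b) measure)" "{z. \<not> P z} \<subseteq> Z"
    using assms unfolding eventually_ae_filter by auto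
  have Zs: "Z \<in> sets (lborel \<Otimes>\<^sub>M lborel)" and Z0: "emeasure (lborel \<Otimes>\<^sub>M lborel) Z = 0"
    using Z(1) unfolding lborel_prod[symmetric] by (auto dest: null_setsD2 null_setsD1)
  have "(\<integral>\<^sup>+y. emeasure lborel ((\<lambda>x. (x, y)) -` Z) \<partial>lborel) = 0"
    using lborel_pair.emeasure_pair_measure_alt2[OF Zs] Z0 by simp
  then have "AE y in lborel. emeasure lborel ((\<lambda>x. (x, y)) -` Z) = 0"
    by (subst (asm) nn_integral_0_iff_AE[OF lborel_pair.measurable_emeasure_Pair2[OF Zs]])
  then show ?thesis
  proof eventually_elim
    case (elim y)
    have "(\<lambda>x. (x, y)) -` Z \<in> sets lborel" using sets_Pair2[OF Zs] .
    then have "(\<lambda>x. (x, y)) -` Z \<in> null_sets lborel" using elim by (auto intro: null_setsI)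
    moreover have "{x. \<not> P (x, y)} \<subseteq> (\<lambda>x. (x, y)) -` Z" using Z(2) by auto
    ultimately show ?case by (intro AE_I') auto
  qed
qed

text \<open>
  The source enters the estimates only through these properties: its time slices act on
  \<open>L\<^sup>2\<close>, their squared norms are integrable in time, and the increment over a time
  step \<open>h\<close> is of order \<open>h\<close> in the mean square. They hold for a Borel
  representative \<open>f0\<close>, which cannot be told from \<open>f\<close> by the weak formulation
  at almost every time.
\<close>

lemma source_slices:
  fixes U :: "(real^'d) set" and f :: "real \<Rightarrow> real^'d \<Rightarrow> real"
  assumes U: "open U" "bounded U" and f: "source_data U T f"
  obtains f0 K where
    "AE t in lborel. t \<in> {0<..<T} \<longrightarrow> in_Lp (lebesgue_on U) 2 (f0 t) \<and>
        (\<forall>r. r \<in> borel_measurable (lebesgue_on U) \<longrightarrow> L2_inner (lebesgue_on U) (f t) r = L2_inner (lebesgue_on U) (f0 t) r)"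
    "integrable lborel (\<lambda>t. L2_inner (lebesgue_on U) (f0 t) (f0 t))"
    "0 \<le> K"
    "\<And>h. 0 \<le> h \<Longrightarrow> integrable lborel (\<lambda>t. indicator {0<..<T - h} t *
         L2_inner (lebesgue_on U) (\<lambda>x. f0 (t + h) x - f0 t x) (\<lambda>x. f0 (t + h) x - f0 t x))"
    "\<And>h. 0 \<le> h \<Longrightarrow> (\<integral>t. indicator {0<..<T - h} t *
         L2_inner (lebesgue_on U) (\<lambda>x. f0 (t + h) x - f0 t x) (\<lambda>x. f0 (t + h) x - f0 t x) \<partial>lborel) \<le> h\<^sup>2 * K"
proof -
  let ?V = "U \<times> {0<..<T}"
  have V: "bounded ?V" "?V \<in> sets borel" using U by (auto intro!: bounded_Times borel_open open_Times)
  have Ub: "U \<in> sets borel" using U by simp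
  obtain ft where f2: "in_Lp (lebesgue_on ?V) 2 (\<lambda>(x, t). f t x)" and ft2: "in_Lp (lebesgue_on ?V) 2 (\<lambda>(x, t). ft t x)"
    and weak: "weak_deriv ?V (0, 1) (\<lambda>(x, t). f t x) (\<lambda>(x, t). ft t x)"
    using f unfolding source_data_def by auto
  obtain h where h: "h \<in> borel_measurable borel" "\<And>x. x \<notin> ?V \<Longrightarrow> h x = 0"
    "AE x in lborel. x \<in> ?V \<longrightarrow> (case x of (x, t) \<Rightarrow> f t x) = h x"
    "integrable lborel h" "integrable lborel (\<lambda>x. (h x)\<^sup>2)"
    "\<And>\<eta>. \<eta> \<in> borel_measurable borel \<Longrightarrow> (\<integral>x. (case x of (x, t) \<Rightarrow> f t x) * \<eta> x \<partial>lebesgue_on ?V) = (\<integral>x. h x * \<eta> x \<partial>lborel)"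
    by (rule L2_borel_representative[OF V f2]) (rule that)
  obtain k where k0: "k \<in> borel_measurable borel" "\<And>x. x \<notin> ?V \<Longrightarrow> k x = 0"
    "AE x in lborel. x \<in> ?V \<longrightarrow> (case x of (x, t) \<Rightarrow> ft t x) = k x"
    "integrable lborel k" "integrable lborel (\<lambda>x. (k x)\<^sup>2)"
    "\<And>\<eta>. \<eta> \<in> borel_measurable borel \<Longrightarrow> (\<integral>x. (case x of (x, t) \<Rightarrow> ft t x) * \<eta> x \<partial>lebesgue_on ?V) = (\<integral>x. k x * \<eta> x \<partial>lborel)"
    by (rule L2_borel_representative[OF V ft2]) (rule that)
  note k = k0(1,4-6)
  note [measurable] = h(1) k(1)
  have w: "(\<integral>z. h z * frechet_derivative \<eta> (at z) (0, 1) \<partial>lborel) = - (\<integral>z. k z * \<eta> z \<partial>lborel)"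
    if t: "test_function ?V \<eta>" for \<eta>
    unfolding h(6)[OF test_function_measurable(2)[OF t], symmetric]
      k(4)[OF test_function_measurable(1)[OF t], symmetric]
    using weak t unfolding weak_deriv_def by blast
  define f0 where "f0 t x = h (x, t)" for t x
  have slice [measurable]: "(\<lambda>x. h (x, t)) \<in> borel_measurable borel" for t
    using h(1) by measurable
  have f0m: "f0 t \<in> borel_measurable (lebesgue_on U)" for t
    unfolding f0_def by (rule lebesgue_on_borel_measurable) measurable
  have z: "indicator U x *\<^sub>R (h (x, t))\<^sup>2 = (h (x, t))\<^sup>2" for x t
    using h(2)[of "(x, t)"] by (auto simp: indicator_def)
  have h2: "integrable (lborel \<Otimes>\<^sub>M lborel) (\<lambda>(x, t). (h (x, t))\<^sup>2)"
    using h(5) by (simp add: lborel_prod case_prod_beta')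
  have inner: "L2_inner (lebesgue_on U) (f0 t) (f0 t) = (\<integral>x. (h (x, t))\<^sup>2 \<partial>lborel)" for t
  proof -
    have m: "(\<lambda>x. (h (x, t))\<^sup>2) \<in> borel_measurable borel" by measurable
    show ?thesis unfolding L2_inner_def f0_def inner_real_def power2_eq_square[symmetric]
        lebesgue_on_integral(1)[OF Ub m] z ..
  qed
  show ?thesis
  proof (rule that[of f0 "\<integral>z. (k z)\<^sup>2 \<partial>lborel"])
    show "AE t in lborel. t \<in> {0<..<T} \<longrightarrow> in_Lp (lebesgue_on U) 2 (f0 t) \<and>
        (\<forall>r. r \<in> borel_measurable (lebesgue_on U) \<longrightarrow> L2_inner (lebesgue_on U) (f t) r = L2_inner (lebesgue_on U) (f0 t) r)"
      using AE_lborel_pair_swap[OF h(3)] lborel_pair.AE_integrable_snd[OF h2]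
    proof eventually_elim
      case (elim t)
      show ?case
      proof (intro impI conjI allI)
        assume t: "t \<in> {0<..<T}"
        have m: "(\<lambda>x. (h (x, t))\<^sup>2) \<in> borel_measurable borel" by measurable
        show "in_Lp (lebesgue_on U) 2 (f0 t)"
          unfolding in_L2_iff
        proof
          have "integrable (lebesgue_on U) (\<lambda>x. (h (x, t))\<^sup>2)"
            unfolding lebesgue_on_integral(2)[OF Ub m] z by (rule elim(2))
          then show "integrable (lebesgue_on U) (\<lambda>x. (norm (f0 t x))\<^sup>2)" by (simp add: f0_def)
        qed (rule f0m)
        have ae: "AE x in lebesgue_on U. f t x = f0 t x"
          using elim(1) Ub t unfolding f0_def by (simp add: lebesgue_on_AE_iff)
        fix r :: "real^'d \<Rightarrow> real" assume r: "r \<in> borel_measurable (lebesgue_on U)"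
        show "L2_inner (lebesgue_on U) (f t) r = L2_inner (lebesgue_on U) (f0 t) r"
          by (rule L2_inner_cong_AE[OF ae AE_eq_borel_measurable_lebesgue_on[OF Ub f0m ae] f0m r])
      qed
    qed
    show "integrable lborel (\<lambda>t. L2_inner (lebesgue_on U) (f0 t) (f0 t))"
      unfolding inner using lborel_pair.integrable_snd[OF h2] by simp
    show "0 \<le> (\<integral>z. (k z)\<^sup>2 \<partial>lborel)" by (simp add: integral_nonneg_AE)
    fix \<delta> :: real assume \<delta>: "0 \<le> \<delta>"
    let ?W = "U \<times> {0<..<T - \<delta>}"
    have W: "open ?W" using U by (intro open_Times) auto
    have sub: "z + \<sigma> *\<^sub>R (0, 1) \<in> ?V" if "z \<in> ?W" "0 \<le> \<sigma>" "\<sigma> \<le> \<delta>" for z \<sigma>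
      using that by (cases z) auto
    note D = weak_deriv_difference_quotient_L2[OF h(4) k(2,3) w \<delta> W sub]
    define u where "u z = indicator ?W z * (h (z + \<delta> *\<^sub>R (0, 1)) - h z)\<^sup>2" for z
    have I: "integrable (lborel \<Otimes>\<^sub>M lborel) (\<lambda>(x, t). u (x, t))"
    proof -
      have "(\<lambda>(x, t). u (x, t)) = u" by (simp add: fun_eq_iff)
      moreover have "integrable lborel u" using D(1) by (simp add: u_def[abs_def])
      ultimately show ?thesis by (simp add: lborel_prod)
    qed
    have eq: "indicator {0<..<T - \<delta>} t *
         L2_inner (lebesgue_on U) (\<lambda>x. f0 (t + \<delta>) x - f0 t x) (\<lambda>x. f0 (t + \<delta>) x - f0 t x)
         = (\<integral>x. u (x, t) \<partial>lborel)" for t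
    proof -
      have m: "(\<lambda>x. (h (x, t + \<delta>) - h (x, t))\<^sup>2) \<in> borel_measurable borel" by measurable
      have "L2_inner (lebesgue_on U) (\<lambda>x. f0 (t + \<delta>) x - f0 t x) (\<lambda>x. f0 (t + \<delta>) x - f0 t x)
        = (\<integral>x. indicator U x *\<^sub>R (h (x, t + \<delta>) - h (x, t))\<^sup>2 \<partial>lborel)"
        unfolding L2_inner_def f0_def inner_real_def power2_eq_square[symmetric]
          lebesgue_on_integral(1)[OF Ub m] ..
      then show ?thesis
        unfolding u_def by (simp add: indicator_times mult.assoc mult.left_commute[of "indicator U _"])
    qed
    show "integrable lborel (\<lambda>t. indicator {0<..<T - \<delta>} t *
         L2_inner (lebesgue_on U) (\<lambda>x. f0 (t + \<delta>) x - f0 t x) (\<lambda>x. f0 (t + \<delta>) x - f0 t x))"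
      unfolding eq using lborel_pair.integrable_snd[OF I] by simp
    have "(\<integral>t. (\<integral>x. u (x, t) \<partial>lborel) \<partial>lborel) = (\<integral>z. u z \<partial>lborel)"
      using lborel_pair.integral_snd[OF I] by (simp add: lborel_prod case_prod_beta')
    also have "\<dots> \<le> \<delta>\<^sup>2 * (\<integral>z. (k z)\<^sup>2 \<partial>lborel)" unfolding u_def by (rule D(2))
    finally show "(\<integral>t. indicator {0<..<T - \<delta>} t *
         L2_inner (lebesgue_on U) (\<lambda>x. f0 (t + \<delta>) x - f0 t x) (\<lambda>x. f0 (t + \<delta>) x - f0 t x) \<partial>lborel)
         \<le> \<delta>\<^sup>2 * (\<integral>z. (k z)\<^sup>2 \<partial>lborel)"
      unfolding eq .
  qed
qed

section \<open>Sobolev functions and boundary data\<close>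

lemma weak_deriv_add_scale:
  assumes U: "open U" "bounded U"
    and u: "in_Lp (lebesgue_on U) 2 u" "in_Lp (lebesgue_on U) 2 u'" "weak_deriv U d u u'"
    and v: "in_Lp (lebesgue_on U) 2 v" "in_Lp (lebesgue_on U) 2 v'" "weak_deriv U d v v'"
  shows "weak_deriv U d (\<lambda>x. u x + c * v x) (\<lambda>x. u' x + c * v' x)"
  unfolding weak_deriv_def
proof (intro allI impI)
  fix \<eta> assume t: "test_function U \<eta>"
  have fin: "finite_measure (lebesgue_on U)" using U by (intro finite_measure_lebesgue_on) auto
  obtain B where B: "\<And>x. \<bar>\<eta> x\<bar> \<le> B" "\<And>x. \<bar>frechet_derivative \<eta> (at x) d\<bar> \<le> B"
    using test_function_bounded[OF t, where v=d] by metis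
  have m: "\<eta> \<in> borel_measurable (lebesgue_on U)" "(\<lambda>x. frechet_derivative \<eta> (at x) d) \<in> borel_measurable (lebesgue_on U)"
    using test_function_measurable[OF t] by (auto intro: lebesgue_on_borel_measurable)
  have i: "integrable (lebesgue_on U) (\<lambda>x. w x * \<eta> x)"
    "integrable (lebesgue_on U) (\<lambda>x. w x * frechet_derivative \<eta> (at x) d)"
    if "in_Lp (lebesgue_on U) 2 w" for w
    using integrable_mult_bounded[OF in_L2_imp_integrable[OF fin that] m(1) B(1)]
      integrable_mult_bounded[OF in_L2_imp_integrable[OF fin that] m(2) B(2)] by auto
  have "(\<integral>x. (u x + c * v x) * frechet_derivative \<eta> (at x) d \<partial>lebesgue_on U)
     = (\<integral>x. u x * frechet_derivative \<eta> (at x) d + c * (v x * frechet_derivative \<eta> (at x) d) \<partial>lebesgue_on U)"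
    by (simp add: algebra_simps)
  also have "\<dots> = (\<integral>x. u x * frechet_derivative \<eta> (at x) d \<partial>lebesgue_on U)
      + c * (\<integral>x. v x * frechet_derivative \<eta> (at x) d \<partial>lebesgue_on U)"
    using i(2)[OF u(1)] i(2)[OF v(1)] by simp
  also have "\<dots> = - (\<integral>x. u' x * \<eta> x \<partial>lebesgue_on U) + c * (- (\<integral>x. v' x * \<eta> x \<partial>lebesgue_on U))"
    using u(3) v(3) t unfolding weak_deriv_def by simp
  also have "\<dots> = - (\<integral>x. u' x * \<eta> x + c * (v' x * \<eta> x) \<partial>lebesgue_on U)"
    using i(1)[OF u(2)] i(1)[OF v(2)] by simp
  also have "\<dots> = - (\<integral>x. (u' x + c * v' x) * \<eta> x \<partial>lebesgue_on U)"
    by (simp add: algebra_simps)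
  finally show "(\<integral>x. (u x + c * v x) * frechet_derivative \<eta> (at x) d \<partial>lebesgue_on U)
     = - (\<integral>x. (u' x + c * v' x) * \<eta> x \<partial>lebesgue_on U)" .
qed

lemma sobolev_add_scale:
  fixes U :: "(real^'d) set"
  assumes U: "open U" "bounded U" and u: "sobolev U 2 u G" and v: "sobolev U 2 v H"
  shows "sobolev U 2 (\<lambda>x. u x + c * v x) (\<lambda>x. G x + c *\<^sub>R H x)"
proof -
  have L: "in_Lp (lebesgue_on U) 2 u" "in_Lp (lebesgue_on U) 2 G" "in_Lp (lebesgue_on U) 2 v" "in_Lp (lebesgue_on U) 2 H"
    using u v by (auto simp: sobolev_def)
  have "weak_gradient U (\<lambda>x. u x + c * v x) (\<lambda>x. G x + c *\<^sub>R H x)"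
    using u v weak_deriv_add_scale[OF U L(1) in_L2_component[OF L(2)] _ L(3) in_L2_component[OF L(4)]]
    by (simp add: sobolev_def weak_gradient_def)
  then show ?thesis
    using L in_L2_add[OF L(1) in_L2_scale[OF L(3)]] in_L2_add[OF L(2) in_L2_scale[OF L(4)]]
    by (simp add: sobolev_def)
qed

lemma sobolev_diff:
  fixes U :: "(real^'d) set"
  assumes U: "open U" "bounded U" and u: "sobolev U 2 u G" and v: "sobolev U 2 v H"
  shows "sobolev U 2 (\<lambda>x. u x - v x) (\<lambda>x. G x - H x)"
  using sobolev_add_scale[OF assms, of "-1"] by simp

lemma sobolev_1_of_2:
  assumes "open U" "bounded U" "sobolev U 2 u G"
  shows "sobolev U 1 u G"
proof -
  have "finite_measure (lebesgue_on U)" using assms by (intro finite_measure_lebesgue_on) auto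
  then show ?thesis using assms(3) L1_le_L2(1)[of "lebesgue_on U" u] L1_le_L2(1)[of "lebesgue_on U" G]
    by (simp add: sobolev_def in_L1_iff in_L2_measurable)
qed

text \<open>
  Cauchy-Schwarz against the constant function \<open>1\<close>.
\<close>

lemma L1_le_L2_norm:
  assumes M: "finite_measure M" and u: "in_Lp M 2 u"
  shows "(\<integral>x. norm (u x) \<partial>M) \<le> sqrt (measure M (space M)) * Lp_norm M 2 u"
proof -
  interpret finite_measure M by fact
  have 1: "in_Lp M 2 (\<lambda>x. 1::real)" by (simp add: in_L2_iff)
  have [measurable]: "u \<in> borel_measurable M" by (rule in_L2_measurable[OF u])
  have "(\<lambda>x. norm (u x)) \<in> borel_measurable M" by measurable
  then have 2: "in_Lp M 2 (\<lambda>x. norm (u x))" using u by (simp add: in_L2_iff)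
  have "(\<integral>x. norm (u x) \<partial>M) = L2_inner M (\<lambda>x. 1::real) (\<lambda>x. norm (u x))" by (simp add: L2_inner_def)
  also have "\<dots> \<le> Lp_norm M 2 (\<lambda>x. 1::real) * Lp_norm M 2 (\<lambda>x. norm (u x))"
    using L2_Cauchy_Schwarz[OF 1 2] by simp
  also have "\<dots> = sqrt (measure M (space M)) * Lp_norm M 2 u" by (simp add: Lp_norm_2)
  finally show ?thesis .
qed

lemma surface_measure_space: "space (surface_measure S) = S"
  by (simp add: surface_measure_def space_restrict_space)

lemma surface_measure_measurable:
  fixes h :: "real^'d \<Rightarrow> real"
  assumes "continuous_on S h"
  shows "h \<in> borel_measurable (surface_measure S)"
proof -
  have "sets (surface_measure S) = sets (restrict_space borel S)"
    unfolding surface_measure_def sets_restrict_space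
    by (subst sets_measure_of) (auto simp: sets.sigma_sets_eq[of borel, simplified])
  then show ?thesis
    using borel_measurable_continuous_on_restrict[OF assms] measurable_cong_sets by blast
qed

lemma C1_time_H1D:
  assumes "C1_time_H1 U T \<rho> G \<rho>t Gt" "t \<in> {0<..<T}"
  shows "sobolev U 2 (\<rho> t) (G t)" "sobolev U 2 (\<rho>t t) (Gt t)"
    "has_L2_derivative (lebesgue_on U) \<rho> (\<rho>t t) t" "has_L2_derivative (lebesgue_on U) G (Gt t) t"
    "L2_tendsto (lebesgue_on U) \<rho>t (\<rho>t t) (at t)" "L2_tendsto (lebesgue_on U) Gt (Gt t) (at t)"
    "in_Lp (lebesgue_on U) 2 (\<rho> t)" "in_Lp (lebesgue_on U) 2 (G t)"
    "in_Lp (lebesgue_on U) 2 (\<rho>t t)" "in_Lp (lebesgue_on U) 2 (Gt t)"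
  using assms by (auto simp: C1_time_H1_def has_L2_derivative_def sobolev_def divide_inverse mult.commute)

lemma eventually_at_Ioo: "t \<in> {0<..<T::real} \<Longrightarrow> eventually (\<lambda>s. s \<in> {0<..<T}) (at t)"
  by (rule eventually_at_in_open') auto

text \<open>
  What the trace theorem and the smoothness of the boundary data contribute. The trace is used in its
  \<open>W(1,1)\<close> form because only the \<open>L\<^sup>1\<close> norm of the
  gradient is controlled by a small multiple of the energy.
\<close>

locale boundary =
  fixes U :: "(real^'d) set" and tr :: "(real^'d \<Rightarrow> real) \<Rightarrow> (real^'d \<Rightarrow> real)"
    and T Ct \<Psi> :: real and \<psi> \<psi>t :: "real \<Rightarrow> real^'d \<Rightarrow> real"
  assumes U: "open U" "bounded U"
    and Ct: "0 \<le> Ct" and \<Psi>: "0 \<le> \<Psi>"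
    and trace_integrable: "\<And>r Gr. sobolev U 2 r Gr \<Longrightarrow> integrable (surface_measure (frontier U)) (tr r)"
    and trace_L1: "\<And>r Gr. sobolev U 2 r Gr \<Longrightarrow>
        (\<integral>x. \<bar>tr r x\<bar> \<partial>surface_measure (frontier U))
          \<le> Ct * ((\<integral>x. \<bar>r x\<bar> \<partial>lebesgue_on U) + (\<integral>x. norm (Gr x) \<partial>lebesgue_on U))"
    and trace_linear: "\<And>u v G H c. sobolev U 2 u G \<Longrightarrow> sobolev U 2 v H \<Longrightarrow>
        AE x in surface_measure (frontier U). tr (\<lambda>y. u y + c * v y) x = tr u x + c * tr v x"
    and psi_measurable: "\<And>t. t \<in> {0<..<T} \<Longrightarrow> \<psi> t \<in> borel_measurable (surface_measure (frontier U))"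
      "\<And>t. t \<in> {0<..<T} \<Longrightarrow> \<psi>t t \<in> borel_measurable (surface_measure (frontier U))"
    and psi_bound: "\<And>t x. t \<in> {0<..<T} \<Longrightarrow> x \<in> frontier U \<Longrightarrow> \<bar>\<psi> t x\<bar> \<le> \<Psi>"
      "\<And>t x. t \<in> {0<..<T} \<Longrightarrow> x \<in> frontier U \<Longrightarrow> \<bar>\<psi>t t x\<bar> \<le> \<Psi>"
    and psi_lipschitz: "\<And>s t x. s \<in> {0<..<T} \<Longrightarrow> t \<in> {0<..<T} \<Longrightarrow> x \<in> frontier U \<Longrightarrow>
        \<bar>\<psi> s x - \<psi> t x\<bar> \<le> \<Psi> * \<bar>s - t\<bar>"
    and psi_derivative: "\<And>t x. t \<in> {0<..<T} \<Longrightarrow> x \<in> frontier U \<Longrightarrow>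
        ((\<lambda>s. \<psi> s x) has_real_derivative \<psi>t t x) (at t)"
begin

abbreviation "M \<equiv> lebesgue_on U"
abbreviation "S \<equiv> surface_measure (frontier U)"

lemma M_finite: "finite_measure M"
  using U by (intro finite_measure_lebesgue_on) auto

lemma boundary_pairing:
  fixes h k :: "real^'d \<Rightarrow> real"
  assumes "h \<in> borel_measurable S" "\<And>x. x \<in> frontier U \<Longrightarrow> \<bar>h x\<bar> \<le> B" and k: "integrable S k"
  shows "integrable S (\<lambda>x. h x * k x)" "\<bar>\<integral>x. h x * k x \<partial>S\<bar> \<le> B * (\<integral>x. \<bar>k x\<bar> \<partial>S)"
proof -
  have le: "norm (h x * k x) \<le> norm (B * \<bar>k x\<bar>)" "norm (h x * k x) \<le> B * \<bar>k x\<bar>" if "x \<in> space S" for x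
  proof -
    have "\<bar>h x\<bar> * \<bar>k x\<bar> \<le> B * \<bar>k x\<bar>"
      using assms(2)[of x] that by (intro mult_right_mono) (auto simp: surface_measure_space)
    moreover have "\<bar>h x\<bar> \<le> \<bar>B\<bar>" using assms(2)[of x] that by (auto simp: surface_measure_space)
    then have "\<bar>h x\<bar> * \<bar>k x\<bar> \<le> \<bar>B\<bar> * \<bar>k x\<bar>" by (intro mult_right_mono) auto
    ultimately show "norm (h x * k x) \<le> norm (B * \<bar>k x\<bar>)" "norm (h x * k x) \<le> B * \<bar>k x\<bar>" by (auto simp: abs_mult)
  qed
  show i: "integrable S (\<lambda>x. h x * k x)"
    by (rule Bochner_Integration.integrable_bound[where f="\<lambda>x. B * \<bar>k x\<bar>"]) (use k assms(1) le in auto)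
  have "\<bar>\<integral>x. h x * k x \<partial>S\<bar> \<le> (\<integral>x. norm (h x * k x) \<partial>S)" using integral_norm_bound[of S "\<lambda>x. h x * k x"] by simp
  also have "\<dots> \<le> (\<integral>x. B * \<bar>k x\<bar> \<partial>S)" using i k le by (intro integral_mono) auto
  finally show "\<bar>\<integral>x. h x * k x \<partial>S\<bar> \<le> B * (\<integral>x. \<bar>k x\<bar> \<partial>S)" by simp
qed

lemma boundary_bound:
  assumes r: "sobolev U 2 r Gr" and h: "h \<in> borel_measurable S" "\<And>x. x \<in> frontier U \<Longrightarrow> \<bar>h x\<bar> \<le> B" "0 \<le> B"
  shows "\<bar>L2_inner S h (tr r)\<bar> \<le> B * Ct * ((\<integral>x. \<bar>r x\<bar> \<partial>M) + (\<integral>x. norm (Gr x) \<partial>M))"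
proof -
  have "\<bar>L2_inner S h (tr r)\<bar> \<le> B * (\<integral>x. \<bar>tr r x\<bar> \<partial>S)"
    using boundary_pairing(2)[OF h(1,2) trace_integrable[OF r]] by (simp add: L2_inner_def)
  also have "\<dots> \<le> B * (Ct * ((\<integral>x. \<bar>r x\<bar> \<partial>M) + (\<integral>x. norm (Gr x) \<partial>M)))"
    by (intro mult_left_mono trace_L1 r h(3))
  finally show ?thesis by (simp add: mult.assoc)
qed

lemma trace_L2:
  assumes r: "sobolev U 2 r Gr"
  shows "(\<integral>x. \<bar>tr r x\<bar> \<partial>S) \<le> Ct * sqrt (measure M (space M)) * (Lp_norm M 2 r + Lp_norm M 2 Gr)"
proof -
  have L: "in_Lp M 2 r" "in_Lp M 2 Gr" using r by (auto simp: sobolev_def)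
  have "(\<integral>x. \<bar>tr r x\<bar> \<partial>S) \<le> Ct * ((\<integral>x. norm (r x) \<partial>M) + (\<integral>x. norm (Gr x) \<partial>M))"
    using trace_L1[OF r] by simp
  also have "\<dots> \<le> Ct * (sqrt (measure M (space M)) * Lp_norm M 2 r + sqrt (measure M (space M)) * Lp_norm M 2 Gr)"
    by (intro mult_left_mono add_mono L1_le_L2_norm[OF M_finite] L Ct)
  finally show ?thesis by (simp add: algebra_simps)
qed

lemma trace_diff:
  assumes u: "sobolev U 2 u G" and v: "sobolev U 2 v H"
  shows "AE x in S. tr (\<lambda>y. u y - v y) x = tr u x - tr v x"
  using trace_linear[OF u v, of "-1"] by simp

text \<open>
  A product rule. The difference quotient of \<open>\<psi>\<close> converges under the integral by
  dominated convergence (\<open>I0\<close>), while the trace of the difference quotient of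
  \<open>\<rho>\<close> converges by the trace inequality (\<open>p0\<close>, \<open>q0\<close>).
\<close>

lemma boundary_pairing_has_derivative:
  assumes c: "C1_time_H1 U T \<rho> G \<rho>t Gt" and t: "t \<in> {0<..<T}"
  shows "((\<lambda>s. L2_inner S (\<psi> s) (tr (\<rho> s))) has_real_derivative
           (L2_inner S (\<psi>t t) (tr (\<rho> t)) + L2_inner S (\<psi> t) (tr (\<rho>t t)))) (at t)"
proof -
  note D = C1_time_H1D[OF c]
  define cs where "cs = Ct * sqrt (measure M (space M))"
  define p where "p s = (\<integral>x. \<bar>tr (\<rho> s) x - tr (\<rho> t) x\<bar> \<partial>S)" for s
  define q where "q s = (\<integral>x. \<bar>(tr (\<rho> s) x - tr (\<rho> t) x) / (s - t) - tr (\<rho>t t) x\<bar> \<partial>S)" for s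
  define I where "I s = (\<integral>x. (\<psi> s x - \<psi> t x) / (s - t) * tr (\<rho> t) x \<partial>S)" for s
  have ev: "eventually (\<lambda>s. s \<in> {0<..<T} \<and> s \<noteq> t) (at t)"
    using eventually_at_Ioo[OF t] by (simp add: eventually_conj eventually_at_filter)
  have L2ev: "eventually (\<lambda>s. in_Lp M 2 (\<rho> s)) (at t)" "eventually (\<lambda>s. in_Lp M 2 (G s)) (at t)"
    using eventually_at_Ioo[OF t] by (auto elim!: eventually_mono intro: D)
  have tri: "integrable S (tr (\<rho> s))" if "s \<in> {0<..<T}" for s
    using trace_integrable[OF D(1)[OF that]] .
  have trti: "integrable S (tr (\<rho>t t))" using trace_integrable[OF D(2)[OF t]] .
  have p0: "(p \<longlongrightarrow> 0) (at t)"
  proof (rule Lim_null_comparison)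
    have "((\<lambda>s. cs * (Lp_norm M 2 (\<lambda>x. \<rho> s x - \<rho> t x) + Lp_norm M 2 (\<lambda>x. G s x - G t x))) \<longlongrightarrow> cs * (0 + 0)) (at t)"
      using has_L2_derivative_tendsto[OF D(3)[OF t] L2ev(1) D(7)[OF t] D(9)[OF t]]
        has_L2_derivative_tendsto[OF D(4)[OF t] L2ev(2) D(8)[OF t] D(10)[OF t]]
      unfolding L2_tendsto_def by (intro tendsto_intros)
    then show "((\<lambda>s. cs * (Lp_norm M 2 (\<lambda>x. \<rho> s x - \<rho> t x) + Lp_norm M 2 (\<lambda>x. G s x - G t x))) \<longlongrightarrow> 0) (at t)" by simp
    show "eventually (\<lambda>s. norm (p s) \<le> cs * (Lp_norm M 2 (\<lambda>x. \<rho> s x - \<rho> t x) + Lp_norm M 2 (\<lambda>x. G s x - G t x))) (at t)"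
      using ev
    proof eventually_elim
      case (elim s)
      note so = sobolev_diff[OF U D(1) D(1)[OF t], of s]
      have "p s = (\<integral>x. \<bar>tr (\<lambda>y. \<rho> s y - \<rho> t y) x\<bar> \<partial>S)"
        unfolding p_def using trace_diff[OF D(1) D(1)[OF t], of s] elim tri[of s] tri[OF t] trace_integrable[OF so]
        by (intro integral_cong_AE) auto
      also have "\<dots> \<le> cs * (Lp_norm M 2 (\<lambda>x. \<rho> s x - \<rho> t x) + Lp_norm M 2 (\<lambda>x. G s x - G t x))"
        unfolding cs_def using elim by (intro trace_L2 so) auto
      finally show ?case by (simp add: p_def integral_nonneg_AE)
    qed
  qed
  have q0: "(q \<longlongrightarrow> 0) (at t)"
  proof (rule Lim_null_comparison)
    let ?r = "\<lambda>s. Lp_norm M 2 (\<lambda>x. (\<rho> s x - \<rho> t x) /\<^sub>R (s - t) - \<rho>t t x)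
        + Lp_norm M 2 (\<lambda>x. (G s x - G t x) /\<^sub>R (s - t) - Gt t x)"
    have "((\<lambda>s. cs * ?r s) \<longlongrightarrow> cs * (0 + 0)) (at t)"
      using D(3,4)[OF t] unfolding has_L2_derivative_def L2_tendsto_def by (intro tendsto_intros)
    then show "((\<lambda>s. cs * ?r s) \<longlongrightarrow> 0) (at t)" by simp
    show "eventually (\<lambda>s. norm (q s) \<le> cs * ?r s) (at t)"
      using ev
    proof eventually_elim
      case (elim s)
      then have st: "s \<in> {0<..<T}" "s - t \<noteq> 0" by auto
      let ?c = "- (s - t)"
      have s1: "sobolev U 2 (\<lambda>x. \<rho> s x - \<rho> t x) (\<lambda>x. G s x - G t x)"
        by (rule sobolev_diff[OF U D(1)[OF st(1)] D(1)[OF t]])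
      have s2: "sobolev U 2 (\<lambda>x. (\<rho> s x - \<rho> t x) + ?c * \<rho>t t x) (\<lambda>x. (G s x - G t x) + ?c *\<^sub>R Gt t x)"
        by (rule sobolev_add_scale[OF U s1 D(2)[OF t]])
      have ae: "AE x in S. tr (\<lambda>x. (\<rho> s x - \<rho> t x) + ?c * \<rho>t t x) x = tr (\<rho> s) x - tr (\<rho> t) x + ?c * tr (\<rho>t t) x"
        using trace_linear[OF s1 D(2)[OF t], of ?c] trace_diff[OF D(1)[OF st(1)] D(1)[OF t]]
        by eventually_elim simp
      have i: "integrable S (\<lambda>x. tr (\<rho> s) x - tr (\<rho> t) x + ?c * tr (\<rho>t t) x)"
        using tri[OF st(1)] tri[OF t] trti by auto
      have "q s = (\<integral>x. inverse \<bar>s - t\<bar> * \<bar>tr (\<rho> s) x - tr (\<rho> t) x + ?c * tr (\<rho>t t) x\<bar> \<partial>S)"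
        unfolding q_def
      proof (intro Bochner_Integration.integral_cong refl)
        fix x
        have "(tr (\<rho> s) x - tr (\<rho> t) x) / (s - t) - tr (\<rho>t t) x
            = inverse (s - t) * (tr (\<rho> s) x - tr (\<rho> t) x + ?c * tr (\<rho>t t) x)"
          using st(2) by (simp add: field_simps)
        then show "\<bar>(tr (\<rho> s) x - tr (\<rho> t) x) / (s - t) - tr (\<rho>t t) x\<bar>
            = inverse \<bar>s - t\<bar> * \<bar>tr (\<rho> s) x - tr (\<rho> t) x + ?c * tr (\<rho>t t) x\<bar>"
          by (simp only: abs_mult abs_inverse)
      qed
      also have "\<dots> = inverse \<bar>s - t\<bar> * (\<integral>x. \<bar>tr (\<lambda>x. (\<rho> s x - \<rho> t x) + ?c * \<rho>t t x) x\<bar> \<partial>S)"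
        unfolding integral_mult_right_zero
        using ae i trace_integrable[OF s2] by (intro arg_cong2[where f="(*)"] refl integral_cong_AE) auto
      also have "\<dots> \<le> inverse \<bar>s - t\<bar> * (cs * (Lp_norm M 2 (\<lambda>x. (\<rho> s x - \<rho> t x) + ?c * \<rho>t t x)
            + Lp_norm M 2 (\<lambda>x. (G s x - G t x) + ?c *\<^sub>R Gt t x)))"
        unfolding cs_def using trace_L2[OF s2] by (intro mult_left_mono) auto
      also have "\<dots> = cs * (inverse \<bar>s - t\<bar> * Lp_norm M 2 (\<lambda>x. (\<rho> s x - \<rho> t x) + ?c * \<rho>t t x)
            + inverse \<bar>s - t\<bar> * Lp_norm M 2 (\<lambda>x. (G s x - G t x) + ?c *\<^sub>R Gt t x))"
        by (simp add: algebra_simps)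
      also have "inverse \<bar>s - t\<bar> * Lp_norm M 2 (\<lambda>x. (\<rho> s x - \<rho> t x) + ?c * \<rho>t t x)
          = Lp_norm M 2 (\<lambda>x. (\<rho> s x - \<rho> t x) /\<^sub>R (s - t) - \<rho>t t x)"
      proof -
        have "(\<lambda>x. inverse (s - t) *\<^sub>R ((\<rho> s x - \<rho> t x) + ?c * \<rho>t t x)) = (\<lambda>x. (\<rho> s x - \<rho> t x) /\<^sub>R (s - t) - \<rho>t t x)"
          using st(2) by (simp add: fun_eq_iff field_simps)
        then show ?thesis
          using Lp_norm_2_scale[of M "inverse (s - t)" "\<lambda>x. (\<rho> s x - \<rho> t x) + ?c * \<rho>t t x"] by simp
      qed
      also have "inverse \<bar>s - t\<bar> * Lp_norm M 2 (\<lambda>x. (G s x - G t x) + ?c *\<^sub>R Gt t x)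
          = Lp_norm M 2 (\<lambda>x. (G s x - G t x) /\<^sub>R (s - t) - Gt t x)"
      proof -
        have "(\<lambda>x. inverse (s - t) *\<^sub>R ((G s x - G t x) + ?c *\<^sub>R Gt t x)) = (\<lambda>x. (G s x - G t x) /\<^sub>R (s - t) - Gt t x)"
          using st(2) by (simp only: scaleR_add_right scaleR_scaleR mult_minus_right left_inverse) simp
        then show ?thesis
          using Lp_norm_2_scale[of M "inverse (s - t)" "\<lambda>x. (G s x - G t x) + ?c *\<^sub>R Gt t x"] by simp
      qed
      finally show ?case by (simp add: q_def integral_nonneg_AE)
    qed
  qed
  have I0: "(I \<longlongrightarrow> L2_inner S (\<psi>t t) (tr (\<rho> t))) (at t)"
    unfolding tendsto_at_iff_sequentially comp_def
  proof (intro allI impI)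
    fix X :: "nat \<Rightarrow> real" assume X: "\<forall>i. X i \<in> UNIV - {t}" "X \<longlonglongrightarrow> t"
    have XT: "eventually (\<lambda>n. X n \<in> {0<..<T}) sequentially"
      using topological_tendstoD[OF X(2) open_greaterThanLessThan t] .
    obtain n0 where n0: "\<And>n. X (n + n0) \<in> {0<..<T}" using XT unfolding eventually_sequentially by (metis le_add2)
    have "(\<lambda>n. I (X (n + n0))) \<longlonglongrightarrow> (\<integral>x. \<psi>t t x * tr (\<rho> t) x \<partial>S)"
      unfolding I_def
    proof (rule integral_dominated_convergence[where w="\<lambda>x. \<Psi> * \<bar>tr (\<rho> t) x\<bar>"])
      show "(\<lambda>x. \<psi>t t x * tr (\<rho> t) x) \<in> borel_measurable S" using psi_measurable(2)[OF t] tri[OF t] by auto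
      show "(\<lambda>x. (\<psi> (X (n + n0)) x - \<psi> t x) / (X (n + n0) - t) * tr (\<rho> t) x) \<in> borel_measurable S" for n
        using psi_measurable(1)[OF n0[of n]] psi_measurable(1)[OF t] tri[OF t] by auto
      show "integrable S (\<lambda>x. \<Psi> * \<bar>tr (\<rho> t) x\<bar>)" using tri[OF t] by simp
      show "AE x in S. (\<lambda>n. (\<psi> (X (n + n0)) x - \<psi> t x) / (X (n + n0) - t) * tr (\<rho> t) x) \<longlonglongrightarrow> \<psi>t t x * tr (\<rho> t) x"
      proof (rule AE_I2)
        fix x assume "x \<in> space S"
        then have "x \<in> frontier U" by (simp add: surface_measure_space)
        from psi_derivative[OF t this] X
        have "(\<lambda>n. (\<psi> (X n) x - \<psi> t x) / (X n - t)) \<longlonglongrightarrow> \<psi>t t x"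
          unfolding has_field_derivative_iff tendsto_at_iff_sequentially comp_def by blast
        from LIMSEQ_ignore_initial_segment[OF this, of n0]
        show "(\<lambda>n. (\<psi> (X (n + n0)) x - \<psi> t x) / (X (n + n0) - t) * tr (\<rho> t) x) \<longlonglongrightarrow> \<psi>t t x * tr (\<rho> t) x"
          by (intro tendsto_intros)
      qed
      show "AE x in S. norm ((\<psi> (X (n + n0)) x - \<psi> t x) / (X (n + n0) - t) * tr (\<rho> t) x) \<le> \<Psi> * \<bar>tr (\<rho> t) x\<bar>" for n
      proof (rule AE_I2)
        fix x assume "x \<in> space S"
        then have x: "x \<in> frontier U" by (simp add: surface_measure_space)
        have "\<bar>(\<psi> (X (n + n0)) x - \<psi> t x) / (X (n + n0) - t)\<bar> \<le> \<Psi>"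
          using psi_lipschitz[OF n0[of n] t x] X(1) by (simp add: abs_divide divide_le_eq)
        then show "norm ((\<psi> (X (n + n0)) x - \<psi> t x) / (X (n + n0) - t) * tr (\<rho> t) x) \<le> \<Psi> * \<bar>tr (\<rho> t) x\<bar>"
          by (simp only: real_norm_def abs_mult mult_right_mono abs_ge_zero)
      qed
    qed
    then show "(\<lambda>n. I (X n)) \<longlonglongrightarrow> L2_inner S (\<psi>t t) (tr (\<rho> t))"
      unfolding L2_inner_def inner_real_def by (rule LIMSEQ_offset)
  qed
  have E: "eventually (\<lambda>s. norm ((L2_inner S (\<psi> s) (tr (\<rho> s)) - L2_inner S (\<psi> t) (tr (\<rho> t))) / (s - t)
        - I s - L2_inner S (\<psi> t) (tr (\<rho>t t))) \<le> \<Psi> * p s + \<Psi> * q s) (at t)"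
    using ev
  proof eventually_elim
    case (elim s)
    then have s: "s \<in> {0<..<T}" "s - t \<noteq> 0" by auto
    have bd: "\<bar>(\<psi> s x - \<psi> t x) / (s - t)\<bar> \<le> \<Psi>" if "x \<in> frontier U" for x
      using psi_lipschitz[OF s(1) t that] s(2) by (simp add: abs_divide divide_le_eq)
    have md: "(\<lambda>x. (\<psi> s x - \<psi> t x) / (s - t)) \<in> borel_measurable S"
      using psi_measurable(1)[OF s(1)] psi_measurable(1)[OF t] by auto
    note ps = psi_measurable(1)[OF s(1)] psi_bound(1)[OF s(1)]
    note pt = psi_measurable(1)[OF t] psi_bound(1)[OF t]
    have d1: "integrable S (\<lambda>x. tr (\<rho> s) x - tr (\<rho> t) x)" using tri[OF s(1)] tri[OF t] by auto
    have d2: "integrable S (\<lambda>x. (tr (\<rho> s) x - tr (\<rho> t) x) / (s - t) - tr (\<rho>t t) x)" using d1 trti by auto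
    note i1 = boundary_pairing(1)[OF ps tri[OF s(1)]]
    note i2 = boundary_pairing(1)[OF pt tri[OF t]]
    note i3 = boundary_pairing(1)[OF md bd tri[OF t]]
    note i4 = boundary_pairing(1)[OF pt trti]
    note i5 = boundary_pairing[OF md bd d1]
    note i6 = boundary_pairing[OF pt d2]
    have pw: "(\<psi> s x * tr (\<rho> s) x - \<psi> t x * tr (\<rho> t) x) / (s - t)
        = (\<psi> s x - \<psi> t x) / (s - t) * tr (\<rho> t) x + \<psi> t x * tr (\<rho>t t) x
        + ((\<psi> s x - \<psi> t x) / (s - t) * (tr (\<rho> s) x - tr (\<rho> t) x)
        + \<psi> t x * ((tr (\<rho> s) x - tr (\<rho> t) x) / (s - t) - tr (\<rho>t t) x))" for x
      using s(2) by (simp add: divide_simps) (simp add: algebra_simps)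
    have "(L2_inner S (\<psi> s) (tr (\<rho> s)) - L2_inner S (\<psi> t) (tr (\<rho> t))) / (s - t)
        = (\<integral>x. (\<psi> s x * tr (\<rho> s) x - \<psi> t x * tr (\<rho> t) x) / (s - t) \<partial>S)"
      using i1 i2 by (simp add: L2_inner_def)
    also have "\<dots> = I s + L2_inner S (\<psi> t) (tr (\<rho>t t))
        + ((\<integral>x. (\<psi> s x - \<psi> t x) / (s - t) * (tr (\<rho> s) x - tr (\<rho> t) x) \<partial>S)
        + (\<integral>x. \<psi> t x * ((tr (\<rho> s) x - tr (\<rho> t) x) / (s - t) - tr (\<rho>t t) x) \<partial>S))"
      unfolding pw I_def L2_inner_def inner_real_def
      using i3 i4 i5(1) i6(1) by (simp only: Bochner_Integration.integral_add Bochner_Integration.integrable_add)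
    finally show ?case using i5(2) i6(2) unfolding p_def q_def real_norm_def by linarith
  qed
  have "((\<lambda>s. \<Psi> * p s + \<Psi> * q s) \<longlongrightarrow> \<Psi> * 0 + \<Psi> * 0) (at t)" by (intro tendsto_intros p0 q0)
  then have "((\<lambda>s. \<Psi> * p s + \<Psi> * q s) \<longlongrightarrow> 0) (at t)" by simp
  from Lim_null_comparison[OF E this]
  have "((\<lambda>s. (L2_inner S (\<psi> s) (tr (\<rho> s)) - L2_inner S (\<psi> t) (tr (\<rho> t))) / (s - t)
        - I s - L2_inner S (\<psi> t) (tr (\<rho>t t))) \<longlongrightarrow> 0) (at t)" .
  from tendsto_add[OF tendsto_add[OF this I0] tendsto_const[of "L2_inner S (\<psi> t) (tr (\<rho>t t))"]]
  show ?thesis unfolding has_field_derivative_iff by simp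
qed

end

text \<open>
  The boundary data are smooth near the compact set \<open>\<Gamma> \<times> [0, T]\<close>, so the
  function and its time derivative are bounded there; the Lipschitz bound is the mean value theorem in
  \<open>t\<close>.
\<close>

lemma boundary_data_bounds:
  assumes G: "compact \<Gamma>" and bd: "boundary_data \<Gamma> T \<psi>"
  obtains \<Psi> \<psi>t where "0 \<le> \<Psi>"
    "\<And>t. t \<in> {0<..<T} \<Longrightarrow> continuous_on \<Gamma> (\<psi> t)" "\<And>t. t \<in> {0<..<T} \<Longrightarrow> continuous_on \<Gamma> (\<psi>t t)"
    "\<And>t x. t \<in> {0<..<T} \<Longrightarrow> x \<in> \<Gamma> \<Longrightarrow> \<bar>\<psi> t x\<bar> \<le> \<Psi>"
    "\<And>t x. t \<in> {0<..<T} \<Longrightarrow> x \<in> \<Gamma> \<Longrightarrow> \<bar>\<psi>t t x\<bar> \<le> \<Psi>"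
    "\<And>s t x. s \<in> {0<..<T} \<Longrightarrow> t \<in> {0<..<T} \<Longrightarrow> x \<in> \<Gamma> \<Longrightarrow> \<bar>\<psi> s x - \<psi> t x\<bar> \<le> \<Psi> * \<bar>s - t\<bar>"
    "\<And>t x. t \<in> {0<..<T} \<Longrightarrow> x \<in> \<Gamma> \<Longrightarrow> ((\<lambda>s. \<psi> s x) has_real_derivative \<psi>t t x) (at t)"
proof -
  obtain V where V: "open V" "\<Gamma> \<times> {0..T} \<subseteq> V" "smooth_on V (\<lambda>(x, t). \<psi> t x)"
    using bd unfolding boundary_data_def by auto
  define p where "p = (\<lambda>(x, t). \<psi> t x)"
  define p' where "p' z = frechet_derivative p (at z) (0, 1)" for z
  have "Ck_on 0 V p" "Ck_on 1 V p" using V(3) unfolding smooth_on_def p_def by blast+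
  then have cp: "continuous_on V p" and cp': "continuous_on V p'" and dp: "\<And>z. z \<in> V \<Longrightarrow> p differentiable (at z)"
    unfolding p'_def by auto
  have K: "compact (\<Gamma> \<times> {0..T})" using G by (intro compact_Times) auto
  have "bounded (p ` (\<Gamma> \<times> {0..T}))" "bounded (p' ` (\<Gamma> \<times> {0..T}))"
    using cp cp' V(2) by (auto intro!: compact_imp_bounded compact_continuous_image K intro: continuous_on_subset)
  then obtain B1 B2 where B: "\<And>z. z \<in> \<Gamma> \<times> {0..T} \<Longrightarrow> \<bar>p z\<bar> \<le> B1" "\<And>z. z \<in> \<Gamma> \<times> {0..T} \<Longrightarrow> \<bar>p' z\<bar> \<le> B2"
    unfolding bounded_iff by (metis (no_types, lifting) imageI real_norm_def)
  define \<Psi> where "\<Psi> = \<bar>B1\<bar> + \<bar>B2\<bar>"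
  have der: "((\<lambda>s. \<psi> s x) has_real_derivative p' (x, t)) (at t)" if "t \<in> {0<..<T}" "x \<in> \<Gamma>" for t x
  proof -
    have z: "(x, t) \<in> V" using that V(2) by auto
    have 1: "((\<lambda>s. (x, s)) has_derivative (\<lambda>h. (0, h))) (at t)"
      by (auto intro!: derivative_eq_intros)
    have 2: "(p has_derivative frechet_derivative p (at (x, t))) (at (x, t))"
      using dp[OF z] by (simp add: frechet_derivative_works)
    from has_derivative_compose[OF 1 2]
    have "((\<lambda>s. p (x, s)) has_derivative (\<lambda>h. frechet_derivative p (at (x, t)) (0, h))) (at t)" .
    moreover have "frechet_derivative p (at (x, t)) (0, h) = p' (x, t) * h" for h
      using linear_scale[OF has_derivative_linear[OF 2], of h "(0, 1)"] by (simp add: p'_def)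
    ultimately show ?thesis by (simp add: has_field_derivative_def p_def)
  qed
  show ?thesis
  proof (rule that[of \<Psi> "\<lambda>t x. p' (x, t)"])
    show "continuous_on \<Gamma> (\<psi> t)" "continuous_on \<Gamma> (\<lambda>x. p' (x, t))" if "t \<in> {0<..<T}" for t
    proof -
      have s: "(\<lambda>x. (x, t)) ` \<Gamma> \<subseteq> V" using that V(2) by auto
      have c: "continuous_on \<Gamma> (\<lambda>x. (x, t))" by (intro continuous_intros)
      show "continuous_on \<Gamma> (\<psi> t)" using continuous_on_compose2[OF cp c s] by (simp add: p_def)
      show "continuous_on \<Gamma> (\<lambda>x. p' (x, t))" using continuous_on_compose2[OF cp' c s] .
    qed
    have b: "\<bar>p' (x, t)\<bar> \<le> \<Psi>" "\<bar>\<psi> t x\<bar> \<le> \<Psi>" if "t \<in> {0<..<T}" "x \<in> \<Gamma>" for t x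
      using B[of "(x, t)"] that by (auto simp: \<Psi>_def p_def)
    show "\<bar>p' (x, t)\<bar> \<le> \<Psi>" "\<bar>\<psi> t x\<bar> \<le> \<Psi>" if "t \<in> {0<..<T}" "x \<in> \<Gamma>" for t x
      using b[OF that] by auto
    show "\<bar>\<psi> s x - \<psi> t x\<bar> \<le> \<Psi> * \<bar>s - t\<bar>" if "s \<in> {0<..<T}" "t \<in> {0<..<T}" "x \<in> \<Gamma>" for s t x
      using field_differentiable_bound[of "{0<..<T}" "\<lambda>s. \<psi> s x" "\<lambda>t. p' (x, t)" \<Psi> s t]
        der[OF _ that(3)] b(1)[OF _ that(3)] that by (auto intro: has_field_derivative_at_within)
    show "((\<lambda>s. \<psi> s x) has_real_derivative p' (x, t)) (at t)" if "t \<in> {0<..<T}" "x \<in> \<Gamma>" for t x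
      by (rule der[OF that])
  qed (simp add: \<Psi>_def)
qed

section \<open>A priori estimates\<close>

text \<open>
  The data of the problem, with the regularity in the form in which the estimates use it. Constants
  obtained in this locale depend on the data only, and on the coefficients only through
  \<open>\<delta>\<close> and \<open>\<mu>\<close>.
\<close>

locale flow = forchheimer N \<alpha> \<delta> \<mu> + boundary U tr T Ct \<Psi> \<psi> \<psi>t
  for N :: nat and \<alpha> :: "nat \<Rightarrow> real" and \<delta> \<mu> :: real
    and U :: "(real^'d) set" and tr :: "(real^'d \<Rightarrow> real) \<Rightarrow> (real^'d \<Rightarrow> real)"
    and T Ct \<Psi> :: real and \<psi> \<psi>t :: "real \<Rightarrow> real^'d \<Rightarrow> real" +
  fixes \<phi> :: "real^'d \<Rightarrow> real" and \<phi>l \<phi>u :: real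
    and f0 :: "real \<Rightarrow> real^'d \<Rightarrow> real" and Kf :: real and \<rho>0 :: "real^'d \<Rightarrow> real"
  assumes T_pos: "0 < T"
    and phi_measurable: "\<phi> \<in> borel_measurable (lebesgue_on U)"
    and phi_bounds: "0 < \<phi>l" "\<And>x. x \<in> U \<Longrightarrow> \<phi>l \<le> \<phi> x" "\<And>x. x \<in> U \<Longrightarrow> \<phi> x \<le> \<phi>u"
    and source_L2: "AE t in lborel. t \<in> {0<..<T} \<longrightarrow> in_Lp (lebesgue_on U) 2 (f0 t)"
    and source_integrable: "integrable lborel (\<lambda>t. L2_inner (lebesgue_on U) (f0 t) (f0 t))"
    and Kf: "0 \<le> Kf"
    and source_diff_integrable: "\<And>h. 0 \<le> h \<Longrightarrow> integrable lborel (\<lambda>t. indicator {0<..<T - h} t *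
         L2_inner (lebesgue_on U) (\<lambda>x. f0 (t + h) x - f0 t x) (\<lambda>x. f0 (t + h) x - f0 t x))"
    and source_diff: "\<And>h. 0 \<le> h \<Longrightarrow> (\<integral>t. indicator {0<..<T - h} t *
         L2_inner (lebesgue_on U) (\<lambda>x. f0 (t + h) x - f0 t x) (\<lambda>x. f0 (t + h) x - f0 t x) \<partial>lborel) \<le> h\<^sup>2 * Kf"
    and rho0: "in_Lp (lebesgue_on U) 2 \<rho>0"
begin

text \<open>
  The squared \<open>L\<^sup>2\<close> norm with weight \<open>\<phi>\<close>, equivalent to the
  unweighted one. It is the quantity whose time derivative the weak formulation provides.
\<close>

definition wsq :: "(real^'d \<Rightarrow> real) \<Rightarrow> real" where
  "wsq u = L2_inner M (\<lambda>x. \<phi> x * u x) u"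

definition energy :: "(nat \<Rightarrow> real) \<Rightarrow> (real^'d \<Rightarrow> real^'d) \<Rightarrow> real" where
  "energy a G = L2_inner M (\<lambda>x. F a (G x)) G"

text \<open>
  The weak problem after elimination of the flux, which is \<open>- F a (G t)\<close> almost everywhere.
\<close>

definition solution ::
  "(nat \<Rightarrow> real) \<Rightarrow> (real \<Rightarrow> real^'d \<Rightarrow> real) \<Rightarrow> (real \<Rightarrow> real^'d \<Rightarrow> real^'d) \<Rightarrow>
     (real \<Rightarrow> real^'d \<Rightarrow> real) \<Rightarrow> (real \<Rightarrow> real^'d \<Rightarrow> real^'d) \<Rightarrow> bool" where
  "solution a \<rho> G \<rho>t Gt \<longleftrightarrow> a \<in> coeffs \<and> C1_time_H1 U T \<rho> G \<rho>t Gt \<and> L2_tendsto M \<rho> \<rho>0 (at_right 0) \<and>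
     (AE t in lborel. t \<in> {0<..<T} \<longrightarrow> (\<forall>r Gr. sobolev U 2 r Gr \<longrightarrow>
        L2_inner M (\<lambda>x. \<phi> x * \<rho>t t x) r + L2_inner M (\<lambda>x. F a (G t x)) Gr
          = L2_inner M (f0 t) r - L2_inner S (\<psi> t) (tr r)))"

abbreviation "vol \<equiv> measure M (space M)"

lemma vol_nonneg: "0 \<le> vol" by simp

lemma flux_measurable:
  fixes G :: "real^'d \<Rightarrow> real^'d"
  assumes "a \<in> coeffs" "G \<in> borel_measurable M"
  shows "(\<lambda>x. F a (G x)) \<in> borel_measurable M"
  using borel_measurable_continuous_onI[OF continuous_flux[OF assms(1)]] assms(2)
  by (rule measurable_compose[rotated])

lemma flux_L2:
  fixes G :: "real^'d \<Rightarrow> real^'d"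
  assumes "a \<in> coeffs" "in_Lp M 2 G"
  shows "in_Lp M 2 (\<lambda>x. F a (G x))"
  by (rule in_L2_bounded[OF assms(2) flux_measurable[OF assms(1) in_L2_measurable[OF assms(2)]]])
     (rule norm_flux_le[OF assms(1)])

lemma flux_tendsto:
  fixes G :: "real \<Rightarrow> real^'d \<Rightarrow> real^'d"
  assumes a: "a \<in> coeffs" and G: "L2_tendsto M G G0 A" "eventually (\<lambda>s. in_Lp M 2 (G s)) A" "in_Lp M 2 G0"
  shows "L2_tendsto M (\<lambda>s x. F a (G s x)) (\<lambda>x. F a (G0 x)) A"
proof (rule L2_tendsto_bounded[OF G(1) _ G(2,3)])
  show "0 \<le> 2 / \<delta>" using lo_pos by simp
  show "eventually (\<lambda>s. (\<lambda>x. F a (G s x)) \<in> borel_measurable M) A"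
    using G(2) by eventually_elim (rule flux_measurable[OF a in_L2_measurable])
  show "(\<lambda>x. F a (G0 x)) \<in> borel_measurable M" by (rule flux_measurable[OF a in_L2_measurable[OF G(3)]])
qed (rule flux_lipschitz[OF a])

lemma phi_L2: "in_Lp M 2 u \<Longrightarrow> in_Lp M 2 (\<lambda>x. \<phi> x * u x)"
proof (rule in_L2_bounded[of M u])
  assume u: "in_Lp M 2 u"
  show "(\<lambda>x. \<phi> x * u x) \<in> borel_measurable M"
    by (intro borel_measurable_times phi_measurable in_L2_measurable[OF u])
  show "norm (\<phi> x * u x) \<le> \<phi>u * norm (u x)" if "x \<in> space M" for x
    using phi_bounds(1) phi_bounds(2,3)[of x] that by (auto simp: abs_mult intro!: mult_right_mono)
qed

lemma wsq_bounds:
  assumes u: "in_Lp M 2 u"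
  shows "\<phi>l * L2_inner M u u \<le> wsq u" "wsq u \<le> \<phi>u * L2_inner M u u"
proof -
  note i = L2_integrable_inner[OF u u] L2_integrable_inner[OF phi_L2[OF u] u]
  have b: "\<phi>l * (u x \<bullet> u x) \<le> (\<phi> x * u x) \<bullet> u x" "(\<phi> x * u x) \<bullet> u x \<le> \<phi>u * (u x \<bullet> u x)" if "x \<in> space M" for x
    using phi_bounds(2,3)[of x] that by (auto simp: mult.assoc intro!: mult_right_mono)
  have "(\<integral>x. \<phi>l * (u x \<bullet> u x) \<partial>M) \<le> wsq u"
    unfolding wsq_def L2_inner_def using i by (intro integral_mono b) auto
  moreover have "wsq u \<le> (\<integral>x. \<phi>u * (u x \<bullet> u x) \<partial>M)"
    unfolding wsq_def L2_inner_def using i by (intro integral_mono b) auto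
  ultimately show "\<phi>l * L2_inner M u u \<le> wsq u" "wsq u \<le> \<phi>u * L2_inner M u u" by (auto simp: L2_inner_def)
qed

lemma wsq_nonneg: "in_Lp M 2 u \<Longrightarrow> 0 \<le> wsq u"
  using wsq_bounds(1)[of u] phi_bounds(1) L2_inner_self_nonneg[of M u]
  by (smt (verit) mult_nonneg_nonneg)

lemma L2_le_wsq: "in_Lp M 2 u \<Longrightarrow> L2_inner M u u \<le> wsq u / \<phi>l"
  using wsq_bounds(1)[of u] phi_bounds(1) by (simp add: field_simps)

lemma phi_tendsto:
  assumes u: "L2_tendsto M u u0 A" "eventually (\<lambda>s. in_Lp M 2 (u s)) A" "in_Lp M 2 u0"
  shows "L2_tendsto M (\<lambda>s x. \<phi> x * u s x) (\<lambda>x. \<phi> x * u0 x) A"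
proof (rule L2_tendsto_bounded[where B="\<bar>\<phi>u\<bar>", OF u(1) _ u(2,3)])
  show "eventually (\<lambda>s. (\<lambda>x. \<phi> x * u s x) \<in> borel_measurable M) A"
    using u(2) by eventually_elim (rule in_L2_measurable[OF phi_L2])
  show "(\<lambda>x. \<phi> x * u0 x) \<in> borel_measurable M" by (rule in_L2_measurable[OF phi_L2[OF u(3)]])
  show "norm (\<phi> x * u s x - \<phi> x * u0 x) \<le> \<bar>\<phi>u\<bar> * norm (u s x - u0 x)" if "x \<in> space M" for s x
    using phi_bounds(1) phi_bounds(2,3)[of x] that
    by (auto simp: right_diff_distrib[symmetric] abs_mult intro!: mult_right_mono)
qed simp

lemma wsq_tendsto:
  assumes u: "L2_tendsto M u u0 A" "eventually (\<lambda>s. in_Lp M 2 (u s)) A" "in_Lp M 2 u0"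
  shows "((\<lambda>s. wsq (u s)) \<longlongrightarrow> wsq u0) A"
  unfolding wsq_def
  by (rule L2_tendsto_inner[OF phi_tendsto[OF u] u(1) _ u(2) phi_L2[OF u(3)] u(3)])
     (use u(2) in \<open>auto elim!: eventually_mono intro: phi_L2\<close>)

lemma wsq_has_derivative:
  assumes d: "has_L2_derivative M u u' t" and ev: "eventually (\<lambda>s. in_Lp M 2 (u s)) (at t)"
    and t: "in_Lp M 2 (u t)" "in_Lp M 2 u'"
  shows "((\<lambda>s. wsq (u s)) has_real_derivative 2 * L2_inner M (\<lambda>x. \<phi> x * u' x) (u t)) (at t)"
proof -
  have "L2_tendsto M (\<lambda>s x. \<phi> x * ((u s x - u t x) /\<^sub>R (s - t))) (\<lambda>x. \<phi> x * u' x) (at t)"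
    using d by (intro phi_tendsto eventually_in_L2_quotient[OF ev t(1)] t) (simp add: has_L2_derivative_def)
  then have d': "has_L2_derivative M (\<lambda>s x. \<phi> x * u s x) (\<lambda>x. \<phi> x * u' x) t"
    by (simp add: has_L2_derivative_def algebra_simps)
  have ev': "eventually (\<lambda>s. in_Lp M 2 (\<lambda>x. \<phi> x * u s x)) (at t)"
    using ev by eventually_elim (rule phi_L2)
  have "L2_inner M (\<lambda>x. \<phi> x * u t x) u' = L2_inner M (\<lambda>x. \<phi> x * u' x) (u t)"
    by (simp add: L2_inner_def mult_ac)
  then show ?thesis
    unfolding wsq_def
    using L2_inner_has_derivative[OF d' d ev' ev phi_L2[OF t(1)] t(1) phi_L2[OF t(2)] t(2)] by simp
qed

lemma energy_nonneg_int:
  assumes "a \<in> coeffs"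
  shows "0 \<le> energy a G"
  unfolding energy_def L2_inner_def by (intro integral_nonneg_AE AE_I2 energy_nonneg[OF assms])

lemma energy_tendsto:
  assumes a: "a \<in> coeffs" and G: "L2_tendsto M G G0 A" "eventually (\<lambda>s. in_Lp M 2 (G s)) A" "in_Lp M 2 G0"
  shows "((\<lambda>s. energy a (G s)) \<longlongrightarrow> energy a G0) A"
  unfolding energy_def
  by (rule L2_tendsto_inner[OF flux_tendsto[OF a G] G(1) _ G(2) flux_L2[OF a G(3)] G(3)])
     (use G(2) in \<open>auto elim!: eventually_mono intro: flux_L2[OF a]\<close>)

lemma gradient_L1:
  assumes a: "a \<in> coeffs" and G: "in_Lp M 2 G" and e: "0 < \<epsilon>"
  shows "(\<integral>x. norm (G x) \<partial>M) \<le> \<epsilon> * energy a G + (real N + 1) * \<mu> * wt (1 / \<epsilon>) / \<epsilon> * vol"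
proof -
  interpret finite_measure M by (rule M_finite)
  have i: "integrable M (\<lambda>x. F a (G x) \<bullet> G x)" by (rule L2_integrable_inner[OF flux_L2[OF a G] G])
  have "(\<integral>x. norm (G x) \<partial>M) \<le> (\<integral>x. \<epsilon> * (F a (G x) \<bullet> G x) + (real N + 1) * \<mu> * wt (1 / \<epsilon>) / \<epsilon> \<partial>M)"
    using i L1_le_L2(1)[OF M_finite G] by (intro integral_mono norm_le_energy[OF a e]) auto
  also have "\<dots> = \<epsilon> * energy a G + (real N + 1) * \<mu> * wt (1 / \<epsilon>) / \<epsilon> * vol"
    using i by (simp add: energy_def L2_inner_def)
  finally show ?thesis .
qed

text \<open>
  The boundary term costs a quarter of the energy: the trace inequality leaves the
  \<open>L\<^sup>1\<close> norm of the gradient, and \<open>gradient_L1\<close> bounds that by an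
  arbitrarily small multiple of the energy plus a constant.
\<close>

lemma boundary_absorb:
  obtains cb where "0 \<le> cb"
    "\<And>a r Gr h. a \<in> coeffs \<Longrightarrow> sobolev U 2 r Gr \<Longrightarrow> h \<in> borel_measurable S \<Longrightarrow>
       \<forall>x\<in>frontier U. \<bar>h x\<bar> \<le> \<Psi> \<Longrightarrow>
       \<bar>L2_inner S h (tr r)\<bar> \<le> energy a Gr / 4 + cb * (1 + L2_inner M r r)"
proof -
  define k where "k = \<Psi> * Ct"
  have k: "0 \<le> k" using \<Psi> Ct by (simp add: k_def)
  \<comment> \<open>The multiple of the energy left by the trace inequality becomes at most \<open>1/4\<close>.\<close>
  define \<epsilon> where "\<epsilon> = 1 / (4 * (k + 1))"
  have e: "0 < \<epsilon>" "k * \<epsilon> \<le> 1 / 4" using k by (auto simp: \<epsilon>_def field_simps)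
  define c where "c = (real N + 1) * \<mu> * wt (1 / \<epsilon>) / \<epsilon> * vol"
  have c: "0 \<le> c" using up_pos wt_ge1[of "1/\<epsilon>"] e vol_nonneg unfolding c_def by (intro mult_nonneg_nonneg divide_nonneg_nonneg) auto
  define cb where "cb = k * (vol + 1 + c)"
  show ?thesis
  proof (rule that[of cb])
    show cb0: "0 \<le> cb" using k c vol_nonneg by (simp add: cb_def)
    fix a r Gr h
    assume a: "a \<in> coeffs" and r: "sobolev U 2 r Gr" and h: "h \<in> borel_measurable S" "\<forall>x\<in>frontier U. \<bar>h x\<bar> \<le> \<Psi>"
    have L: "in_Lp M 2 r" "in_Lp M 2 Gr" using r by (auto simp: sobolev_def)
    have E: "0 \<le> energy a Gr" "0 \<le> L2_inner M r r"
      using energy_nonneg_int[OF a] L2_inner_self_nonneg by auto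
    have "\<bar>L2_inner S h (tr r)\<bar> \<le> k * ((\<integral>x. \<bar>r x\<bar> \<partial>M) + (\<integral>x. norm (Gr x) \<partial>M))"
      unfolding k_def by (rule boundary_bound[OF r h(1) _ \<Psi>]) (use h(2) in blast)
    also have "\<dots> \<le> k * ((vol + L2_inner M r r) / 2 + (\<epsilon> * energy a Gr + c))"
      using L1_le_L2(2)[OF M_finite L(1)] gradient_L1[OF a L(2) e(1)]
      by (intro mult_left_mono k add_mono) (auto simp: c_def)
    also have "\<dots> = (k * \<epsilon>) * energy a Gr + k * (vol / 2 + L2_inner M r r / 2 + c)"
      by (simp add: algebra_simps add_divide_distrib)
    also have "\<dots> \<le> 1 / 4 * energy a Gr + k * ((vol + 1 + c) * (1 + L2_inner M r r))"
    proof (intro add_mono mult_right_mono mult_left_mono e E k)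
      have "0 \<le> (vol + c) * L2_inner M r r" using vol_nonneg c E by simp
      moreover have "(vol + 1 + c) * (1 + L2_inner M r r)
          = vol + 1 + c + L2_inner M r r + (vol + c) * L2_inner M r r" by (simp only: algebra_simps)
      ultimately show "vol / 2 + L2_inner M r r / 2 + c \<le> (vol + 1 + c) * (1 + L2_inner M r r)"
        using vol_nonneg E by linarith
    qed
    finally show "\<bar>L2_inner S h (tr r)\<bar> \<le> energy a Gr / 4 + cb * (1 + L2_inner M r r)"
      by (simp add: cb_def mult.assoc)
  qed
qed

lemma solutionD:
  assumes "solution a \<rho> G \<rho>t Gt"
  shows "a \<in> coeffs" "C1_time_H1 U T \<rho> G \<rho>t Gt" "L2_tendsto M \<rho> \<rho>0 (at_right 0)"
    "AE t in lborel. t \<in> {0<..<T} \<longrightarrow> (\<forall>r Gr. sobolev U 2 r Gr \<longrightarrow>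
        L2_inner M (\<lambda>x. \<phi> x * \<rho>t t x) r + L2_inner M (\<lambda>x. F a (G t x)) Gr
          = L2_inner M (f0 t) r - L2_inner S (\<psi> t) (tr r))"
  using assms by (auto simp: solution_def)

lemma solution_ev:
  assumes "C1_time_H1 U T \<rho> G \<rho>t Gt" "t \<in> {0<..<T}"
  shows "eventually (\<lambda>s. in_Lp M 2 (\<rho> s)) (at t)" "eventually (\<lambda>s. in_Lp M 2 (G s)) (at t)"
    "eventually (\<lambda>s. in_Lp M 2 (\<rho>t s)) (at t)" "eventually (\<lambda>s. in_Lp M 2 (Gt s)) (at t)"
  using eventually_at_Ioo[OF assms(2)] C1_time_H1D[OF assms(1)] by (auto elim!: eventually_mono)

lemma rho_continuous:
  assumes c: "C1_time_H1 U T \<rho> G \<rho>t Gt" and t: "t \<in> {0<..<T}"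
  shows "L2_tendsto M \<rho> (\<rho> t) (at t)" "L2_tendsto M G (G t) (at t)"
  using has_L2_derivative_tendsto C1_time_H1D[OF c t] solution_ev[OF c t] by blast+

lemma wsq_rho_derivative:
  assumes c: "C1_time_H1 U T \<rho> G \<rho>t Gt" and t: "t \<in> {0<..<T}"
  shows "((\<lambda>s. wsq (\<rho> s)) has_real_derivative 2 * L2_inner M (\<lambda>x. \<phi> x * \<rho>t t x) (\<rho> t)) (at t)"
  using wsq_has_derivative[OF C1_time_H1D(3)[OF c t] solution_ev(1)[OF c t] C1_time_H1D(7,9)[OF c t]] .

lemma energy_continuous:
  assumes a: "a \<in> coeffs" and c: "C1_time_H1 U T \<rho> G \<rho>t Gt"
  shows "continuous_on {0<..<T} (\<lambda>t. energy a (G t))"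
proof (rule continuous_at_imp_continuous_on, rule ballI)
  fix t assume t: "t \<in> {0<..<T}"
  show "isCont (\<lambda>t. energy a (G t)) t"
    unfolding isCont_def
    by (rule energy_tendsto[OF a rho_continuous(2)[OF c t] solution_ev(2)[OF c t] C1_time_H1D(8)[OF c t]])
qed

lemma wsq_rhot_continuous:
  assumes c: "C1_time_H1 U T \<rho> G \<rho>t Gt"
  shows "continuous_on {0<..<T} (\<lambda>t. wsq (\<rho>t t))"
proof (rule continuous_at_imp_continuous_on, rule ballI)
  fix t assume t: "t \<in> {0<..<T}"
  show "isCont (\<lambda>t. wsq (\<rho>t t)) t"
    unfolding isCont_def
    by (rule wsq_tendsto[OF C1_time_H1D(5)[OF c t] solution_ev(3)[OF c t] C1_time_H1D(9)[OF c t]])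
qed

definition potential_energy :: "(nat \<Rightarrow> real) \<Rightarrow> (real^'d \<Rightarrow> real^'d) \<Rightarrow> real" where
  "potential_energy a G = (\<integral>x. forch_potential N \<alpha> a (G x) \<partial>M)"

lemma potential_integrable:
  fixes G :: "real^'d \<Rightarrow> real^'d"
  assumes a: "a \<in> coeffs" and G: "in_Lp M 2 G"
  shows "integrable M (\<lambda>x. forch_potential N \<alpha> a (G x))"
proof (rule Bochner_Integration.integrable_bound)
  show "integrable M (\<lambda>x. F a (G x) \<bullet> G x)" by (rule L2_integrable_inner[OF flux_L2[OF a G] G])
  have [measurable]: "(\<lambda>x. F a (G x)) \<in> borel_measurable M" "G \<in> borel_measurable M"
    using flux_measurable[OF a] in_L2_measurable[OF G] by auto
  show "(\<lambda>x. forch_potential N \<alpha> a (G x)) \<in> borel_measurable M"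
    unfolding forch_potential_def forch_dual_potential_def by measurable
  show "AE x in M. norm (forch_potential N \<alpha> a (G x)) \<le> norm (F a (G x) \<bullet> G x)"
  proof (rule AE_I2)
    fix x
    show "norm (forch_potential N \<alpha> a (G x)) \<le> norm (F a (G x) \<bullet> G x)"
      using potential_bounds[OF a, of "G x"] energy_nonneg[OF a, of "G x"] by simp
  qed
qed

lemma potential_energy_bounds:
  assumes a: "a \<in> coeffs" and G: "in_Lp M 2 G"
  shows "energy a G / 2 \<le> potential_energy a G" "potential_energy a G \<le> energy a G"
proof -
  have i: "integrable M (\<lambda>x. F a (G x) \<bullet> G x)" by (rule L2_integrable_inner[OF flux_L2[OF a G] G])
  have "(\<integral>x. F a (G x) \<bullet> G x / 2 \<partial>M) \<le> potential_energy a G"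
    unfolding potential_energy_def using i potential_integrable[OF a G] potential_bounds[OF a]
    by (intro integral_mono) auto
  then show "energy a G / 2 \<le> potential_energy a G" by (simp add: energy_def L2_inner_def)
  show "potential_energy a G \<le> energy a G"
    unfolding potential_energy_def energy_def L2_inner_def
    using i potential_integrable[OF a G] potential_bounds[OF a] by (intro integral_mono) auto
qed

lemma potential_energy_convex:
  fixes G1 G2 :: "real^'d \<Rightarrow> real^'d"
  assumes a: "a \<in> coeffs" and G: "in_Lp M 2 G1" "in_Lp M 2 G2"
  shows "L2_inner M (\<lambda>x. F a (G1 x)) (\<lambda>x. G2 x - G1 x) \<le> potential_energy a G2 - potential_energy a G1"
proof -
  note p = potential_integrable[OF a G(1)] potential_integrable[OF a G(2)]
  have "L2_inner M (\<lambda>x. F a (G1 x)) (\<lambda>x. G2 x - G1 x)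
      \<le> (\<integral>x. forch_potential N \<alpha> a (G2 x) - forch_potential N \<alpha> a (G1 x) \<partial>M)"
    unfolding L2_inner_def
    using p L2_integrable_inner[OF flux_L2[OF a G(1)] in_L2_diff[OF G(2,1)]] potential_convex[OF a]
    by (intro integral_mono) auto
  then show ?thesis using p by (simp add: potential_energy_def)
qed

text \<open>
  The flux is merely Lipschitz as a map on \<open>L\<^sup>2\<close>, so the chain rule is replaced by
  convexity: the difference quotient of the potential energy lies between the pairings of the difference
  quotient of \<open>G\<close> with the fluxes at the two times, and both have the same limit.
\<close>

lemma potential_energy_has_derivative:
  assumes a: "a \<in> coeffs" and c: "C1_time_H1 U T \<rho> G \<rho>t Gt" and t: "t \<in> {0<..<T}"
  shows "((\<lambda>s. potential_energy a (G s)) has_real_derivative L2_inner M (\<lambda>x. F a (G t x)) (Gt t)) (at t)"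
proof -
  note D = C1_time_H1D[OF c]
  let ?q = "\<lambda>s x. (G s x - G t x) /\<^sub>R (s - t)"
  have ev: "eventually (\<lambda>s. s \<in> {0<..<T} \<and> s \<noteq> t) (at t)"
    using eventually_at_Ioo[OF t] by (simp add: eventually_conj eventually_at_filter)
  have q: "L2_tendsto M ?q (Gt t) (at t)" using D(4)[OF t] by (simp add: has_L2_derivative_def)
  have q2: "eventually (\<lambda>s. in_Lp M 2 (?q s)) (at t)"
    by (rule eventually_in_L2_quotient[OF solution_ev(2)[OF c t] D(8)[OF t]])
  have Fev: "eventually (\<lambda>s. in_Lp M 2 (\<lambda>x. F a (G s x))) (at t)"
    using solution_ev(2)[OF c t] by eventually_elim (rule flux_L2[OF a])
  let ?l = "\<lambda>s. L2_inner M (\<lambda>x. F a (G t x)) (?q s)" and ?u = "\<lambda>s. L2_inner M (\<lambda>x. F a (G s x)) (?q s)"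
  have lims: "(?l \<longlongrightarrow> L2_inner M (\<lambda>x. F a (G t x)) (Gt t)) (at t)"
    "(?u \<longlongrightarrow> L2_inner M (\<lambda>x. F a (G t x)) (Gt t)) (at t)"
    by (rule L2_tendsto_inner[OF L2_tendsto_const q _ q2 flux_L2[OF a D(8)[OF t]] D(10)[OF t]],
        simp add: flux_L2[OF a D(8)[OF t]])
       (rule L2_tendsto_inner[OF flux_tendsto[OF a rho_continuous(2)[OF c t] solution_ev(2)[OF c t] D(8)[OF t]]
          q Fev q2 flux_L2[OF a D(8)[OF t]] D(10)[OF t]])
  let ?d = "\<lambda>s. (potential_energy a (G s) - potential_energy a (G t)) / (s - t)"
  have sand: "eventually (\<lambda>s. min (?l s) (?u s) \<le> ?d s \<and> ?d s \<le> max (?l s) (?u s)) (at t)"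
    using ev
  proof eventually_elim
    case (elim s)
    note s = D(8)[of s] D(8)[OF t]
    have 1: "L2_inner M (\<lambda>x. F a (G t x)) (\<lambda>x. G s x - G t x) \<le> potential_energy a (G s) - potential_energy a (G t)"
      using elim by (intro potential_energy_convex[OF a] s) auto
    have "L2_inner M (\<lambda>x. F a (G s x)) (\<lambda>x. G t x - G s x) = - L2_inner M (\<lambda>x. F a (G s x)) (\<lambda>x. G s x - G t x)"
      using L2_inner_scale_right[of M "\<lambda>x. F a (G s x)" "-1" "\<lambda>x. G s x - G t x"] by simp
    moreover have "L2_inner M (\<lambda>x. F a (G s x)) (\<lambda>x. G t x - G s x) \<le> potential_energy a (G t) - potential_energy a (G s)"
      using elim by (intro potential_energy_convex[OF a] s) auto
    ultimately have 2: "potential_energy a (G s) - potential_energy a (G t) \<le> L2_inner M (\<lambda>x. F a (G s x)) (\<lambda>x. G s x - G t x)"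
      by simp
    show ?case
    proof (cases "t < s")
      case True
      then have "?l s \<le> ?d s \<and> ?d s \<le> ?u s"
        using 1 2 unfolding L2_inner_scale_right by (simp add: divide_inverse mult.commute mult_left_mono)
      then show ?thesis by auto
    next
      case False
      then have "s < t" using elim by auto
      then have "inverse (s - t) \<le> 0" by simp
      then have "?u s \<le> ?d s \<and> ?d s \<le> ?l s"
        using 1 2 unfolding L2_inner_scale_right by (simp add: divide_inverse mult.commute[of _ "inverse (s - t)"] mult_left_mono_neg)
      then show ?thesis by auto
    qed
  qed
  show ?thesis unfolding has_field_derivative_iff
  proof (rule tendsto_sandwich)
    show "((\<lambda>s. min (?l s) (?u s)) \<longlongrightarrow> L2_inner M (\<lambda>x. F a (G t x)) (Gt t)) (at t)"
      using tendsto_min[OF lims] by simp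
    show "((\<lambda>s. max (?l s) (?u s)) \<longlongrightarrow> L2_inner M (\<lambda>x. F a (G t x)) (Gt t)) (at t)"
      using tendsto_max[OF lims] by simp
  qed (use sand in \<open>auto elim!: eventually_mono\<close>)
qed

end

lemma exists_le_average:
  fixes e :: "real \<Rightarrow> real"
  assumes "a < b" "continuous_on {a..b} e" "integral {a..b} e \<le> C"
  obtains t where "t \<in> {a..b}" "e t \<le> (C + 1) / (b - a)"
proof -
  have "\<exists>t\<in>{a..b}. e t \<le> (C + 1) / (b - a)"
  proof (rule ccontr)
    assume "\<not> ?thesis"
    then have "integral {a..b} (\<lambda>_. (C + 1) / (b - a)) \<le> integral {a..b} e"
      using assms(2) by (intro integral_le integrable_continuous_real) (auto simp: not_le less_imp_le)
    then show False using assms by simp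
  qed
  then show ?thesis using that by blast
qed

lemma exp_mult_le:
  fixes x y A t T :: real
  assumes "0 \<le> A" "t \<le> T" "x \<le> y" "0 \<le> y"
  shows "exp (A * t) * x \<le> exp (A * T) * y"
proof -
  have "exp (A * t) * x \<le> exp (A * t) * y" using assms by (intro mult_left_mono) auto
  also have "\<dots> \<le> exp (A * T) * y" using assms by (intro mult_right_mono) (auto intro: mult_left_mono)
  finally show ?thesis .
qed

context flow
begin

definition fnorm :: real where
  "fnorm = (\<integral>t. L2_inner M (f0 t) (f0 t) \<partial>lborel)"

lemma fnorm_nonneg: "0 \<le> fnorm"
  unfolding fnorm_def by (intro integral_nonneg_AE AE_I2 L2_inner_self_nonneg)

lemma source_plus_const:
  assumes "0 \<le> k" "0 \<le> c"
  shows "integrable lborel (\<lambda>t. k * L2_inner M (f0 t) (f0 t) + c * indicator {0..T} t)"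
    "0 \<le> k * L2_inner M (f0 t) (f0 t) + c * indicator {0..T} t"
    "(\<integral>t. k * L2_inner M (f0 t) (f0 t) + c * indicator {0..T} t \<partial>lborel) = k * fnorm + c * T"
proof -
  have i: "integrable lborel (indicator {0..T} :: real \<Rightarrow> real)"
    by (intro integrable_real_indicator emeasure_bounded_finite) auto
  show "integrable lborel (\<lambda>t. k * L2_inner M (f0 t) (f0 t) + c * indicator {0..T} t)"
    using i source_integrable by simp
  show "0 \<le> k * L2_inner M (f0 t) (f0 t) + c * indicator {0..T} t"
    using assms L2_inner_self_nonneg[of M "f0 t"] by simp
  show "(\<integral>t. k * L2_inner M (f0 t) (f0 t) + c * indicator {0..T} t \<partial>lborel) = k * fnorm + c * T"
    using i source_integrable T_pos by (simp add: fnorm_def)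
qed

lemma energy_integral_mono:
  assumes a: "a \<in> coeffs" and c: "C1_time_H1 U T \<rho> G \<rho>t Gt" and "0 < s'" "s' \<le> s" "t < T"
  shows "integral {s..t} (\<lambda>\<tau>. energy a (G \<tau>)) \<le> integral {s'..t} (\<lambda>\<tau>. energy a (G \<tau>))"
  using assms energy_nonneg_int[OF a]
  by (intro integral_subset_le integrable_continuous_real continuous_on_subset[OF energy_continuous[OF a c]]) auto

text \<open>
  Testing with \<open>\<rho>\<close>. The differential inequality is integrated from \<open>s >
  0\<close>, where solutions are differentiable in time, and then \<open>s\<close> tends to
  \<open>0\<close>, which brings in the initial datum.
\<close>

lemma energy_estimate:
  obtains C where "0 \<le> C"
    "\<And>a \<rho> G \<rho>t Gt t. solution a \<rho> G \<rho>t Gt \<Longrightarrow> t \<in> {0<..<T} \<Longrightarrow> wsq (\<rho> t) \<le> C"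
    "\<And>a \<rho> G \<rho>t Gt s t. solution a \<rho> G \<rho>t Gt \<Longrightarrow> 0 < s \<Longrightarrow> s \<le> t \<Longrightarrow> t < T \<Longrightarrow>
       integral {s..t} (\<lambda>\<tau>. energy a (G \<tau>)) \<le> C"
proof -
  obtain cb where cb: "0 \<le> cb"
    "\<And>a r Gr h. a \<in> coeffs \<Longrightarrow> sobolev U 2 r Gr \<Longrightarrow> h \<in> borel_measurable S \<Longrightarrow>
       \<forall>x\<in>frontier U. \<bar>h x\<bar> \<le> \<Psi> \<Longrightarrow>
       \<bar>L2_inner S h (tr r)\<bar> \<le> energy a Gr / 4 + cb * (1 + L2_inner M r r)"
    by (rule boundary_absorb) (rule that)
  define A where "A = (1 + 2 * cb) / \<phi>l"
  define B where "B = fnorm + 2 * cb * T"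
  have A: "0 \<le> A" using cb phi_bounds(1) by (simp add: A_def)
  have B: "0 \<le> B" using cb fnorm_nonneg T_pos by (simp add: B_def)
  have main: "wsq (\<rho> t) + integral {s..t} (\<lambda>\<tau>. energy a (G \<tau>)) \<le> exp (A * T) * (wsq (\<rho> s) + B)"
    if sol: "solution a \<rho> G \<rho>t Gt" and st: "0 < s" "s \<le> t" "t < T" for a \<rho> G \<rho>t Gt s t
  proof -
    note a = solutionD(1)[OF sol] and c = solutionD(2)[OF sol]
    note D = C1_time_H1D[OF c]
    let ?b = "\<lambda>t. 1 * L2_inner M (f0 t) (f0 t) + 2 * cb * indicator {0..T} t"
    have sub: "{s..t} \<subseteq> {0<..<T}" using st by auto
    have "wsq (\<rho> t) + integral {s..t} (\<lambda>\<tau>. energy a (G \<tau>)) \<le> exp (A * (t - s)) * (wsq (\<rho> s) + integral\<^sup>L lborel ?b)"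
    proof (rule gronwall[OF st(2) A])
      show "((\<lambda>s. wsq (\<rho> s)) has_real_derivative 2 * L2_inner M (\<lambda>x. \<phi> x * \<rho>t \<tau> x) (\<rho> \<tau>)) (at \<tau>)"
        if "\<tau> \<in> {s..t}" for \<tau>
        using wsq_rho_derivative[OF c] that sub by blast
      show "continuous_on {s..t} (\<lambda>\<tau>. energy a (G \<tau>))"
        by (rule continuous_on_subset[OF energy_continuous[OF a c] sub])
      show "AE \<tau> in lborel. \<tau> \<in> {s..t} \<longrightarrow> 2 * L2_inner M (\<lambda>x. \<phi> x * \<rho>t \<tau> x) (\<rho> \<tau>) + energy a (G \<tau>)
          \<le> A * wsq (\<rho> \<tau>) + ?b \<tau>"
        using solutionD(4)[OF sol] source_L2
      proof eventually_elim
        case (elim \<tau>)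
        show ?case
        proof
          assume "\<tau> \<in> {s..t}"
          then have \<tau>: "\<tau> \<in> {0<..<T}" using sub by auto
          let ?r = "L2_inner M (\<rho> \<tau>) (\<rho> \<tau>)"
          have eq: "L2_inner M (\<lambda>x. \<phi> x * \<rho>t \<tau> x) (\<rho> \<tau>) + energy a (G \<tau>)
              = L2_inner M (f0 \<tau>) (\<rho> \<tau>) - L2_inner S (\<psi> \<tau>) (tr (\<rho> \<tau>))"
            using elim(1) \<tau> D(1)[OF \<tau>] by (simp add: energy_def)
          have f: "\<bar>L2_inner M (f0 \<tau>) (\<rho> \<tau>)\<bar> \<le> L2_inner M (f0 \<tau>) (f0 \<tau>) / 2 + ?r / 2"
            using L2_young[of M "f0 \<tau>" "\<rho> \<tau>" 1] elim(2) \<tau> D(7)[OF \<tau>] by simp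
          have bd: "\<bar>L2_inner S (\<psi> \<tau>) (tr (\<rho> \<tau>))\<bar> \<le> energy a (G \<tau>) / 4 + cb * (1 + ?r)"
            by (rule cb(2)[OF a D(1)[OF \<tau>] psi_measurable(1)[OF \<tau>] ballI[OF psi_bound(1)[OF \<tau>]]])
          have "(1 + 2 * cb) * ?r \<le> (1 + 2 * cb) * (wsq (\<rho> \<tau>) / \<phi>l)"
            using cb(1) by (intro mult_left_mono L2_le_wsq D(7)[OF \<tau>]) auto
          then have "(1 + 2 * cb) * ?r \<le> A * wsq (\<rho> \<tau>)" by (simp add: A_def)
          moreover have "(1 + 2 * cb) * ?r = ?r + 2 * (cb * ?r)" "cb * (1 + ?r) = cb + cb * ?r"
            by (simp_all add: algebra_simps)
          moreover have "(indicator {0..T} \<tau> :: real) = 1" using \<tau> by simp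
          ultimately show "2 * L2_inner M (\<lambda>x. \<phi> x * \<rho>t \<tau> x) (\<rho> \<tau>) + energy a (G \<tau>) \<le> A * wsq (\<rho> \<tau>) + ?b \<tau>"
            using eq f bd energy_nonneg_int[OF a, of "G \<tau>"] by simp
        qed
      qed
      show "integrable lborel ?b" by (rule source_plus_const(1)) (use cb in auto)
      show "0 \<le> ?b \<tau>" for \<tau> by (rule source_plus_const(2)) (use cb in auto)
    qed (rule energy_nonneg_int[OF a])
    also have "integral\<^sup>L lborel ?b = B" using source_plus_const(3)[of 1 "2 * cb"] cb by (simp add: B_def)
    also have "exp (A * (t - s)) * (wsq (\<rho> s) + B) \<le> exp (A * T) * (wsq (\<rho> s) + B)"
      using st A B wsq_nonneg[OF D(7)[of s]] by (intro exp_mult_le) auto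
    finally show ?thesis .
  qed
  have lim: "((\<lambda>s. exp (A * T) * (wsq (\<rho> s) + B)) \<longlongrightarrow> exp (A * T) * (wsq \<rho>0 + B)) (at_right 0)"
    if sol: "solution a \<rho> G \<rho>t Gt" for a \<rho> G \<rho>t Gt
  proof -
    have "eventually (\<lambda>s. in_Lp M 2 (\<rho> s)) (at_right 0)"
      using eventually_at_right_real[OF T_pos]
      by eventually_elim (rule C1_time_H1D(7)[OF solutionD(2)[OF sol]])
    from wsq_tendsto[OF solutionD(3)[OF sol] this rho0] show ?thesis by (intro tendsto_intros)
  qed
  show ?thesis
  proof (rule that[of "exp (A * T) * (wsq \<rho>0 + B)"])
    show "0 \<le> exp (A * T) * (wsq \<rho>0 + B)" using B wsq_nonneg[OF rho0] by simp
    fix a \<rho> G \<rho>t Gt s t assume sol: "solution a \<rho> G \<rho>t Gt"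
    note a = solutionD(1)[OF sol] and c = solutionD(2)[OF sol]
    have i0: "0 \<le> integral {s..t} (\<lambda>\<tau>. energy a (G \<tau>))" for s t
      by (cases "(\<lambda>\<tau>. energy a (G \<tau>)) integrable_on {s..t}")
         (auto intro!: integral_nonneg energy_nonneg_int[OF a] simp: not_integrable_integral)
    {
      assume t: "t \<in> {0<..<T}"
      have "eventually (\<lambda>s. wsq (\<rho> t) \<le> exp (A * T) * (wsq (\<rho> s) + B)) (at_right 0)"
        using eventually_at_right_real[of 0 t]
      proof (rule eventually_mono)
        fix s assume "s \<in> {0<..<t}"
        then show "wsq (\<rho> t) \<le> exp (A * T) * (wsq (\<rho> s) + B)"
          using main[OF sol, of s t] t i0[of s t] by auto
      qed (use t in auto)
      then show "wsq (\<rho> t) \<le> exp (A * T) * (wsq \<rho>0 + B)"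
        by (intro tendsto_lowerbound[OF lim[OF sol]]) auto
    next
      assume st: "0 < s" "s \<le> t" "t < T"
      have "eventually (\<lambda>s'. integral {s..t} (\<lambda>\<tau>. energy a (G \<tau>)) \<le> exp (A * T) * (wsq (\<rho> s') + B)) (at_right 0)"
        using eventually_at_right_real[OF st(1)]
      proof (rule eventually_mono)
        fix s' assume "s' \<in> {0<..<s}"
        then show "integral {s..t} (\<lambda>\<tau>. energy a (G \<tau>)) \<le> exp (A * T) * (wsq (\<rho> s') + B)"
          using main[OF sol, of s' t] st energy_integral_mono[OF a c, of s' s t]
            wsq_nonneg[OF C1_time_H1D(7)[OF c, of t]] by auto
      qed
      then show "integral {s..t} (\<lambda>\<tau>. energy a (G \<tau>)) \<le> exp (A * T) * (wsq \<rho>0 + B)"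
        by (intro tendsto_lowerbound[OF lim[OF sol]]) auto
    }
  qed
qed

text \<open>
  Testing with \<open>\<rho>\<^sub>t\<close>. The pairing of \<open>\<psi>\<close> with the trace of
  \<open>\<rho>\<^sub>t\<close> cannot be estimated directly; it is combined with the derivative of the
  potential energy into the derivative of \<open>J\<close>, at the price of a pairing with
  \<open>\<psi>\<^sub>t\<close>. By \<open>boundary_absorb\<close>, \<open>J\<close> is still equivalent
  to the energy up to constants.
\<close>

lemma smoothing_estimate:
  assumes \<tau>0: "0 < \<tau>0" "\<tau>0 < T"
  obtains C where "0 \<le> C"
    "\<And>a \<rho> G \<rho>t Gt t. solution a \<rho> G \<rho>t Gt \<Longrightarrow> t \<in> {\<tau>0..<T} \<Longrightarrow> energy a (G t) \<le> C"
    "\<And>a \<rho> G \<rho>t Gt t. solution a \<rho> G \<rho>t Gt \<Longrightarrow> t \<in> {\<tau>0..<T} \<Longrightarrow>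
       integral {\<tau>0..t} (\<lambda>s. wsq (\<rho>t s)) \<le> C"
proof -
  obtain cb where cb: "0 \<le> cb"
    "\<And>a r Gr h. a \<in> coeffs \<Longrightarrow> sobolev U 2 r Gr \<Longrightarrow> h \<in> borel_measurable S \<Longrightarrow>
       \<forall>x\<in>frontier U. \<bar>h x\<bar> \<le> \<Psi> \<Longrightarrow>
       \<bar>L2_inner S h (tr r)\<bar> \<le> energy a Gr / 4 + cb * (1 + L2_inner M r r)"
    by (rule boundary_absorb) (rule that)
  obtain C1 where C1: "0 \<le> C1"
    "\<And>a \<rho> G \<rho>t Gt t. solution a \<rho> G \<rho>t Gt \<Longrightarrow> t \<in> {0<..<T} \<Longrightarrow> wsq (\<rho> t) \<le> C1"
    "\<And>a \<rho> G \<rho>t Gt s t. solution a \<rho> G \<rho>t Gt \<Longrightarrow> 0 < s \<Longrightarrow> s \<le> t \<Longrightarrow> t < T \<Longrightarrow>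
       integral {s..t} (\<lambda>\<tau>. energy a (G \<tau>)) \<le> C1"
    by (rule energy_estimate) (rule that)
  define c' where "c' = cb * (1 + C1 / \<phi>l)"
  define B where "B = 1 / (2 * \<phi>l) * fnorm + 2 * c' * T"
  define e0 where "e0 = (C1 + 1) / (\<tau>0 - \<tau>0 / 2)"
  define Q where "Q = exp (1 * T) * (2 * e0 + c' + B)"
  have c': "0 \<le> c'" using cb C1 phi_bounds(1) by (simp add: c'_def)
  have B: "0 \<le> B" using c' fnorm_nonneg T_pos phi_bounds(1) by (simp add: B_def)
  have e0: "0 \<le> e0" using C1(1) \<tau>0 by (simp add: e0_def)
  have Q: "0 \<le> Q" using c' B e0 by (simp add: Q_def)
  have main: "energy a (G t) / 4 \<le> Q + c' \<and> integral {\<tau>0..t} (\<lambda>s. wsq (\<rho>t s)) / 2 \<le> Q + c'"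
    if sol: "solution a \<rho> G \<rho>t Gt" and t: "t \<in> {\<tau>0..<T}" for a \<rho> G \<rho>t Gt t
  proof -
    note a = solutionD(1)[OF sol] and c = solutionD(2)[OF sol]
    note D = C1_time_H1D[OF c]
    have ce: "continuous_on {\<tau>0 / 2..\<tau>0} (\<lambda>\<tau>. energy a (G \<tau>))"
      by (rule continuous_on_subset[OF energy_continuous[OF a c]]) (use \<tau>0 in auto)
    obtain t0 where t0: "t0 \<in> {\<tau>0 / 2..\<tau>0}" "energy a (G t0) \<le> e0"
      using exists_le_average[OF _ ce, of C1] C1(3)[OF sol, of "\<tau>0/2" \<tau>0] \<tau>0 unfolding e0_def by auto
    have sub: "{t0..t} \<subseteq> {0<..<T}" using t0 t \<tau>0 by auto
    define J where "J s = potential_energy a (G s) + L2_inner S (\<psi> s) (tr (\<rho> s))" for s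
    define J' where "J' s = L2_inner M (\<lambda>x. F a (G s x)) (Gt s)
        + (L2_inner S (\<psi>t s) (tr (\<rho> s)) + L2_inner S (\<psi> s) (tr (\<rho>t s)))" for s
    have bdr: "\<bar>L2_inner S h (tr (\<rho> s))\<bar> \<le> energy a (G s) / 4 + c'"
      if s: "s \<in> {0<..<T}" and h: "h \<in> borel_measurable S" "\<forall>x\<in>frontier U. \<bar>h x\<bar> \<le> \<Psi>" for s h
    proof -
      have "L2_inner M (\<rho> s) (\<rho> s) \<le> wsq (\<rho> s) / \<phi>l" by (rule L2_le_wsq[OF D(7)[OF s]])
      also have "\<dots> \<le> C1 / \<phi>l" using C1(2)[OF sol s] phi_bounds(1) by (intro divide_right_mono) auto
      finally have "cb * (1 + L2_inner M (\<rho> s) (\<rho> s)) \<le> c'"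
        unfolding c'_def using cb(1) by (intro mult_left_mono) auto
      then show ?thesis using cb(2)[OF a D(1)[OF s] h] by simp
    qed
    have Jlo: "energy a (G s) / 4 - c' \<le> J s" and Jhi: "J s \<le> 2 * energy a (G s) + c'" if s: "s \<in> {0<..<T}" for s
      using potential_energy_bounds[OF a D(8)[OF s]] bdr[OF s psi_measurable(1)[OF s] ballI[OF psi_bound(1)[OF s]]]
        energy_nonneg_int[OF a, of "G s"] unfolding J_def by auto
    let ?b = "\<lambda>t. 1 / (2 * \<phi>l) * L2_inner M (f0 t) (f0 t) + 2 * c' * indicator {0..T} t"
    have z0: "0 \<le> wsq (\<rho>t s)" if "s \<in> {0<..<T}" for s by (rule wsq_nonneg[OF D(9)[OF that]])
    have zc: "continuous_on {t0..t} (\<lambda>s. wsq (\<rho>t s))"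
      by (rule continuous_on_subset[OF wsq_rhot_continuous[OF c] sub])
    have "J t + integral {t0..t} (\<lambda>s. wsq (\<rho>t s) / 2) \<le> exp (1 * (t - t0)) * (J t0 + integral\<^sup>L lborel ?b)"
    proof (rule gronwall)
      show "t0 \<le> t" using t0 t by auto
      show "(J has_real_derivative J' s) (at s)" if "s \<in> {t0..t}" for s
        unfolding J_def[abs_def] J'_def
        using that sub by (intro DERIV_add potential_energy_has_derivative[OF a c] boundary_pairing_has_derivative[OF c]) auto
      show "continuous_on {t0..t} (\<lambda>s. wsq (\<rho>t s) / 2)" using zc by (intro continuous_intros) auto
      show "0 \<le> wsq (\<rho>t s) / 2" if "s \<in> {t0..t}" for s using z0 that sub by auto
      show "AE s in lborel. s \<in> {t0..t} \<longrightarrow> J' s + wsq (\<rho>t s) / 2 \<le> 1 * J s + ?b s"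
        using solutionD(4)[OF sol] source_L2
      proof eventually_elim
        case (elim s)
        show ?case
        proof
          assume "s \<in> {t0..t}"
          then have s: "s \<in> {0<..<T}" using sub by auto
          have eq: "wsq (\<rho>t s) + L2_inner M (\<lambda>x. F a (G s x)) (Gt s)
              = L2_inner M (f0 s) (\<rho>t s) - L2_inner S (\<psi> s) (tr (\<rho>t s))"
            using elim(1) s D(2)[OF s] by (simp add: wsq_def)
          have f: "\<bar>L2_inner M (f0 s) (\<rho>t s)\<bar> \<le> L2_inner M (f0 s) (f0 s) / (2 * \<phi>l) + \<phi>l * L2_inner M (\<rho>t s) (\<rho>t s) / 2"
            using L2_young[of M "f0 s" "\<rho>t s" \<phi>l] elim(2) s D(9)[OF s] phi_bounds(1) by simp
          have "(indicator {0..T} s :: real) = 1" using s by simp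
          then show "J' s + wsq (\<rho>t s) / 2 \<le> 1 * J s + ?b s"
            using eq f wsq_bounds(1)[OF D(9)[OF s]] Jlo[OF s]
              bdr[OF s psi_measurable(2)[OF s] ballI[OF psi_bound(2)[OF s]]]
            unfolding J'_def by simp
        qed
      qed
      show "integrable lborel ?b" by (rule source_plus_const(1)) (use c' phi_bounds(1) in auto)
      show "0 \<le> ?b s" for s by (rule source_plus_const(2)) (use c' phi_bounds(1) in auto)
    qed simp
    also have "integral\<^sup>L lborel ?b = B"
      using source_plus_const(3)[of "1 / (2 * \<phi>l)" "2 * c'"] c' phi_bounds(1) by (simp add: B_def)
    also have "exp (1 * (t - t0)) * (J t0 + B) \<le> Q"
      unfolding Q_def
    proof (rule exp_mult_le)
      show "J t0 + B \<le> 2 * e0 + c' + B" using Jhi[of t0] t0 \<tau>0 by simp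
    qed (use t0 t \<tau>0 e0 c' B in auto)
    finally have est: "J t + integral {t0..t} (\<lambda>s. wsq (\<rho>t s)) / 2 \<le> Q" by simp
    have zi: "(\<lambda>s. wsq (\<rho>t s)) integrable_on {t0..t}" by (rule integrable_continuous_real[OF zc])
    have "integral {\<tau>0..t} (\<lambda>s. wsq (\<rho>t s)) \<le> integral {t0..t} (\<lambda>s. wsq (\<rho>t s))"
      using t0 sub z0 by (intro integral_subset_le zi integrable_on_subinterval[OF zi]) auto
    moreover have "0 \<le> integral {t0..t} (\<lambda>s. wsq (\<rho>t s))"
      using sub z0 by (intro integral_nonneg zi) auto
    ultimately show ?thesis using est Jlo[of t] energy_nonneg_int[OF a, of "G t"] t \<tau>0 by auto
  qed
  show ?thesis
  proof (rule that[of "4 * (Q + c')"])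
    show "0 \<le> 4 * (Q + c')" using Q c' by simp
    fix a \<rho> G \<rho>t Gt t assume "solution a \<rho> G \<rho>t Gt" "t \<in> {\<tau>0..<T}"
    from main[OF this] Q c'
    show "energy a (G t) \<le> 4 * (Q + c')" "integral {\<tau>0..t} (\<lambda>s. wsq (\<rho>t s)) \<le> 4 * (Q + c')"
      by simp_all
  qed
qed

lemma wsq_scale: "wsq (\<lambda>x. c *\<^sub>R u x) = c\<^sup>2 * wsq u"
  by (simp add: wsq_def L2_inner_def power2_eq_square mult_ac)

text \<open>
  Pointwise, Young's inequality applied to \<open>gradient_diff_le\<close>; the growing constant
  \<open>g\<close> there is bounded by the energy density.
\<close>

lemma gradient_increment_L1:
  fixes G1 G2 :: "real^'d \<Rightarrow> real^'d"
  assumes a: "a \<in> coeffs" and G: "in_Lp M 2 G1" "in_Lp M 2 G2" and l: "0 < \<kappa>"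
  shows "(\<integral>x. norm (G1 x - G2 x) \<partial>M)
     \<le> \<kappa> * (1 + \<alpha> N)\<^sup>2 * L2_inner M (\<lambda>x. F a (G1 x) - F a (G2 x)) (\<lambda>x. G1 x - G2 x)
       + (4 * (real N + 1) * \<mu> * vol + energy a G1 + energy a G2) / (2 * \<kappa>)"
proof -
  interpret finite_measure M by (rule M_finite)
  let ?q = "\<lambda>x. (F a (G1 x) - F a (G2 x)) \<bullet> (G1 x - G2 x)"
  let ?e = "\<lambda>x. 4 * (real N + 1) * \<mu> + F a (G1 x) \<bullet> G1 x + F a (G2 x) \<bullet> G2 x"
  note L = flux_L2[OF a G(1)] flux_L2[OF a G(2)]
  have iq: "integrable M ?q" by (rule L2_integrable_inner[OF in_L2_diff[OF L] in_L2_diff[OF G]])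
  have ie: "integrable M ?e" using L2_integrable_inner[OF L(1) G(1)] L2_integrable_inner[OF L(2) G(2)] by simp
  have pw: "norm (G1 x - G2 x) \<le> \<kappa> * (1 + \<alpha> N)\<^sup>2 * ?q x + ?e x / (2 * \<kappa>)" for x
  proof -
    let ?g1 = "g (norm (F a (G1 x))) a" and ?g2 = "g (norm (F a (G2 x))) a"
    define k where "k = ?g1 + ?g2"
    have k: "0 < k" unfolding k_def using g_pos[OF a] by (intro add_pos_pos) auto
    have ke: "k \<le> ?e x" using g_le_energy[OF a, of "G1 x"] g_le_energy[OF a, of "G2 x"] by (simp add: k_def algebra_simps)
    let ?n = "norm (G1 x - G2 x)"
    have "0 \<le> (\<kappa> * ?n - k)\<^sup>2 / (2 * \<kappa> * k)" using k l by simp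
    also have "\<dots> = \<kappa> * ?n\<^sup>2 / (2 * k) + k / (2 * \<kappa>) - ?n"
      using k l by (simp add: power2_eq_square field_simps)
    finally have "?n \<le> \<kappa> * ?n\<^sup>2 / (2 * k) + k / (2 * \<kappa>)" by simp
    also have "\<dots> \<le> \<kappa> * (2 * (1 + \<alpha> N)\<^sup>2 * k * ?q x) / (2 * k) + ?e x / (2 * \<kappa>)"
      using gradient_diff_le[OF a, of "G1 x" "G2 x"] ke k l
      by (intro add_mono divide_right_mono mult_left_mono) (auto simp: k_def)
    also have "\<kappa> * (2 * (1 + \<alpha> N)\<^sup>2 * k * ?q x) / (2 * k) = \<kappa> * (1 + \<alpha> N)\<^sup>2 * ?q x"
      using k by simp
    finally show ?thesis .
  qed
  have "(\<integral>x. norm (G1 x - G2 x) \<partial>M) \<le> (\<integral>x. \<kappa> * (1 + \<alpha> N)\<^sup>2 * ?q x + ?e x / (2 * \<kappa>) \<partial>M)"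
    using iq ie L1_le_L2(1)[OF M_finite in_L2_diff[OF G]] by (intro integral_mono pw) auto
  also have "\<dots> = \<kappa> * (1 + \<alpha> N)\<^sup>2 * (\<integral>x. ?q x \<partial>M) + (\<integral>x. ?e x \<partial>M) / (2 * \<kappa>)"
    using iq ie by simp
  also have "(\<integral>x. ?e x \<partial>M) = 4 * (real N + 1) * \<mu> * vol + energy a G1 + energy a G2"
    using L2_integrable_inner[OF L(1) G(1)] L2_integrable_inner[OF L(2) G(2)]
    by (simp add: energy_def L2_inner_def)
  finally show ?thesis by (simp add: L2_inner_def)
qed

end

context flow
begin

text \<open>
  The equation at time \<open>s + h\<close> minus the equation at time \<open>s\<close>, tested with
  \<open>\<rho>(s + h) - \<rho>(s)\<close>. The boundary data change by \<open>O(h)\<close>, and their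
  pairing with the trace of the increment is absorbed by the monotone term through
  \<open>gradient_increment_L1\<close>, leaving \<open>O(h\<^sup>2)\<close>. The bound \<open>E\<close>
  on the energy makes that remainder uniform.
\<close>

lemma increment_estimate:
  assumes sol: "solution a \<rho> G \<rho>t Gt" and t1: "0 < t1" "t1 \<le> t" and h: "0 < h" "t + h < T"
    and E: "\<And>s. s \<in> {t1..<T} \<Longrightarrow> energy a (G s) \<le> E" and E0: "0 \<le> E"
  shows "wsq (\<lambda>x. \<rho> (t + h) x - \<rho> t x)
    \<le> exp ((1 + \<Psi> * Ct) / \<phi>l * T) * (wsq (\<lambda>x. \<rho> (t1 + h) x - \<rho> t1 x)
        + h\<^sup>2 * (Kf + (\<Psi> * Ct * vol + (1 + \<alpha> N)\<^sup>2 * (\<Psi> * Ct + 1)\<^sup>2 * (4 * (real N + 1) * \<mu> * vol + 2 * E)) * T))"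
proof -
  note a = solutionD(1)[OF sol] and c = solutionD(2)[OF sol]
  note D = C1_time_H1D[OF c]
  define k where "k = \<Psi> * Ct"
  define q where "q = (1 + \<alpha> N)\<^sup>2"
  define Z where "Z = 4 * (real N + 1) * \<mu> * vol + 2 * E"
  define A where "A = (1 + k) / \<phi>l"
  define K where "K = k * vol + q * (k + 1)\<^sup>2 * Z"
  have k: "0 \<le> k" using \<Psi> Ct by (simp add: k_def)
  have q: "0 < q" using exp_N_pos by (simp add: q_def)
  have Z: "0 \<le> Z" using up_pos vol_nonneg E0 unfolding Z_def by (intro add_nonneg_nonneg mult_nonneg_nonneg) auto
  have A: "0 \<le> A" using k phi_bounds(1) by (simp add: A_def)
  have K: "0 \<le> K" using k q Z vol_nonneg by (simp add: K_def)
  define W where "W s = (\<lambda>x. \<rho> (s + h) x - \<rho> s x)" for s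
  define GW where "GW s = (\<lambda>x. G (s + h) x - G s x)" for s
  define Wt where "Wt s = (\<lambda>x. \<rho>t (s + h) x - \<rho>t s x)" for s
  have inT: "s \<in> {0<..<T}" "s + h \<in> {0<..<T}" if "s \<in> {t1..t}" for s using that t1 h by auto
  have dW: "((\<lambda>s. wsq (W s)) has_real_derivative 2 * L2_inner M (\<lambda>x. \<phi> x * Wt s x) (W s)) (at s)"
    if s: "s \<in> {t1..t}" for s
  proof (rule wsq_has_derivative)
    note i = inT[OF s]
    have "filterlim (\<lambda>s. s + h) (at (s + h)) (at s)"
      by (intro filterlim_atI tendsto_intros) (auto simp: eventually_at_filter)
    from eventually_compose_filterlim[OF solution_ev(1)[OF c i(2)] this]
    have ev: "eventually (\<lambda>s. in_Lp M 2 (\<rho> (s + h))) (at s)" .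
    show "has_L2_derivative M W (Wt s) s"
      unfolding W_def[abs_def] Wt_def
      by (rule has_L2_derivative_diff[OF has_L2_derivative_shift[OF D(3)[OF i(2)]] D(3)[OF i(1)]
            ev solution_ev(1)[OF c i(1)] D(7)[OF i(2)] D(7)[OF i(1)] D(9)[OF i(2)] D(9)[OF i(1)]])
    show "eventually (\<lambda>s. in_Lp M 2 (W s)) (at s)"
      using ev solution_ev(1)[OF c i(1)] unfolding W_def by eventually_elim (rule in_L2_diff)
    show "in_Lp M 2 (W s)" unfolding W_def by (rule in_L2_diff[OF D(7)[OF i(2)] D(7)[OF i(1)]])
    show "in_Lp M 2 (Wt s)" unfolding Wt_def by (rule in_L2_diff[OF D(9)[OF i(2)] D(9)[OF i(1)]])
  qed
  let ?df = "\<lambda>s. indicator {0<..<T - h} s *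
         L2_inner M (\<lambda>x. f0 (s + h) x - f0 s x) (\<lambda>x. f0 (s + h) x - f0 s x)"
  let ?b = "\<lambda>s. ?df s + h\<^sup>2 * K * indicator {0..T} s"
  have iT: "integrable lborel (indicator {0..T} :: real \<Rightarrow> real)"
    by (intro integrable_real_indicator emeasure_bounded_finite) auto
  note idf = source_diff_integrable[OF less_imp_le[OF h(1)]]
  have "wsq (W t) + integral {t1..t} (\<lambda>_. 0) \<le> exp (A * (t - t1)) * (wsq (W t1) + integral\<^sup>L lborel ?b)"
  proof (rule gronwall[OF t1(2) A dW])
    show "integrable lborel ?b" using idf iT by simp
    show "0 \<le> ?b s" for s using K by (simp add: L2_inner_self_nonneg)
    show "AE s in lborel. s \<in> {t1..t} \<longrightarrow> 2 * L2_inner M (\<lambda>x. \<phi> x * Wt s x) (W s) + 0 \<le> A * wsq (W s) + ?b s"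
      using solutionD(4)[OF sol] AE_lborel_translate[OF solutionD(4)[OF sol], of h]
        source_L2 AE_lborel_translate[OF source_L2, of h]
    proof eventually_elim
      case (elim s)
      show ?case
      proof
        assume st: "s \<in> {t1..t}"
        note i = inT[OF st]
        have so: "sobolev U 2 (W s) (GW s)"
          unfolding W_def GW_def by (rule sobolev_diff[OF U D(1)[OF i(2)] D(1)[OF i(1)]])
        have L: "in_Lp M 2 (W s)" "in_Lp M 2 (GW s)" using so by (auto simp: sobolev_def)
        let ?F1 = "\<lambda>x. F a (G (s + h) x)" and ?F2 = "\<lambda>x. F a (G s x)"
        let ?fd = "\<lambda>x. f0 (s + h) x - f0 s x" and ?pd = "\<lambda>x. \<psi> (s + h) x - \<psi> s x"
        note LF = flux_L2[OF a D(8)[OF i(2)]] flux_L2[OF a D(8)[OF i(1)]]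
        have Lf: "in_Lp M 2 (f0 (s + h))" "in_Lp M 2 (f0 s)" using elim(3,4) i by auto
        have e1: "L2_inner M (\<lambda>x. \<phi> x * \<rho>t (s + h) x) (W s) + L2_inner M ?F1 (GW s)
            = L2_inner M (f0 (s + h)) (W s) - L2_inner S (\<psi> (s + h)) (tr (W s))"
          using elim(2) i so by blast
        have e2: "L2_inner M (\<lambda>x. \<phi> x * \<rho>t s x) (W s) + L2_inner M ?F2 (GW s)
            = L2_inner M (f0 s) (W s) - L2_inner S (\<psi> s) (tr (W s))"
          using elim(1) i so by blast
        have d1: "L2_inner M (\<lambda>x. \<phi> x * Wt s x) (W s)
            = L2_inner M (\<lambda>x. \<phi> x * \<rho>t (s + h) x) (W s) - L2_inner M (\<lambda>x. \<phi> x * \<rho>t s x) (W s)"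
          unfolding Wt_def right_diff_distrib
          by (rule L2_inner_diff_left[OF phi_L2[OF D(9)[OF i(2)]] phi_L2[OF D(9)[OF i(1)]] L(1)])
        define Q where "Q = L2_inner M (\<lambda>x. ?F1 x - ?F2 x) (GW s)"
        have d2: "Q = L2_inner M ?F1 (GW s) - L2_inner M ?F2 (GW s)"
          unfolding Q_def by (rule L2_inner_diff_left[OF LF L(2)])
        have d3: "L2_inner M ?fd (W s) = L2_inner M (f0 (s + h)) (W s) - L2_inner M (f0 s) (W s)"
          by (rule L2_inner_diff_left[OF Lf L(1)])
        have tri: "integrable S (tr (W s))" by (rule trace_integrable[OF so])
        have d4: "L2_inner S ?pd (tr (W s)) = L2_inner S (\<psi> (s + h)) (tr (W s)) - L2_inner S (\<psi> s) (tr (W s))"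
          using boundary_pairing(1)[OF psi_measurable(1)[OF i(2)] psi_bound(1)[OF i(2)] tri]
            boundary_pairing(1)[OF psi_measurable(1)[OF i(1)] psi_bound(1)[OF i(1)] tri]
          by (simp add: L2_inner_def left_diff_distrib)
        have "2 * L2_inner M (\<lambda>x. \<phi> x * Wt s x) (W s) = 2 * (L2_inner M ?fd (W s) - Q - L2_inner S ?pd (tr (W s)))"
          using e1 e2 unfolding d1 d2 d3 d4 by simp
        moreover have "\<bar>L2_inner M ?fd (W s)\<bar> \<le> ?df s / 2 + L2_inner M (W s) (W s) / 2"
          using L2_young[OF in_L2_diff[OF Lf] L(1), of 1] i h by simp
        moreover have "\<bar>L2_inner S ?pd (tr (W s))\<bar> \<le> Q + k * L2_inner M (W s) (W s) / 2 + h\<^sup>2 * K / 2"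
        proof -
          have "\<bar>L2_inner S ?pd (tr (W s))\<bar> \<le> (\<Psi> * h) * Ct * ((\<integral>x. \<bar>W s x\<bar> \<partial>M) + (\<integral>x. norm (GW s x) \<partial>M))"
          proof (rule boundary_bound[OF so])
            show "?pd \<in> borel_measurable S" using psi_measurable(1)[OF i(1)] psi_measurable(1)[OF i(2)] by simp
            show "\<bar>?pd x\<bar> \<le> \<Psi> * h" if "x \<in> frontier U" for x using psi_lipschitz[OF i(2,1) that] h by simp
          qed (use \<Psi> h in simp)
          then have 1: "\<bar>L2_inner S ?pd (tr (W s))\<bar> \<le> k * (h * (\<integral>x. \<bar>W s x\<bar> \<partial>M)) + k * (h * (\<integral>x. norm (GW s x) \<partial>M))"
            by (simp add: k_def algebra_simps)
          \<comment> \<open>The increment is scaled by \<open>1/h\<close> so that the constant in \<open>L1_le_L2\<close> turns into \<open>h\<^sup>2\<close>.\<close>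
          have "(\<integral>x. norm (inverse h *\<^sub>R W s x) \<partial>M)
              \<le> (vol + L2_inner M (\<lambda>x. inverse h *\<^sub>R W s x) (\<lambda>x. inverse h *\<^sub>R W s x)) / 2"
            by (rule L1_le_L2(2)[OF M_finite in_L2_scale[OF L(1)]])
          moreover have "(\<integral>x. norm (inverse h *\<^sub>R W s x) \<partial>M) = (\<integral>x. \<bar>W s x\<bar> \<partial>M) / h"
          proof -
            have "norm (inverse h *\<^sub>R W s x) = inverse h * \<bar>W s x\<bar>" for x using h by (simp add: abs_mult)
            then show ?thesis by (simp only: integral_mult_right_zero divide_inverse mult.commute)
          qed
          moreover have "L2_inner M (\<lambda>x. inverse h *\<^sub>R W s x) (\<lambda>x. inverse h *\<^sub>R W s x) = L2_inner M (W s) (W s) / h\<^sup>2"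
            unfolding L2_inner_scale_left L2_inner_scale_right by (simp only: divide_inverse power2_eq_square inverse_mult_distrib mult_ac)
          ultimately have "(\<integral>x. \<bar>W s x\<bar> \<partial>M) / h \<le> (vol + L2_inner M (W s) (W s) / h\<^sup>2) / 2"
            by (simp only:)
          then have "h\<^sup>2 * ((\<integral>x. \<bar>W s x\<bar> \<partial>M) / h) \<le> h\<^sup>2 * ((vol + L2_inner M (W s) (W s) / h\<^sup>2) / 2)"
            by (intro mult_left_mono) auto
          moreover have "h\<^sup>2 * ((\<integral>x. \<bar>W s x\<bar> \<partial>M) / h) = h * (\<integral>x. \<bar>W s x\<bar> \<partial>M)"
            using h by (simp add: power2_eq_square)
          moreover have "h\<^sup>2 * ((vol + L2_inner M (W s) (W s) / h\<^sup>2) / 2) = (h\<^sup>2 * vol + L2_inner M (W s) (W s)) / 2"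
            using h by (simp add: distrib_left)
          ultimately have "h * (\<integral>x. \<bar>W s x\<bar> \<partial>M) \<le> (h\<^sup>2 * vol + L2_inner M (W s) (W s)) / 2"
            by (simp only:)
          then have 2: "k * (h * (\<integral>x. \<bar>W s x\<bar> \<partial>M)) \<le> k * ((h\<^sup>2 * vol + L2_inner M (W s) (W s)) / 2)"
            using k by (intro mult_left_mono) auto
          \<comment> \<open>With this parameter the monotone term \<open>Q\<close> receives the coefficient \<open>1\<close>, and the remainder a factor \<open>h\<^sup>2\<close>.\<close>
          define l where "l = 1 / (q * (k + 1)) / h"
          have l: "0 < l" using q k h by (simp add: l_def)
          have Q0: "0 \<le> Q" unfolding Q_def GW_def L2_inner_def
            by (intro integral_nonneg_AE AE_I2 flux_monotone[OF a])
          have "(\<integral>x. norm (GW s x) \<partial>M) \<le> l * q * Q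
             + (4 * (real N + 1) * \<mu> * vol + energy a (G (s + h)) + energy a (G s)) / (2 * l)"
            using gradient_increment_L1[OF a D(8)[OF i(2)] D(8)[OF i(1)] l] by (simp add: GW_def Q_def q_def)
          also have "\<dots> \<le> l * q * Q + Z / (2 * l)"
            using E[of s] E[of "s + h"] st i h l unfolding Z_def by (intro add_left_mono divide_right_mono) auto
          finally have "k * (h * (\<integral>x. norm (GW s x) \<partial>M)) \<le> (k + 1) * (h * (l * q * Q + Z / (2 * l)))"
            using k h l q Q0 Z by (intro mult_mono mult_left_mono) (auto simp: integral_nonneg_AE)
          also have "\<dots> = Q + h\<^sup>2 * (q * (k + 1)\<^sup>2 * Z) / 2"
          proof -
            have "(k + 1) * (h * (l * q * Q)) = Q" using k q h by (simp add: l_def)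
            moreover have "(k + 1) * (h * (Z / (2 * l))) = h\<^sup>2 * (q * (k + 1)\<^sup>2 * Z) / 2"
              using k q h by (simp add: l_def power2_eq_square)
            ultimately show ?thesis by (simp only: distrib_left)
          qed
          finally have 3: "k * (h * (\<integral>x. norm (GW s x) \<partial>M)) \<le> Q + h\<^sup>2 * (q * (k + 1)\<^sup>2 * Z) / 2" .
          have "k * ((h\<^sup>2 * vol + L2_inner M (W s) (W s)) / 2) + h\<^sup>2 * (q * (k + 1)\<^sup>2 * Z) / 2
             = k * L2_inner M (W s) (W s) / 2 + h\<^sup>2 * K / 2"
            by (simp add: K_def algebra_simps add_divide_distrib)
          then show ?thesis using 1 2 3 by linarith
        qed
        moreover have "(1 + k) * L2_inner M (W s) (W s) \<le> A * wsq (W s)"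
          using mult_left_mono[OF L2_le_wsq[OF L(1)], of "1 + k"] k by (simp add: A_def)
        moreover have "(1 + k) * L2_inner M (W s) (W s) = L2_inner M (W s) (W s) + k * L2_inner M (W s) (W s)"
          by (simp add: algebra_simps)
        moreover have "(indicator {0..T} s :: real) = 1" using i by simp
        ultimately show "2 * L2_inner M (\<lambda>x. \<phi> x * Wt s x) (W s) + 0 \<le> A * wsq (W s) + ?b s"
          by simp
      qed
    qed
  qed auto
  also have "exp (A * (t - t1)) * (wsq (W t1) + integral\<^sup>L lborel ?b) \<le> exp (A * T) * (wsq (W t1) + h\<^sup>2 * (Kf + K * T))"
  proof (rule exp_mult_le[OF A])
    have w0: "0 \<le> wsq (W t1)" unfolding W_def
      using inT[of t1] t1 by (intro wsq_nonneg in_L2_diff D) auto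
    have "integral\<^sup>L lborel ?b = integral\<^sup>L lborel ?df + h\<^sup>2 * K * T" using idf iT T_pos by simp
    then show "wsq (W t1) + integral\<^sup>L lborel ?b \<le> wsq (W t1) + h\<^sup>2 * (Kf + K * T)"
      using source_diff[OF less_imp_le[OF h(1)]] by (simp add: algebra_simps)
    show "0 \<le> wsq (W t1) + h\<^sup>2 * (Kf + K * T)" using w0 Kf K T_pos by simp
  qed (use t1 h in auto)
  finally show ?thesis by (simp add: W_def A_def K_def Z_def q_def k_def)
qed

lemma increment_quotient_tendsto:
  assumes c: "C1_time_H1 U T \<rho> G \<rho>t Gt" and t: "t \<in> {0<..<T}"
  shows "((\<lambda>h. wsq (\<lambda>x. \<rho> (t + h) x - \<rho> t x) / h\<^sup>2) \<longlongrightarrow> wsq (\<rho>t t)) (at_right 0)"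
proof -
  note D = C1_time_H1D[OF c t]
  have "((\<lambda>s. wsq (\<lambda>x. (\<rho> s x - \<rho> t x) /\<^sub>R (s - t))) \<longlongrightarrow> wsq (\<rho>t t)) (at t)"
    by (rule wsq_tendsto[OF _ eventually_in_L2_quotient[OF solution_ev(1)[OF c t] D(7)] D(9)])
       (use D(3) in \<open>simp add: has_L2_derivative_def\<close>)
  moreover have "filterlim (\<lambda>h. t + h) (at t) (at_right 0)"
  proof (rule filterlim_atI)
    show "((\<lambda>h. t + h) \<longlongrightarrow> t) (at_right 0)" by (auto intro!: tendsto_eq_intros)
    show "eventually (\<lambda>h. t + h \<noteq> t) (at_right 0)"
      using eventually_at_right_less[of "0::real"] by eventually_elim auto
  qed
  ultimately have "((\<lambda>h. wsq (\<lambda>x. (\<rho> (t + h) x - \<rho> t x) /\<^sub>R (t + h - t))) \<longlongrightarrow> wsq (\<rho>t t)) (at_right 0)"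
    by (rule filterlim_compose)
  then show ?thesis unfolding wsq_scale by (simp add: power_inverse divide_inverse mult.commute)
qed

text \<open>
  The increment estimate divided by \<open>h\<^sup>2\<close>, in the limit \<open>h \<rightarrow>
  0\<close>. The starting time is one at which
  \<open>\<parallel>\<rho>\<^sub>t\<parallel>\<^sup>2\<close> does not exceed its average, which
  \<open>smoothing_estimate\<close> bounds.
\<close>

lemma time_derivative_estimate:
  assumes \<tau>0: "0 < \<tau>0" "\<tau>0 < T"
  obtains C where "0 \<le> C"
    "\<And>a \<rho> G \<rho>t Gt t. solution a \<rho> G \<rho>t Gt \<Longrightarrow> t \<in> {\<tau>0..<T} \<Longrightarrow> wsq (\<rho>t t) \<le> C"
    "\<And>a \<rho> G \<rho>t Gt t. solution a \<rho> G \<rho>t Gt \<Longrightarrow> t \<in> {\<tau>0..<T} \<Longrightarrow> energy a (G t) \<le> C"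
proof -
  obtain E where E: "0 \<le> E"
    "\<And>a \<rho> G \<rho>t Gt t. solution a \<rho> G \<rho>t Gt \<Longrightarrow> t \<in> {\<tau>0/2..<T} \<Longrightarrow> energy a (G t) \<le> E"
    "\<And>a \<rho> G \<rho>t Gt t. solution a \<rho> G \<rho>t Gt \<Longrightarrow> t \<in> {\<tau>0/2..<T} \<Longrightarrow>
       integral {\<tau>0/2..t} (\<lambda>s. wsq (\<rho>t s)) \<le> E"
    by (rule smoothing_estimate[of "\<tau>0/2"]) (use \<tau>0 in auto)
  define X where "X = exp ((1 + \<Psi> * Ct) / \<phi>l * T)"
  define Y where "Y = Kf + (\<Psi> * Ct * vol + (1 + \<alpha> N)\<^sup>2 * (\<Psi> * Ct + 1)\<^sup>2 * (4 * (real N + 1) * \<mu> * vol + 2 * E)) * T"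
  define z0 where "z0 = (E + 1) / (\<tau>0 - \<tau>0 / 2)"
  have Y: "0 \<le> Y" unfolding Y_def using Kf \<Psi> Ct vol_nonneg up_pos E(1) T_pos
    by (intro add_nonneg_nonneg mult_nonneg_nonneg) auto
  have z0: "0 \<le> z0" using E(1) \<tau>0 by (simp add: z0_def)
  have bound: "wsq (\<rho>t t) \<le> X * (z0 + Y)" if sol: "solution a \<rho> G \<rho>t Gt" and t: "t \<in> {\<tau>0..<T}" for a \<rho> G \<rho>t Gt t
  proof -
    note c = solutionD(2)[OF sol]
    have cz: "continuous_on {\<tau>0 / 2..\<tau>0} (\<lambda>\<tau>. wsq (\<rho>t \<tau>))"
      by (rule continuous_on_subset[OF wsq_rhot_continuous[OF c]]) (use \<tau>0 in auto)
    obtain t1 where t1: "t1 \<in> {\<tau>0 / 2..\<tau>0}" "wsq (\<rho>t t1) \<le> z0"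
      using exists_le_average[OF _ cz, of E] E(3)[OF sol, of \<tau>0] \<tau>0 unfolding z0_def by auto
    have t1T: "t1 \<in> {0<..<T}" and tT: "t \<in> {0<..<T}" using t1 t \<tau>0 by auto
    have "eventually (\<lambda>h. wsq (\<lambda>x. \<rho> (t + h) x - \<rho> t x) / h\<^sup>2
        \<le> X * (wsq (\<lambda>x. \<rho> (t1 + h) x - \<rho> t1 x) / h\<^sup>2 + Y)) (at_right 0)"
      using eventually_at_right_real[of 0 "T - t"]
    proof (rule eventually_mono)
      fix h assume h: "h \<in> {0<..<T - t}"
      have "wsq (\<lambda>x. \<rho> (t + h) x - \<rho> t x) \<le> X * (wsq (\<lambda>x. \<rho> (t1 + h) x - \<rho> t1 x) + h\<^sup>2 * Y)"
        unfolding X_def Y_def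
        by (rule increment_estimate[OF sol]) (use t1 t \<tau>0 h E(1) E(2)[OF sol] in auto)
      then have "wsq (\<lambda>x. \<rho> (t + h) x - \<rho> t x) / h\<^sup>2 \<le> X * (wsq (\<lambda>x. \<rho> (t1 + h) x - \<rho> t1 x) + h\<^sup>2 * Y) / h\<^sup>2"
        by (intro divide_right_mono) auto
      then show "wsq (\<lambda>x. \<rho> (t + h) x - \<rho> t x) / h\<^sup>2 \<le> X * (wsq (\<lambda>x. \<rho> (t1 + h) x - \<rho> t1 x) / h\<^sup>2 + Y)"
        using h by (simp add: algebra_simps add_divide_distrib)
    qed (use t in auto)
    moreover have "((\<lambda>h. X * (wsq (\<lambda>x. \<rho> (t1 + h) x - \<rho> t1 x) / h\<^sup>2 + Y)) \<longlongrightarrow> X * (wsq (\<rho>t t1) + Y)) (at_right 0)"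
      by (intro tendsto_intros increment_quotient_tendsto[OF c t1T])
    ultimately have "wsq (\<rho>t t) \<le> X * (wsq (\<rho>t t1) + Y)"
      by (intro tendsto_le[OF _ _ increment_quotient_tendsto[OF c tT]]) auto
    also have "\<dots> \<le> X * (z0 + Y)" using t1(2) by (intro mult_left_mono) (auto simp: X_def)
    finally show ?thesis .
  qed
  show ?thesis
  proof (rule that[of "X * (z0 + Y) + E"])
    have "0 \<le> X * (z0 + Y)" using z0 Y by (simp add: X_def)
    then show "0 \<le> X * (z0 + Y) + E" using E(1) by simp
    fix a \<rho> G \<rho>t Gt t assume sol: "solution a \<rho> G \<rho>t Gt" and t: "t \<in> {\<tau>0..<T}"
    show "wsq (\<rho>t t) \<le> X * (z0 + Y) + E" using bound[OF sol t] E(1) by simp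
    show "energy a (G t) \<le> X * (z0 + Y) + E"
      using E(2)[OF sol, of t] t \<tau>0 \<open>0 \<le> X * (z0 + Y)\<close> by auto
  qed
qed

section \<open>Comparison of two solutions\<close>

lemma flux_difference_estimate:
  fixes G1 G2 :: "real^'d \<Rightarrow> real^'d"
  assumes a: "a \<in> coeffs" and b: "b \<in> coeffs" and G: "in_Lp M 2 G1" "in_Lp M 2 G2"
  shows "\<delta> / 2 * L2_inner M (\<lambda>x. F a (G1 x) - F b (G2 x)) (\<lambda>x. F a (G1 x) - F b (G2 x))
           - (real N + 1)\<^sup>2 / (2 * \<delta>\<^sup>2) * (coeff_dist N a b)\<^sup>2 * energy b G2
         \<le> L2_inner M (\<lambda>x. F a (G1 x) - F b (G2 x)) (\<lambda>x. G1 x - G2 x)"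
proof -
  note L = flux_L2[OF a G(1)] flux_L2[OF b G(2)]
  note Ld = in_L2_diff[OF L]
  let ?k = "(real N + 1)\<^sup>2 / (2 * \<delta>\<^sup>2) * (coeff_dist N a b)\<^sup>2"
  note i = L2_integrable_inner[OF Ld Ld] L2_integrable_inner[OF L(2) G(2)]
  have "\<delta> / 2 * L2_inner M (\<lambda>x. F a (G1 x) - F b (G2 x)) (\<lambda>x. F a (G1 x) - F b (G2 x)) - ?k * energy b G2
     = (\<integral>x. \<delta> / 2 * ((F a (G1 x) - F b (G2 x)) \<bullet> (F a (G1 x) - F b (G2 x))) - ?k * (F b (G2 x) \<bullet> G2 x) \<partial>M)"
    unfolding L2_inner_def energy_def
    by (subst Bochner_Integration.integral_diff) (use i in auto)
  also have "\<dots> \<le> L2_inner M (\<lambda>x. F a (G1 x) - F b (G2 x)) (\<lambda>x. G1 x - G2 x)"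
    unfolding L2_inner_def
  proof (rule integral_mono)
    show "integrable M (\<lambda>x. \<delta> / 2 * ((F a (G1 x) - F b (G2 x)) \<bullet> (F a (G1 x) - F b (G2 x))) - ?k * (F b (G2 x) \<bullet> G2 x))"
      using i by (intro Bochner_Integration.integrable_diff integrable_mult_right) auto
    show "integrable M (\<lambda>x. (F a (G1 x) - F b (G2 x)) \<bullet> (G1 x - G2 x))"
      by (rule L2_integrable_inner[OF Ld in_L2_diff[OF G]])
    show "\<delta> / 2 * ((F a (G1 x) - F b (G2 x)) \<bullet> (F a (G1 x) - F b (G2 x))) - ?k * (F b (G2 x) \<bullet> G2 x)
        \<le> (F a (G1 x) - F b (G2 x)) \<bullet> (G1 x - G2 x)" for x
      using flux_monotone_coeffs[OF a b, of "G1 x" "G2 x"] by (simp add: power2_norm_eq_inner)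
  qed
  finally show ?thesis .
qed

text \<open>
  The source and the boundary term are the same for both solutions and cancel.
\<close>

lemma difference_equation:
  assumes s1: "solution a \<rho>1 G1 \<rho>t1 Gt1" and s2: "solution b \<rho>2 G2 \<rho>t2 Gt2"
  shows "AE t in lborel. t \<in> {0<..<T} \<longrightarrow>
     L2_inner M (\<lambda>x. \<phi> x * (\<rho>t1 t x - \<rho>t2 t x)) (\<lambda>x. \<rho>1 t x - \<rho>2 t x)
     + L2_inner M (\<lambda>x. F a (G1 t x) - F b (G2 t x)) (\<lambda>x. G1 t x - G2 t x) = 0"
  using solutionD(4)[OF s1] solutionD(4)[OF s2]
proof eventually_elim
  case (elim t)
  show ?case
  proof
    assume t: "t \<in> {0<..<T}"
    note D1 = C1_time_H1D[OF solutionD(2)[OF s1] t] and D2 = C1_time_H1D[OF solutionD(2)[OF s2] t]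
    let ?r = "\<lambda>x. \<rho>1 t x - \<rho>2 t x" and ?Gr = "\<lambda>x. G1 t x - G2 t x"
    have so: "sobolev U 2 ?r ?Gr" by (rule sobolev_diff[OF U D1(1) D2(1)])
    have L: "in_Lp M 2 ?r" "in_Lp M 2 ?Gr" using so by (auto simp: sobolev_def)
    have "L2_inner M (\<lambda>x. \<phi> x * (\<rho>t1 t x - \<rho>t2 t x)) ?r
        = L2_inner M (\<lambda>x. \<phi> x * \<rho>t1 t x) ?r - L2_inner M (\<lambda>x. \<phi> x * \<rho>t2 t x) ?r"
      unfolding right_diff_distrib by (rule L2_inner_diff_left[OF phi_L2[OF D1(9)] phi_L2[OF D2(9)] L(1)])
    moreover have "L2_inner M (\<lambda>x. F a (G1 t x) - F b (G2 t x)) ?Gr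
        = L2_inner M (\<lambda>x. F a (G1 t x)) ?Gr - L2_inner M (\<lambda>x. F b (G2 t x)) ?Gr"
      by (rule L2_inner_diff_left[OF flux_L2[OF solutionD(1)[OF s1] D1(8)] flux_L2[OF solutionD(1)[OF s2] D2(8)] L(2)])
    moreover have "L2_inner M (\<lambda>x. \<phi> x * \<rho>t1 t x) ?r + L2_inner M (\<lambda>x. F a (G1 t x)) ?Gr
       = L2_inner M (\<lambda>x. \<phi> x * \<rho>t2 t x) ?r + L2_inner M (\<lambda>x. F b (G2 t x)) ?Gr"
      using elim(1)[rule_format, OF t so] elim(2)[rule_format, OF t so] by simp
    ultimately show "L2_inner M (\<lambda>x. \<phi> x * (\<rho>t1 t x - \<rho>t2 t x)) ?r
        + L2_inner M (\<lambda>x. F a (G1 t x) - F b (G2 t x)) ?Gr = 0" by simp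
  qed
qed

text \<open>
  Gronwall with zero growth rate: the two solutions start from the same datum, and the source of the
  inequality is \<open>|a - b|\<^sup>2\<close> times the energy of the second solution, which is
  integrable in time.
\<close>

lemma density_comparison:
  obtains C where "0 \<le> C"
    "\<And>a \<rho>1 G1 \<rho>t1 Gt1 b \<rho>2 G2 \<rho>t2 Gt2 t. solution a \<rho>1 G1 \<rho>t1 Gt1 \<Longrightarrow> solution b \<rho>2 G2 \<rho>t2 Gt2 \<Longrightarrow>
       t \<in> {0<..<T} \<Longrightarrow> Lp_norm M 2 (\<lambda>x. \<rho>1 t x - \<rho>2 t x) \<le> C * coeff_dist N a b"
proof -
  obtain C1 where C1: "0 \<le> C1"
    "\<And>a \<rho> G \<rho>t Gt t. solution a \<rho> G \<rho>t Gt \<Longrightarrow> t \<in> {0<..<T} \<Longrightarrow> wsq (\<rho> t) \<le> C1"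
    "\<And>a \<rho> G \<rho>t Gt s t. solution a \<rho> G \<rho>t Gt \<Longrightarrow> 0 < s \<Longrightarrow> s \<le> t \<Longrightarrow> t < T \<Longrightarrow>
       integral {s..t} (\<lambda>\<tau>. energy a (G \<tau>)) \<le> C1"
    by (rule energy_estimate) (rule that)
  define \<kappa> where "\<kappa> = (real N + 1)\<^sup>2 / (2 * \<delta>\<^sup>2)"
  have \<kappa>: "0 \<le> \<kappa>" by (simp add: \<kappa>_def)
  have main: "wsq (\<lambda>x. \<rho>1 t x - \<rho>2 t x) \<le> 2 * \<kappa> * (coeff_dist N a b)\<^sup>2 * C1"
    if s1: "solution a \<rho>1 G1 \<rho>t1 Gt1" and s2: "solution b \<rho>2 G2 \<rho>t2 Gt2" and t: "t \<in> {0<..<T}"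
    for a \<rho>1 G1 \<rho>t1 Gt1 b \<rho>2 G2 \<rho>t2 Gt2 t
  proof -
    note a = solutionD(1)[OF s1] and c1 = solutionD(2)[OF s1]
    note b = solutionD(1)[OF s2] and c2 = solutionD(2)[OF s2]
    note D1 = C1_time_H1D[OF c1] and D2 = C1_time_H1D[OF c2]
    define d where "d = 2 * \<kappa> * (coeff_dist N a b)\<^sup>2"
    have d: "0 \<le> d" using \<kappa> by (simp add: d_def)
    define y where "y s = wsq (\<lambda>x. \<rho>1 s x - \<rho>2 s x)" for s
    have dy: "(y has_real_derivative 2 * L2_inner M (\<lambda>x. \<phi> x * (\<rho>t1 s x - \<rho>t2 s x)) (\<lambda>x. \<rho>1 s x - \<rho>2 s x)) (at s)"
      if s: "s \<in> {0<..<T}" for s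
      unfolding y_def[abs_def]
    proof (rule wsq_has_derivative)
      show "has_L2_derivative M (\<lambda>s x. \<rho>1 s x - \<rho>2 s x) (\<lambda>x. \<rho>t1 s x - \<rho>t2 s x) s"
        by (rule has_L2_derivative_diff[OF D1(3)[OF s] D2(3)[OF s] solution_ev(1)[OF c1 s] solution_ev(1)[OF c2 s]
              D1(7)[OF s] D2(7)[OF s] D1(9)[OF s] D2(9)[OF s]])
      show "eventually (\<lambda>s. in_Lp M 2 (\<lambda>x. \<rho>1 s x - \<rho>2 s x)) (at s)"
        using solution_ev(1)[OF c1 s] solution_ev(1)[OF c2 s] by eventually_elim (rule in_L2_diff)
    qed (intro in_L2_diff D1 D2 s)+
    have ce: "continuous_on {s..t} (\<lambda>\<tau>. energy b (G2 \<tau>))" if "0 < s" for s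
      by (rule continuous_on_subset[OF energy_continuous[OF b c2]]) (use that t in auto)
    have step: "y t \<le> y s + d * C1" if s: "0 < s" "s \<le> t" for s
    proof -
      have ie: "integrable lborel (\<lambda>\<tau>. d * (indicator {s..t} \<tau> *\<^sub>R energy b (G2 \<tau>)))"
        using borel_integrable_compact[OF compact_Icc ce[OF s(1)]] by simp
      have "y t + integral {s..t} (\<lambda>_. 0)
          \<le> exp (0 * (t - s)) * (y s + (\<integral>\<tau>. d * (indicator {s..t} \<tau> *\<^sub>R energy b (G2 \<tau>)) \<partial>lborel))"
      proof (rule gronwall[OF s(2) _ dy _ _ ie])
        show "AE \<tau> in lborel. \<tau> \<in> {s..t} \<longrightarrow>
            2 * L2_inner M (\<lambda>x. \<phi> x * (\<rho>t1 \<tau> x - \<rho>t2 \<tau> x)) (\<lambda>x. \<rho>1 \<tau> x - \<rho>2 \<tau> x) + 0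
            \<le> 0 * y \<tau> + d * (indicator {s..t} \<tau> *\<^sub>R energy b (G2 \<tau>))"
          using difference_equation[OF s1 s2]
        proof eventually_elim
          case (elim \<tau>)
          show ?case
          proof
            assume \<tau>: "\<tau> \<in> {s..t}"
            then have \<tau>T: "\<tau> \<in> {0<..<T}" using s t by auto
            let ?Fd = "\<lambda>x. F a (G1 \<tau> x) - F b (G2 \<tau> x)"
            have "0 \<le> \<delta> / 2 * L2_inner M ?Fd ?Fd" using lo_pos L2_inner_self_nonneg[of M ?Fd] by simp
            then show "2 * L2_inner M (\<lambda>x. \<phi> x * (\<rho>t1 \<tau> x - \<rho>t2 \<tau> x)) (\<lambda>x. \<rho>1 \<tau> x - \<rho>2 \<tau> x) + 0
                \<le> 0 * y \<tau> + d * (indicator {s..t} \<tau> *\<^sub>R energy b (G2 \<tau>))"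
              using flux_difference_estimate[OF a b D1(8)[OF \<tau>T] D2(8)[OF \<tau>T]] elim \<tau> \<tau>T
              by (simp add: d_def \<kappa>_def)
          qed
        qed
        show "0 \<le> d * (indicator {s..t} \<tau> *\<^sub>R energy b (G2 \<tau>))" for \<tau>
          using d energy_nonneg_int[OF b, of "G2 \<tau>"] by simp
      qed (use s t in auto)
      also have "(\<integral>\<tau>. d * (indicator {s..t} \<tau> *\<^sub>R energy b (G2 \<tau>)) \<partial>lborel) = d * integral {s..t} (\<lambda>\<tau>. energy b (G2 \<tau>))"
        using set_borel_integral_eq_integral(2)[of "{s..t}" "\<lambda>\<tau>. energy b (G2 \<tau>)"]
          borel_integrable_compact[OF compact_Icc ce[OF s(1)]]
        by (simp add: set_integrable_def set_lebesgue_integral_def)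
      also have "\<dots> \<le> d * C1" using C1(3)[OF s2 s] t d by (intro mult_left_mono) auto
      finally show ?thesis by simp
    qed
    have ev1: "eventually (\<lambda>s. in_Lp M 2 (\<rho>1 s)) (at_right 0)" "eventually (\<lambda>s. in_Lp M 2 (\<rho>2 s)) (at_right 0)"
      using eventually_at_right_real[OF T_pos] D1(7) D2(7) by (auto elim: eventually_mono)
    have "L2_tendsto M (\<lambda>s x. \<rho>1 s x - \<rho>2 s x) (\<lambda>x. \<rho>0 x - \<rho>0 x) (at_right 0)"
      by (rule L2_tendsto_diff[OF solutionD(3)[OF s1] solutionD(3)[OF s2] ev1 rho0 rho0])
    moreover have "eventually (\<lambda>s. in_Lp M 2 (\<lambda>x. \<rho>1 s x - \<rho>2 s x)) (at_right 0)"
      using ev1 by eventually_elim (rule in_L2_diff)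
    ultimately have "(y \<longlongrightarrow> wsq (\<lambda>x. \<rho>0 x - \<rho>0 x)) (at_right 0)"
      unfolding y_def by (rule wsq_tendsto[OF _ _ in_L2_diff[OF rho0 rho0]])
    then have y0: "(y \<longlongrightarrow> 0) (at_right 0)" by (simp add: wsq_def L2_inner_def)
    have "((\<lambda>s. y s + d * C1) \<longlongrightarrow> 0 + d * C1) (at_right 0)" by (intro tendsto_intros y0)
    moreover have "eventually (\<lambda>s. y t \<le> y s + d * C1) (at_right 0)"
      using eventually_at_right_real[of 0 t] t by (auto elim!: eventually_mono intro: step)
    ultimately have "y t \<le> 0 + d * C1" by (rule tendsto_lowerbound) auto
    then show ?thesis by (simp add: y_def d_def)
  qed
  define C where "C = sqrt (2 * \<kappa> * C1 / \<phi>l)"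
  show ?thesis
  proof (rule that[of C])
    show "0 \<le> C" using \<kappa> C1 phi_bounds(1) by (simp add: C_def)
    fix a \<rho>1 G1 \<rho>t1 Gt1 b \<rho>2 G2 \<rho>t2 Gt2 t
    assume s1: "solution a \<rho>1 G1 \<rho>t1 Gt1" and s2: "solution b \<rho>2 G2 \<rho>t2 Gt2" and t: "t \<in> {0<..<T}"
    let ?r = "\<lambda>x. \<rho>1 t x - \<rho>2 t x"
    have L: "in_Lp M 2 ?r"
      by (intro in_L2_diff C1_time_H1D(7)[OF solutionD(2)[OF s1] t] C1_time_H1D(7)[OF solutionD(2)[OF s2] t])
    have "(Lp_norm M 2 ?r)\<^sup>2 \<le> wsq ?r / \<phi>l" unfolding Lp_norm_2_power2 by (rule L2_le_wsq[OF L])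
    also have "\<dots> \<le> 2 * \<kappa> * (coeff_dist N a b)\<^sup>2 * C1 / \<phi>l"
      using main[OF s1 s2 t] phi_bounds(1) by (intro divide_right_mono) auto
    also have "\<dots> = (C * coeff_dist N a b)\<^sup>2"
      using \<kappa> C1(1) phi_bounds(1) by (simp add: C_def power_mult_distrib)
    finally show "Lp_norm M 2 ?r \<le> C * coeff_dist N a b"
      by (rule power2_le_imp_le) (use \<open>0 \<le> C\<close> coeff_dist_nonneg in simp)
  qed
qed

text \<open>
  The difference equation at a fixed time. The pairing of \<open>\<phi> (\<rho>\<^sub>1\<^sub>t
  - \<rho>\<^sub>2\<^sub>t)\<close> with \<open>\<rho>\<^sub>1 - \<rho>\<^sub>2\<close> is only
  of first order in \<open>|a - b|\<close>, because the time derivatives are merely bounded; this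
  determines the order of the result.
\<close>

lemma flux_comparison:
  assumes \<tau>0: "0 < \<tau>0" "\<tau>0 < T"
  obtains C where "0 \<le> C"
    "\<And>a \<rho>1 G1 \<rho>t1 Gt1 b \<rho>2 G2 \<rho>t2 Gt2. solution a \<rho>1 G1 \<rho>t1 Gt1 \<Longrightarrow> solution b \<rho>2 G2 \<rho>t2 Gt2 \<Longrightarrow>
       AE t in lborel. t \<in> {\<tau>0<..<T} \<longrightarrow>
         L2_inner M (\<lambda>x. F a (G1 t x) - F b (G2 t x)) (\<lambda>x. F a (G1 t x) - F b (G2 t x)) \<le> C * coeff_dist N a b"
proof -
  obtain C1 where C1: "0 \<le> C1"
    "\<And>a \<rho>1 G1 \<rho>t1 Gt1 b \<rho>2 G2 \<rho>t2 Gt2 t. solution a \<rho>1 G1 \<rho>t1 Gt1 \<Longrightarrow> solution b \<rho>2 G2 \<rho>t2 Gt2 \<Longrightarrow>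
       t \<in> {0<..<T} \<Longrightarrow> Lp_norm M 2 (\<lambda>x. \<rho>1 t x - \<rho>2 t x) \<le> C1 * coeff_dist N a b"
    by (rule density_comparison) (rule that)
  obtain C2 where C2: "0 \<le> C2"
    "\<And>a \<rho> G \<rho>t Gt t. solution a \<rho> G \<rho>t Gt \<Longrightarrow> t \<in> {\<tau>0..<T} \<Longrightarrow> wsq (\<rho>t t) \<le> C2"
    "\<And>a \<rho> G \<rho>t Gt t. solution a \<rho> G \<rho>t Gt \<Longrightarrow> t \<in> {\<tau>0..<T} \<Longrightarrow> energy a (G t) \<le> C2"
    by (rule time_derivative_estimate[OF \<tau>0]) (rule that)
  define \<kappa> where "\<kappa> = (real N + 1)\<^sup>2 / (2 * \<delta>\<^sup>2)"
  have \<kappa>: "0 \<le> \<kappa>" by (simp add: \<kappa>_def)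
  define m where "m = sqrt (C2 / \<phi>l)"
  define C where "C = 2 / \<delta> * (\<kappa> * ((real N + 1) * \<mu>) * C2 + \<bar>\<phi>u\<bar> * (2 * m) * C1)"
  have m: "0 \<le> m" using C2 phi_bounds(1) by (simp add: m_def)
  show ?thesis
  proof (rule that[of C])
    show "0 \<le> C" using lo_pos up_pos \<kappa> C1(1) C2(1) m by (simp add: C_def)
    fix a \<rho>1 G1 \<rho>t1 Gt1 b \<rho>2 G2 \<rho>t2 Gt2
    assume s1: "solution a \<rho>1 G1 \<rho>t1 Gt1" and s2: "solution b \<rho>2 G2 \<rho>t2 Gt2"
    note a = solutionD(1)[OF s1] and b = solutionD(1)[OF s2]
    let ?d = "coeff_dist N a b"
    show "AE t in lborel. t \<in> {\<tau>0<..<T} \<longrightarrow>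
         L2_inner M (\<lambda>x. F a (G1 t x) - F b (G2 t x)) (\<lambda>x. F a (G1 t x) - F b (G2 t x)) \<le> C * ?d"
      using difference_equation[OF s1 s2]
    proof eventually_elim
      case (elim t)
      show ?case
      proof
        assume t: "t \<in> {\<tau>0<..<T}"
        then have tT: "t \<in> {0<..<T}" "t \<in> {\<tau>0..<T}" using \<tau>0 by auto
        note D1 = C1_time_H1D[OF solutionD(2)[OF s1] tT(1)] and D2 = C1_time_H1D[OF solutionD(2)[OF s2] tT(1)]
        let ?Fd = "\<lambda>x. F a (G1 t x) - F b (G2 t x)" and ?r = "\<lambda>x. \<rho>1 t x - \<rho>2 t x" and ?rt = "\<lambda>x. \<rho>t1 t x - \<rho>t2 t x"
        have Lt: "in_Lp M 2 ?rt" "in_Lp M 2 ?r" by (intro in_L2_diff D1 D2)+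
        have mb: "Lp_norm M 2 u \<le> m" if "in_Lp M 2 u" "wsq u \<le> C2" for u
        proof (rule power2_le_imp_le[OF _ m])
          have "(Lp_norm M 2 u)\<^sup>2 \<le> wsq u / \<phi>l" unfolding Lp_norm_2_power2 by (rule L2_le_wsq[OF that(1)])
          also have "\<dots> \<le> C2 / \<phi>l" using that(2) phi_bounds(1) by (intro divide_right_mono) auto
          also have "\<dots> = m\<^sup>2" using C2(1) phi_bounds(1) by (simp add: m_def)
          finally show "(Lp_norm M 2 u)\<^sup>2 \<le> m\<^sup>2" .
        qed
        have "Lp_norm M 2 ?rt \<le> Lp_norm M 2 (\<rho>t1 t) + Lp_norm M 2 (\<rho>t2 t)"
          using Lp_norm_2_triangle[OF D1(9) in_L2_scale[OF D2(9), of "-1"]] Lp_norm_2_scale[of M "-1" "\<rho>t2 t"]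
          by simp
        also have "\<dots> \<le> 2 * m" using mb[OF D1(9) C2(2)[OF s1 tT(2)]] mb[OF D2(9) C2(2)[OF s2 tT(2)]] by simp
        finally have rt: "Lp_norm M 2 ?rt \<le> 2 * m" .
        have "\<bar>L2_inner M (\<lambda>x. \<phi> x * ?rt x) ?r\<bar> \<le> Lp_norm M 2 (\<lambda>x. \<phi> x * ?rt x) * Lp_norm M 2 ?r"
          by (rule L2_Cauchy_Schwarz[OF phi_L2[OF Lt(1)] Lt(2)])
        also have "\<dots> \<le> (\<bar>\<phi>u\<bar> * (2 * m)) * (C1 * ?d)"
        proof (intro mult_mono C1(2)[OF s1 s2 tT(1)])
          have "Lp_norm M 2 (\<lambda>x. \<phi> x * ?rt x) \<le> \<bar>\<phi>u\<bar> * Lp_norm M 2 ?rt"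
          proof (rule Lp_norm_2_mono[OF Lt(1) in_L2_measurable[OF phi_L2[OF Lt(1)]]])
            show "norm (\<phi> x * ?rt x) \<le> \<bar>\<phi>u\<bar> * norm (?rt x)" if "x \<in> space M" for x
              using phi_bounds(1) phi_bounds(2,3)[of x] that by (auto simp: abs_mult intro!: mult_right_mono)
          qed simp
          also have "\<dots> \<le> \<bar>\<phi>u\<bar> * (2 * m)" using rt by (intro mult_left_mono) auto
          finally show "Lp_norm M 2 (\<lambda>x. \<phi> x * ?rt x) \<le> \<bar>\<phi>u\<bar> * (2 * m)" .
        qed (use m in \<open>auto simp: Lp_norm_2_nonneg\<close>)
        finally have cross: "\<bar>L2_inner M (\<lambda>x. \<phi> x * ?rt x) ?r\<bar> \<le> \<bar>\<phi>u\<bar> * (2 * m) * C1 * ?d"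
          by (simp add: mult.assoc)
        have "\<kappa> * ?d\<^sup>2 * energy b (G2 t) \<le> \<kappa> * (?d * ((real N + 1) * \<mu>)) * C2"
          unfolding power2_eq_square
          using \<kappa> coeff_dist_nonneg[of a b] coeff_dist_le[OF a b] C2(3)[OF s2 tT(2)] energy_nonneg_int[OF b] up_pos
          by (intro mult_mono mult_left_mono mult_nonneg_nonneg) auto
        moreover have "L2_inner M (\<lambda>x. \<phi> x * ?rt x) ?r + L2_inner M ?Fd (\<lambda>x. G1 t x - G2 t x) = 0"
          using elim tT(1) by blast
        ultimately have "\<delta> / 2 * L2_inner M ?Fd ?Fd
            \<le> \<kappa> * (?d * ((real N + 1) * \<mu>)) * C2 + \<bar>\<phi>u\<bar> * (2 * m) * C1 * ?d"
          using flux_difference_estimate[OF a b D1(8) D2(8)] cross unfolding \<kappa>_def[symmetric] by linarith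
        also have "\<dots> = \<delta> / 2 * (C * ?d)" using lo_pos by (simp add: C_def algebra_simps)
        finally show "L2_inner M ?Fd ?Fd \<le> C * ?d" using lo_pos by simp
      qed
    qed
  qed
qed

end

section \<open>The continuous dependence theorem\<close>

text \<open>
  Evaluation at an index is continuous in the product topology, so it attains its extrema on
  \<open>D\<close>.
\<close>

lemma compact_admissible_bounds:
  assumes D: "compact D" "D \<subseteq> admissible_coeffs N"
  obtains \<delta> \<mu> where "0 < \<delta>" "0 < \<mu>"
    "\<And>a. a \<in> D \<Longrightarrow> \<delta> \<le> a 0 \<and> \<delta> \<le> a N \<and> (\<forall>i\<le>N. 0 \<le> a i \<and> a i \<le> \<mu>)"
proof (cases "D = {}")
  case True
  then show ?thesis using that[of 1 1] by auto
next
  case False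
  have c: "continuous_on D (\<lambda>a::nat \<Rightarrow> real. a i)" for i
    by (rule continuous_on_subset[OF continuous_on_product_coordinates]) simp
  obtain p where p: "p \<in> D" "\<And>a. a \<in> D \<Longrightarrow> p 0 \<le> a 0"
    using continuous_attains_inf[OF D(1) False c[of 0]] by blast
  obtain q where q: "q \<in> D" "\<And>a. a \<in> D \<Longrightarrow> q N \<le> a N"
    using continuous_attains_inf[OF D(1) False c[of N]] by blast
  have "continuous_on D (\<lambda>a. \<Sum>i\<le>N. \<bar>a i\<bar>)" by (intro continuous_intros c)
  then obtain r where r: "\<And>a. a \<in> D \<Longrightarrow> (\<Sum>i\<le>N. \<bar>a i\<bar>) \<le> (\<Sum>i\<le>N. \<bar>r i\<bar>)"
    using continuous_attains_sup[OF D(1) False] by blast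
  show ?thesis
  proof (rule that[of "min (p 0) (q N)" "1 + (\<Sum>i\<le>N. \<bar>r i\<bar>)"])
    show "0 < min (p 0) (q N)" using p(1) q(1) D(2) by (auto simp: admissible_coeffs_def)
    show "0 < 1 + (\<Sum>i\<le>N. \<bar>r i\<bar>)" by (simp add: add_pos_nonneg sum_nonneg)
    fix a assume a: "a \<in> D"
    have nn: "0 \<le> a i" if "i \<le> N" for i
    proof -
      have "i = 0 \<or> i = N \<or> i \<in> {1..<N}" using that by auto
      then show ?thesis using a D(2) by (auto simp: admissible_coeffs_def)
    qed
    have "a i \<le> 1 + (\<Sum>i\<le>N. \<bar>r i\<bar>)" if "i \<le> N" for i
    proof -
      have "a i \<le> \<bar>a i\<bar>" by simp
      also have "\<dots> \<le> (\<Sum>i\<le>N. \<bar>a i\<bar>)" using that by (intro member_le_sum[of i "{..N}" "\<lambda>i. \<bar>a i\<bar>"]) auto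
      finally show ?thesis using r[OF a] by simp
    qed
    then show "min (p 0) (q N) \<le> a 0 \<and> min (p 0) (q N) \<le> a N \<and> (\<forall>i\<le>N. 0 \<le> a i \<and> a i \<le> 1 + (\<Sum>i\<le>N. \<bar>r i\<bar>))"
      using p(2)[OF a] q(2)[OF a] nn by auto
  qed
qed

lemma trace_operator_L1:
  fixes U :: "(real^'d) set"
  assumes U: "open U" "bounded U" and tr: "trace_operator U tr"
  obtains Ct where "0 \<le> Ct"
    "\<And>r Gr. sobolev U 2 r Gr \<Longrightarrow> integrable (surface_measure (frontier U)) (tr r)"
    "\<And>r Gr. sobolev U 2 r Gr \<Longrightarrow>
        (\<integral>x. \<bar>tr r x\<bar> \<partial>surface_measure (frontier U))
          \<le> Ct * ((\<integral>x. \<bar>r x\<bar> \<partial>lebesgue_on U) + (\<integral>x. norm (Gr x) \<partial>lebesgue_on U))"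
    "\<And>u v G H c. sobolev U 2 u G \<Longrightarrow> sobolev U 2 v H \<Longrightarrow>
        AE x in surface_measure (frontier U). tr (\<lambda>y. u y + c * v y) x = tr u x + c * tr v x"
proof -
  from tr have lin: "\<And>u v G H c. sobolev U 1 u G \<Longrightarrow> sobolev U 1 v H \<Longrightarrow>
        AE x in surface_measure (frontier U). tr (\<lambda>y. u y + c * v y) x = tr u x + c * tr v x"
    and "\<forall>p\<ge>1. \<exists>C. \<forall>u G. sobolev U p u G \<longrightarrow>
        in_Lp (surface_measure (frontier U)) p (tr u) \<and>
        Lp_norm (surface_measure (frontier U)) p (tr u)
          \<le> C * (Lp_norm (lebesgue_on U) p u + Lp_norm (lebesgue_on U) p G)"
    unfolding trace_operator_def by blast+
  then obtain C where C: "\<And>u G. sobolev U 1 u G \<Longrightarrow>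
        in_Lp (surface_measure (frontier U)) 1 (tr u) \<and>
        Lp_norm (surface_measure (frontier U)) 1 (tr u)
          \<le> C * (Lp_norm (lebesgue_on U) 1 u + Lp_norm (lebesgue_on U) 1 G)"
    by (meson order_refl)
  note s1 = sobolev_1_of_2[OF U]
  show ?thesis
  proof (rule that[of "\<bar>C\<bar>"])
    fix r :: "real^'d \<Rightarrow> real" and Gr assume r: "sobolev U 2 r Gr"
    show "integrable (surface_measure (frontier U)) (tr r)"
      using C[OF s1[OF r]] integrable_norm_iff[of "tr r" "surface_measure (frontier U)"] by (simp add: in_L1_iff)
    have "(\<integral>x. \<bar>tr r x\<bar> \<partial>surface_measure (frontier U))
        \<le> C * ((\<integral>x. \<bar>r x\<bar> \<partial>lebesgue_on U) + (\<integral>x. norm (Gr x) \<partial>lebesgue_on U))"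
      using C[OF s1[OF r]] by (simp add: Lp_norm_1)
    also have "\<dots> \<le> \<bar>C\<bar> * ((\<integral>x. \<bar>r x\<bar> \<partial>lebesgue_on U) + (\<integral>x. norm (Gr x) \<partial>lebesgue_on U))"
      by (intro mult_right_mono add_nonneg_nonneg integral_nonneg_AE) auto
    finally show "(\<integral>x. \<bar>tr r x\<bar> \<partial>surface_measure (frontier U))
        \<le> \<bar>C\<bar> * ((\<integral>x. \<bar>r x\<bar> \<partial>lebesgue_on U) + (\<integral>x. norm (Gr x) \<partial>lebesgue_on U))" .
  next
    fix u v :: "real^'d \<Rightarrow> real" and G H and c :: real assume "sobolev U 2 u G" "sobolev U 2 v H"
    then show "AE x in surface_measure (frontier U). tr (\<lambda>y. u y + c * v y) x = tr u x + c * tr v x"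
      by (intro lin s1)
  qed simp
qed

lemma esssup_interval_nonneg:
  fixes n :: "real \<Rightarrow> real"
  assumes st: "s < t" and n: "\<And>x. 0 \<le> n x"
  shows "0 \<le> esssup (lebesgue_on {s<..<t}) (\<lambda>x. ereal (n x))"
proof (rule ccontr)
  assume neg: "\<not> ?thesis"
  have "AE x in lebesgue_on {s<..<t}. False"
    using esssup_AE[of "\<lambda>x. ereal (n x)" "lebesgue_on {s<..<t}"]
  proof eventually_elim
    case (elim x)
    then show ?case using neg n[of x] by (metis ereal_less_eq(5) order_trans)
  qed
  then have "emeasure (lebesgue_on {s<..<t}) (space (lebesgue_on {s<..<t})) = 0"
    unfolding ae_filter_eq_bot_iff[symmetric] eventually_False .
  then show False using st by (simp add: emeasure_restrict_space)
qed

lemma in_Hdiv_L2: "in_Hdiv U z \<Longrightarrow> in_Lp (lebesgue_on U) 2 z"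
  by (simp add: in_Hdiv_def)

context flow
begin

text \<open>
  The flux law holds only for almost every time, and there only almost everywhere in space; this is
  enough to replace \<open>m\<close> in the second equation.
\<close>

lemma weak_solution_imp_solution:
  assumes f: "AE t in lborel. t \<in> {0<..<T} \<longrightarrow>
      (\<forall>r. r \<in> borel_measurable M \<longrightarrow> L2_inner M (f t) r = L2_inner M (f0 t) r)"
    and a: "a \<in> coeffs" and w: "weak_solution N \<alpha> U tr T \<phi> f \<psi> \<rho>0 a m \<rho>"
  obtains G \<rho>t Gt where "solution a \<rho> G \<rho>t Gt"
    "AE t in lborel. t \<in> {0<..<T} \<longrightarrow> (AE x in M. m t x = - F a (G t x))"
proof -
  from w obtain G \<rho>t Gt where c: "C1_time_H1 U T \<rho> G \<rho>t Gt" and m: "\<And>t. t \<in> {0<..<T} \<Longrightarrow> in_Hdiv U (m t)"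
    and init: "L2_tendsto M \<rho> \<rho>0 (at_right 0)"
    and ae: "AE t in lebesgue_on {0<..<T}.
           (\<forall>z. in_Hdiv U z \<longrightarrow> L2_inner M (m t) z
              + L2_inner M (\<lambda>x. forch_K N \<alpha> (norm (G t x)) a *\<^sub>R G t x) z = 0) \<and>
           (\<forall>r Gr. sobolev U 2 r Gr \<longrightarrow>
              L2_inner M (\<lambda>x. \<phi> x * \<rho>t t x) r - L2_inner M (m t) Gr
              = L2_inner M (f t) r - L2_inner S (\<psi> t) (tr r))"
    unfolding weak_solution_def by blast
  have eqs: "AE t in lborel. t \<in> {0<..<T} \<longrightarrow>
           (\<forall>z. in_Hdiv U z \<longrightarrow> L2_inner M (m t) z + L2_inner M (\<lambda>x. F a (G t x)) z = 0) \<and>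
           (\<forall>r Gr. sobolev U 2 r Gr \<longrightarrow>
              L2_inner M (\<lambda>x. \<phi> x * \<rho>t t x) r - L2_inner M (m t) Gr
              = L2_inner M (f t) r - L2_inner S (\<psi> t) (tr r))"
    unfolding forch_flux_def by (rule iffD1[OF lebesgue_on_AE_iff ae]) simp
  note D = C1_time_H1D[OF c]
  have mF: "AE x in M. m t x = - F a (G t x)"
    if t: "t \<in> {0<..<T}" and z: "\<forall>z. in_Hdiv U z \<longrightarrow> L2_inner M (m t) z + L2_inner M (\<lambda>x. F a (G t x)) z = 0" for t
  proof -
    note L = in_Hdiv_L2[OF m[OF t]] flux_L2[OF a D(8)[OF t]]
    have "AE x in M. m t x + F a (G t x) = 0"
    proof (rule Hdiv_orthogonal_zero[OF U in_L2_add[OF L]])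
      fix z assume "in_Hdiv U z"
      then show "L2_inner M (\<lambda>x. m t x + F a (G t x)) z = 0"
        using z by (simp add: L2_inner_add_left[OF L in_Hdiv_L2])
    qed
    then show ?thesis by eventually_elim (simp add: eq_neg_iff_add_eq_0)
  qed
  show ?thesis
  proof (rule that)
    show "AE t in lborel. t \<in> {0<..<T} \<longrightarrow> (AE x in M. m t x = - F a (G t x))"
      using eqs by eventually_elim (use mF in blast)
    have "AE t in lborel. t \<in> {0<..<T} \<longrightarrow> (\<forall>r Gr. sobolev U 2 r Gr \<longrightarrow>
        L2_inner M (\<lambda>x. \<phi> x * \<rho>t t x) r + L2_inner M (\<lambda>x. F a (G t x)) Gr
          = L2_inner M (f0 t) r - L2_inner S (\<psi> t) (tr r))"
      using eqs f
    proof eventually_elim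
      case (elim t)
      show ?case
      proof (intro impI allI)
        fix r Gr assume t: "t \<in> {0<..<T}" and r: "sobolev U 2 r Gr"
        have L: "in_Lp M 2 r" "in_Lp M 2 Gr" using r by (auto simp: sobolev_def)
        note LF = flux_L2[OF a D(8)[OF t]]
        have "L2_inner M (m t) Gr = L2_inner M (\<lambda>x. - F a (G t x)) Gr"
          using elim(1) t in_L2_measurable[OF LF] in_L2_measurable[OF in_Hdiv_L2[OF m[OF t]]] in_L2_measurable[OF L(2)]
          by (intro L2_inner_cong_AE mF) auto
        also have "\<dots> = - L2_inner M (\<lambda>x. F a (G t x)) Gr"
          using L2_inner_scale_left[of M "-1" "\<lambda>x. F a (G t x)" Gr] by simp
        finally have "L2_inner M (m t) Gr = - L2_inner M (\<lambda>x. F a (G t x)) Gr" .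
        moreover have "L2_inner M (\<lambda>x. \<phi> x * \<rho>t t x) r - L2_inner M (m t) Gr
            = L2_inner M (f t) r - L2_inner S (\<psi> t) (tr r)"
          using elim(1) t r by blast
        moreover have "L2_inner M (f t) r = L2_inner M (f0 t) r"
          using elim(2) t in_L2_measurable[OF L(1)] by blast
        ultimately show "L2_inner M (\<lambda>x. \<phi> x * \<rho>t t x) r + L2_inner M (\<lambda>x. F a (G t x)) Gr
          = L2_inner M (f0 t) r - L2_inner S (\<psi> t) (tr r)"
          by linarith
      qed
    qed
    then show "solution a \<rho> G \<rho>t Gt" using a c init by (simp add: solution_def)
  qed
qed

lemma L2_norm_diff_continuous:
  fixes u v :: "real \<Rightarrow> real^'d \<Rightarrow> 'b::euclidean_space"
  assumes u: "\<And>t. t \<in> {0<..<T} \<Longrightarrow> in_Lp M 2 (u t)" "\<And>t. t \<in> {0<..<T} \<Longrightarrow> L2_tendsto M u (u t) (at t)"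
    and v: "\<And>t. t \<in> {0<..<T} \<Longrightarrow> in_Lp M 2 (v t)" "\<And>t. t \<in> {0<..<T} \<Longrightarrow> L2_tendsto M v (v t) (at t)"
  shows "continuous_on {0<..<T} (\<lambda>t. Lp_norm M 2 (\<lambda>x. u t x - v t x))"
proof (rule continuous_at_imp_continuous_on, rule ballI)
  fix t assume t: "t \<in> {0<..<T}"
  have ev: "eventually (\<lambda>s. in_Lp M 2 (u s)) (at t)" "eventually (\<lambda>s. in_Lp M 2 (v s)) (at t)"
    using eventually_at_Ioo[OF t] u(1) v(1) by (auto elim: eventually_mono)
  have d: "L2_tendsto M (\<lambda>s x. u s x - v s x) (\<lambda>x. u t x - v t x) (at t)"
    by (rule L2_tendsto_diff[OF u(2)[OF t] v(2)[OF t] ev u(1)[OF t] v(1)[OF t]])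
  have evd: "eventually (\<lambda>s. in_Lp M 2 (\<lambda>x. u s x - v s x)) (at t)"
    using ev by eventually_elim (rule in_L2_diff)
  have "((\<lambda>s. sqrt (L2_inner M (\<lambda>x. u s x - v s x) (\<lambda>x. u s x - v s x)))
      \<longlongrightarrow> sqrt (L2_inner M (\<lambda>x. u t x - v t x) (\<lambda>x. u t x - v t x))) (at t)"
    by (intro tendsto_real_sqrt L2_tendsto_inner d evd in_L2_diff u(1) v(1) t)
  moreover have "sqrt (L2_inner M w w) = Lp_norm M 2 w" for w :: "real^'d \<Rightarrow> 'b"
    by (simp add: Lp_norm_2_power2[symmetric] Lp_norm_2_nonneg)
  ultimately show "isCont (\<lambda>t. Lp_norm M 2 (\<lambda>x. u t x - v t x)) t"
    by (simp add: isCont_def)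
qed

text \<open>
  The norms in the statement are essential suprema, which are infinite for non-measurable functions.
  Both functions of time are measurable: the first is continuous, the second agrees almost everywhere
  with a continuous one.
\<close>

lemma continuous_dependence:
  assumes f: "AE t in lborel. t \<in> {0<..<T} \<longrightarrow>
      (\<forall>r. r \<in> borel_measurable M \<longrightarrow> L2_inner M (f t) r = L2_inner M (f0 t) r)"
    and ts: "0 < ts" "ts < T"
  obtains C where "0 < C"
    "\<And>a b m1 \<rho>1 m2 \<rho>2. a \<in> coeffs \<Longrightarrow> b \<in> coeffs \<Longrightarrow>
       weak_solution N \<alpha> U tr T \<phi> f \<psi> \<rho>0 a m1 \<rho>1 \<Longrightarrow> weak_solution N \<alpha> U tr T \<phi> f \<psi> \<rho>0 b m2 \<rho>2 \<Longrightarrow>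
       Linf_L2_norm 0 T U (\<lambda>t x. \<rho>1 t x - \<rho>2 t x) + (Linf_L2_norm ts T U (\<lambda>t x. m1 t x - m2 t x))\<^sup>2
         \<le> ereal (C * coeff_dist N a b)"
proof -
  obtain C1 where C1: "0 \<le> C1"
    "\<And>a \<rho>1 G1 \<rho>t1 Gt1 b \<rho>2 G2 \<rho>t2 Gt2 t. solution a \<rho>1 G1 \<rho>t1 Gt1 \<Longrightarrow> solution b \<rho>2 G2 \<rho>t2 Gt2 \<Longrightarrow>
       t \<in> {0<..<T} \<Longrightarrow> Lp_norm M 2 (\<lambda>x. \<rho>1 t x - \<rho>2 t x) \<le> C1 * coeff_dist N a b"
    by (rule density_comparison) (rule that)
  obtain C2 where C2: "0 \<le> C2"
    "\<And>a \<rho>1 G1 \<rho>t1 Gt1 b \<rho>2 G2 \<rho>t2 Gt2. solution a \<rho>1 G1 \<rho>t1 Gt1 \<Longrightarrow> solution b \<rho>2 G2 \<rho>t2 Gt2 \<Longrightarrow>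
       AE t in lborel. t \<in> {ts<..<T} \<longrightarrow>
         L2_inner M (\<lambda>x. F a (G1 t x) - F b (G2 t x)) (\<lambda>x. F a (G1 t x) - F b (G2 t x)) \<le> C2 * coeff_dist N a b"
    by (rule flux_comparison[OF ts]) (rule that)
  show ?thesis
  proof (rule that[of "C1 + C2 + 1"])
    show "0 < C1 + C2 + 1" using C1 C2 by simp
    fix a b m1 \<rho>1 m2 \<rho>2
    assume a: "a \<in> coeffs" and b: "b \<in> coeffs"
      and w1: "weak_solution N \<alpha> U tr T \<phi> f \<psi> \<rho>0 a m1 \<rho>1" and w2: "weak_solution N \<alpha> U tr T \<phi> f \<psi> \<rho>0 b m2 \<rho>2"
    obtain G1 \<rho>t1 Gt1 where s1: "solution a \<rho>1 G1 \<rho>t1 Gt1"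
      and m1: "AE t in lborel. t \<in> {0<..<T} \<longrightarrow> (AE x in M. m1 t x = - F a (G1 t x))"
      by (rule weak_solution_imp_solution[OF f a w1]) (rule that)
    obtain G2 \<rho>t2 Gt2 where s2: "solution b \<rho>2 G2 \<rho>t2 Gt2"
      and m2: "AE t in lborel. t \<in> {0<..<T} \<longrightarrow> (AE x in M. m2 t x = - F b (G2 t x))"
      by (rule weak_solution_imp_solution[OF f b w2]) (rule that)
    note c1 = solutionD(2)[OF s1] and c2 = solutionD(2)[OF s2]
    note D1 = C1_time_H1D[OF c1] and D2 = C1_time_H1D[OF c2]
    define d where "d = coeff_dist N a b"
    have d: "0 \<le> d" unfolding d_def by (rule coeff_dist_nonneg)
    have rho: "Linf_L2_norm 0 T U (\<lambda>t x. \<rho>1 t x - \<rho>2 t x) \<le> ereal (C1 * d)"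
      unfolding Linf_L2_norm_def
    proof (rule esssup_I)
      have "continuous_on {0<..<T} (\<lambda>t. Lp_norm M 2 (\<lambda>x. \<rho>1 t x - \<rho>2 t x))"
        by (rule L2_norm_diff_continuous[OF D1(7) rho_continuous(1)[OF c1] D2(7) rho_continuous(1)[OF c2]])
      then show "(\<lambda>t. ereal (Lp_norm M 2 (\<lambda>x. \<rho>1 t x - \<rho>2 t x))) \<in> borel_measurable (lebesgue_on {0<..<T})"
        by (intro borel_measurable_ereal continuous_imp_measurable_on_sets_lebesgue) auto
      show "AE t in lebesgue_on {0<..<T}. ereal (Lp_norm M 2 (\<lambda>x. \<rho>1 t x - \<rho>2 t x)) \<le> ereal (C1 * d)"
        using C1(2)[OF s1 s2] by (intro AE_I2) (simp add: d_def)
    qed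
    let ?n = "\<lambda>t. Lp_norm M 2 (\<lambda>x. m1 t x - m2 t x)"
    let ?k = "\<lambda>t. Lp_norm M 2 (\<lambda>x. F a (G1 t x) - F b (G2 t x))"
    have nk: "AE t in lborel. t \<in> {0<..<T} \<longrightarrow> ?n t = ?k t"
      using m1 m2
    proof eventually_elim
      case (elim t)
      show ?case
      proof
        assume t: "t \<in> {0<..<T}"
        have mm: "m1 t \<in> borel_measurable M" "m2 t \<in> borel_measurable M"
          using w1 w2 t by (auto simp: weak_solution_def in_Hdiv_def in_L2_iff)
        note FF = in_L2_measurable[OF flux_L2[OF a D1(8)[OF t]]] in_L2_measurable[OF flux_L2[OF b D2(8)[OF t]]]
        have "(\<integral>x. (norm (m1 t x - m2 t x))\<^sup>2 \<partial>M) = (\<integral>x. (norm (F a (G1 t x) - F b (G2 t x)))\<^sup>2 \<partial>M)"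
        proof (rule integral_cong_AE)
          show "(\<lambda>x. (norm (m1 t x - m2 t x))\<^sup>2) \<in> borel_measurable M" using mm by measurable
          show "(\<lambda>x. (norm (F a (G1 t x) - F b (G2 t x)))\<^sup>2) \<in> borel_measurable M" using FF by measurable
          have "AE x in M. m1 t x = - F a (G1 t x)" "AE x in M. m2 t x = - F b (G2 t x)" using elim t by auto
          then show "AE x in M. (norm (m1 t x - m2 t x))\<^sup>2 = (norm (F a (G1 t x) - F b (G2 t x)))\<^sup>2"
            by eventually_elim (simp add: norm_minus_commute)
        qed
        then show "?n t = ?k t" by (simp add: Lp_norm_2)
      qed
    qed
    have "continuous_on {0<..<T} ?k"
      using flux_tendsto[OF a rho_continuous(2)[OF c1] solution_ev(2)[OF c1] D1(8)]
        flux_tendsto[OF b rho_continuous(2)[OF c2] solution_ev(2)[OF c2] D2(8)]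
      by (intro L2_norm_diff_continuous flux_L2[OF a] flux_L2[OF b] D1(8) D2(8)) auto
    then have "continuous_on {ts<..<T} ?k" by (rule continuous_on_subset) (use ts in auto)
    then have km: "?k \<in> borel_measurable (lebesgue_on {ts<..<T})"
      by (intro continuous_imp_measurable_on_sets_lebesgue) auto
    have nk': "AE t in lebesgue_on {ts<..<T}. ?n t = ?k t"
      using nk ts by (subst lebesgue_on_AE_iff) (auto elim: eventually_mono)
    have flux: "Linf_L2_norm ts T U (\<lambda>t x. m1 t x - m2 t x) \<le> ereal (sqrt (C2 * d))"
      unfolding Linf_L2_norm_def
    proof (rule esssup_I)
      show "(\<lambda>t. ereal (?n t)) \<in> borel_measurable (lebesgue_on {ts<..<T})"
        by (intro borel_measurable_ereal AE_eq_borel_measurable_lebesgue_on[OF _ km nk']) simp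
      have "AE t in lebesgue_on {ts<..<T}. (?k t)\<^sup>2 \<le> C2 * d"
        using C2(2)[OF s1 s2] by (subst lebesgue_on_AE_iff) (auto simp: Lp_norm_2_power2 d_def)
      with nk' show "AE t in lebesgue_on {ts<..<T}. ereal (?n t) \<le> ereal (sqrt (C2 * d))"
        by eventually_elim (simp add: real_le_rsqrt)
    qed
    have "0 \<le> Linf_L2_norm ts T U (\<lambda>t x. m1 t x - m2 t x)"
      unfolding Linf_L2_norm_def by (rule esssup_interval_nonneg[OF ts(2) Lp_norm_2_nonneg])
    then have "(Linf_L2_norm ts T U (\<lambda>t x. m1 t x - m2 t x))\<^sup>2 \<le> ereal (sqrt (C2 * d)) * ereal (sqrt (C2 * d))"
      unfolding power2_eq_square using flux C2(1) d by (intro ereal_mult_mono) auto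
    also have "\<dots> = ereal (C2 * d)" using C2(1) d by simp
    finally have "Linf_L2_norm 0 T U (\<lambda>t x. \<rho>1 t x - \<rho>2 t x) + (Linf_L2_norm ts T U (\<lambda>t x. m1 t x - m2 t x))\<^sup>2
         \<le> ereal (C1 * d) + ereal (C2 * d)"
      by (intro add_mono rho)
    also have "\<dots> \<le> ereal ((C1 + C2 + 1) * d)" using d by (simp add: algebra_simps)
    finally show "Linf_L2_norm 0 T U (\<lambda>t x. \<rho>1 t x - \<rho>2 t x) + (Linf_L2_norm ts T U (\<lambda>t x. m1 t x - m2 t x))\<^sup>2
         \<le> ereal ((C1 + C2 + 1) * coeff_dist N a b)"
      by (simp add: d_def)
  qed
qed

end

theorem theorem5p1:
  fixes N :: nat and \<alpha> :: "nat \<Rightarrow> real"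
    and \<Omega> :: "(real^'d) set"
    and tr :: "(real^'d \<Rightarrow> real) \<Rightarrow> (real^'d \<Rightarrow> real)"
    and T tstar \<phi>l \<phi>u :: real
    and \<phi> \<rho>0 :: "real^'d \<Rightarrow> real"
    and f \<psi> :: "real \<Rightarrow> real^'d \<Rightarrow> real"
    and D :: "(nat \<Rightarrow> real) set"
  assumes "N \<ge> 1" and "\<alpha> 0 = 0" and "strict_mono_on {..N} \<alpha>"
    and "CARD('d) \<ge> 2"
    and "open \<Omega>" and "connected \<Omega>" and "bounded \<Omega>" and "\<Omega> \<noteq> {}"
    and "trace_operator \<Omega> tr"
    and "0 < tstar" and "tstar < T"
    and "Ck_on 1 \<Omega> \<phi>" and "0 < \<phi>l" and "\<forall>x\<in>\<Omega>. \<phi>l < \<phi> x \<and> \<phi> x < \<phi>u"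
    and "smooth_on \<Omega> \<rho>0"
    and "boundary_data (frontier \<Omega>) T \<psi>"
    and "source_data \<Omega> T f"
    and "compact D" and "D \<subseteq> admissible_coeffs N"
  shows "\<exists>C>0. \<forall>a1\<in>D. \<forall>a2\<in>D. \<forall>m1 \<rho>1 m2 \<rho>2.
           weak_solution N \<alpha> \<Omega> tr T \<phi> f \<psi> \<rho>0 a1 m1 \<rho>1 \<longrightarrow>
           weak_solution N \<alpha> \<Omega> tr T \<phi> f \<psi> \<rho>0 a2 m2 \<rho>2 \<longrightarrow>
           Linf_L2_norm 0 T \<Omega> (\<lambda>t x. \<rho>1 t x - \<rho>2 t x)
           + (Linf_L2_norm tstar T \<Omega> (\<lambda>t x. m1 t x - m2 t x))\<^sup>2
           \<le> ereal (C * coeff_dist N a1 a2)"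
proof (cases "in_Lp (lebesgue_on \<Omega>) 2 \<rho>0")
  case False
  then show ?thesis by (intro exI[of _ 1]) (auto simp: weak_solution_def)
next
  case True
  note U = \<open>open \<Omega>\<close> \<open>bounded \<Omega>\<close>
  obtain \<delta> \<mu> where dm: "0 < \<delta>" "0 < \<mu>"
    "\<And>a. a \<in> D \<Longrightarrow> \<delta> \<le> a 0 \<and> \<delta> \<le> a N \<and> (\<forall>i\<le>N. 0 \<le> a i \<and> a i \<le> \<mu>)"
    by (rule compact_admissible_bounds[OF \<open>compact D\<close> \<open>D \<subseteq> admissible_coeffs N\<close>]) (rule that)
  have G: "compact (frontier \<Omega>)" using U by (simp add: compact_frontier_bounded)
  obtain \<Psi> \<psi>t where psi: "0 \<le> \<Psi>"
    "\<And>t. t \<in> {0<..<T} \<Longrightarrow> continuous_on (frontier \<Omega>) (\<psi> t)" "\<And>t. t \<in> {0<..<T} \<Longrightarrow> continuous_on (frontier \<Omega>) (\<psi>t t)"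
    "\<And>t x. t \<in> {0<..<T} \<Longrightarrow> x \<in> frontier \<Omega> \<Longrightarrow> \<bar>\<psi> t x\<bar> \<le> \<Psi>"
    "\<And>t x. t \<in> {0<..<T} \<Longrightarrow> x \<in> frontier \<Omega> \<Longrightarrow> \<bar>\<psi>t t x\<bar> \<le> \<Psi>"
    "\<And>s t x. s \<in> {0<..<T} \<Longrightarrow> t \<in> {0<..<T} \<Longrightarrow> x \<in> frontier \<Omega> \<Longrightarrow> \<bar>\<psi> s x - \<psi> t x\<bar> \<le> \<Psi> * \<bar>s - t\<bar>"
    "\<And>t x. t \<in> {0<..<T} \<Longrightarrow> x \<in> frontier \<Omega> \<Longrightarrow> ((\<lambda>s. \<psi> s x) has_real_derivative \<psi>t t x) (at t)"
    by (rule boundary_data_bounds[OF G \<open>boundary_data (frontier \<Omega>) T \<psi>\<close>]) (rule that)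
  obtain Ct where Ct: "0 \<le> Ct"
    "\<And>r Gr. sobolev \<Omega> 2 r Gr \<Longrightarrow> integrable (surface_measure (frontier \<Omega>)) (tr r)"
    "\<And>r Gr. sobolev \<Omega> 2 r Gr \<Longrightarrow>
        (\<integral>x. \<bar>tr r x\<bar> \<partial>surface_measure (frontier \<Omega>))
          \<le> Ct * ((\<integral>x. \<bar>r x\<bar> \<partial>lebesgue_on \<Omega>) + (\<integral>x. norm (Gr x) \<partial>lebesgue_on \<Omega>))"
    "\<And>u v G H c. sobolev \<Omega> 2 u G \<Longrightarrow> sobolev \<Omega> 2 v H \<Longrightarrow>
        AE x in surface_measure (frontier \<Omega>). tr (\<lambda>y. u y + c * v y) x = tr u x + c * tr v x"
    by (rule trace_operator_L1[OF U \<open>trace_operator \<Omega> tr\<close>]) (rule that)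
  obtain f0 Kf where f0:
    "AE t in lborel. t \<in> {0<..<T} \<longrightarrow> in_Lp (lebesgue_on \<Omega>) 2 (f0 t) \<and>
        (\<forall>r. r \<in> borel_measurable (lebesgue_on \<Omega>) \<longrightarrow> L2_inner (lebesgue_on \<Omega>) (f t) r = L2_inner (lebesgue_on \<Omega>) (f0 t) r)"
    "integrable lborel (\<lambda>t. L2_inner (lebesgue_on \<Omega>) (f0 t) (f0 t))"
    "0 \<le> Kf"
    "\<And>h. 0 \<le> h \<Longrightarrow> integrable lborel (\<lambda>t. indicator {0<..<T - h} t *
         L2_inner (lebesgue_on \<Omega>) (\<lambda>x. f0 (t + h) x - f0 t x) (\<lambda>x. f0 (t + h) x - f0 t x))"
    "\<And>h. 0 \<le> h \<Longrightarrow> (\<integral>t. indicator {0<..<T - h} t *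
         L2_inner (lebesgue_on \<Omega>) (\<lambda>x. f0 (t + h) x - f0 t x) (\<lambda>x. f0 (t + h) x - f0 t x) \<partial>lborel) \<le> h\<^sup>2 * Kf"
    by (rule source_slices[OF U \<open>source_data \<Omega> T f\<close>]) (rule that)
  have "Ck_on 0 \<Omega> \<phi>" using Ck_on_Suc_imp[of 0 \<Omega> \<phi>] \<open>Ck_on 1 \<Omega> \<phi>\<close> by simp
  then have phi_m: "\<phi> \<in> borel_measurable (lebesgue_on \<Omega>)"
    using U by (intro continuous_imp_measurable_on_sets_lebesgue) auto
  have forch: "forchheimer N \<alpha> \<delta> \<mu>"
  proof (rule forchheimer.intro)
    show "0 < \<alpha> i" if "i \<in> {1..N}" for i
      using strict_mono_onD[OF \<open>strict_mono_on {..N} \<alpha>\<close>, of 0 i] \<open>\<alpha> 0 = 0\<close> that by simp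
    show "\<alpha> i \<le> \<alpha> N" if "i \<in> {1..N}" for i
      using strict_mono_onD[OF \<open>strict_mono_on {..N} \<alpha>\<close>, of i N] that by (cases "i = N") auto
  qed (fact \<open>N \<ge> 1\<close> dm)+
  have bdry: "boundary \<Omega> tr T Ct \<Psi> \<psi> \<psi>t"
  proof (rule boundary.intro)
    show "\<psi> t \<in> borel_measurable (surface_measure (frontier \<Omega>))"
      "\<psi>t t \<in> borel_measurable (surface_measure (frontier \<Omega>))" if "t \<in> {0<..<T}" for t
      by (rule surface_measure_measurable, rule psi(2)[OF that], rule surface_measure_measurable, rule psi(3)[OF that])
  qed (fact U Ct psi)+
  have f0_L2: "AE t in lborel. t \<in> {0<..<T} \<longrightarrow> in_Lp (lebesgue_on \<Omega>) 2 (f0 t)"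
    using f0(1) by eventually_elim blast
  have ax: "flow_axioms \<Omega> T \<phi> \<phi>l \<phi>u f0 Kf \<rho>0"
  proof (rule flow_axioms.intro)
    show "0 < T" using \<open>0 < tstar\<close> \<open>tstar < T\<close> by simp
    show "\<phi>l \<le> \<phi> x" "\<phi> x \<le> \<phi>u" if "x \<in> \<Omega>" for x
      using \<open>\<forall>x\<in>\<Omega>. \<phi>l < \<phi> x \<and> \<phi> x < \<phi>u\<close> that by (auto intro: less_imp_le)
  qed (fact phi_m \<open>0 < \<phi>l\<close> f0_L2 f0 True)+
  interpret flow N \<alpha> \<delta> \<mu> \<Omega> tr T Ct \<Psi> \<psi> \<psi>t \<phi> \<phi>l \<phi>u f0 Kf \<rho>0
    by (rule flow.intro[OF forch bdry ax])
  have f: "AE t in lborel. t \<in> {0<..<T} \<longrightarrow>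
      (\<forall>r. r \<in> borel_measurable (lebesgue_on \<Omega>) \<longrightarrow> L2_inner (lebesgue_on \<Omega>) (f t) r = L2_inner (lebesgue_on \<Omega>) (f0 t) r)"
    using f0(1) by eventually_elim blast
  obtain C where C: "0 < C"
    "\<And>a b m1 \<rho>1 m2 \<rho>2. a \<in> coeffs \<Longrightarrow> b \<in> coeffs \<Longrightarrow>
       weak_solution N \<alpha> \<Omega> tr T \<phi> f \<psi> \<rho>0 a m1 \<rho>1 \<Longrightarrow> weak_solution N \<alpha> \<Omega> tr T \<phi> f \<psi> \<rho>0 b m2 \<rho>2 \<Longrightarrow>
       Linf_L2_norm 0 T \<Omega> (\<lambda>t x. \<rho>1 t x - \<rho>2 t x) + (Linf_L2_norm tstar T \<Omega> (\<lambda>t x. m1 t x - m2 t x))\<^sup>2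
         \<le> ereal (C * coeff_dist N a b)"
    by (rule continuous_dependence[OF f \<open>0 < tstar\<close> \<open>tstar < T\<close>]) (rule that)
  have "D \<subseteq> coeffs" using dm(3) by (auto simp: coeffs_def)
  with C show ?thesis by blast
qed

end
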